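(* For $s\in(0,1)$, consider the Manneville-Pomeau map $T_s:\mathbb T\to\mathbb T$, $T_s(x)=x+x^{s+1}\bmod 1$. Suppose $0<s<\alpha<1$ and $\beta\ge0$, and let $f\in\mathscr C_{\omega_{\alpha,\beta}}(\mathbb T)$. Then the transfer operator $\mathscr L_f$ satisfies the Ruelle-Perron-Frobenius theorem on $\mathscr C_{\omega_{\alpha-s,\beta}}(\mathbb T)$, that is: (i) there are a Borel probability measure $\nu$ on $\mathbb T$ and a constant $\chi>0$ with $\mathscr L_f^*\nu=\chi\nu$; (ii) $\chi$ is a simple eigenvalue of $\mathscr L_f$, and there is a positive function $h\in\mathscr C_{\omega_{\alpha-s,\beta}}(\mathbb T)$ with $\mathscr L_fh=\chi h$; (iii) $\mathscr L_f$, acting on complex-valued continuous functions, has no eigenvalue $c\ne\chi$ with $|c|\ge\chi$; (iv) if $h$ is normalized by $\int h\,d\nu=1$, then for every continuous $\phi$ the sequence $\chi^{-n}\mathscr L_f^n\phi$ converges uniformly on $\mathbb T$ to $h\int\phi\,d\nu$. Furthermore, with $\int h\,d\nu=1$, the $T_s$-invariant probability $\mu=h\nu$ is the unique Gibbs-equilibrium state associated with $f$: $h_\mu(T_s)+\int f\,d\mu=\log\chi=P(T_s,f)$; $h_m(T_s)+\int f\,dm<P(T_s,f)$ for every $m\in M(\mathbb T,T_s)$ with $m\neq\mu$; and for every sufficiently small $r>0$ there is $K_r>0$ such that, for all $x\in\mathbb T$ and $n\ge1$, $$K_r^{-1}\le\frac{\mu\big(\{y\in\mathbb T: d(T_s^j(x),T_s^j(y))<r,\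 0\le j\le n\}\big)}{e^{S_nf(x)-nP(T_s,f)}}\le K_r .$$
   Context: $\mathbb T=\mathbb R/\mathbb Z=[0,1)$ is the circle with metric $d(x,y)=\min\{|x-y|,|x-y\pm1|\}$. For $0\le\alpha<1$, $\beta\ge0$ with $\alpha+\beta>0$, the modulus of continuity $\omega_{\alpha,\beta}:[0,+\infty)\to[0,+\infty)$ is defined by $\omega_{\alpha,\beta}(0)=0$, $\omega_{\alpha,\beta}(x)=x^\alpha(-\log x)^{-\beta}$ for $0<x<x_0$, and $\omega_{\alpha,\beta}(x)=x_0^\alpha(-\log x_0)^{-\beta}$ for $x\ge x_0$, where $x_0=x_0(\alpha,\beta)$ is taken small enough that $\omega_{\alpha,\beta}$ is concave (and non-decreasing). For a concave modulus of continuity $\omega$ (concave, continuous, non-decreasing on $[0,+\infty)$ with $\omega(0)=0$), $\mathscr C_\omega(\mathbb T)$ is the linear space of functions $\varphi:\mathbb T\to\mathbb R$ for which there is $C>0$ with $|\varphi(x)-\varphi(y)|\le C\,\omega(d(x,y))$ for all $x,y\in\mathbb T$. Transfer operator: $\mathscr L_f\phi(x)=\sum_{y\in T_s^{-1}(x)}e^{f(y)}\phi(y)$ for continuous $\phi$. The dual $\mathscr L_f^*$ acts on finite signed Borel measures by $\int\phi\,d(\mathscr L_f^*m)=\int\mathscr L_f\phi\,dm$ for all continuous $\phi$. Birkhoff sums: $S_nf=\sum_{j=0}^{n-1}f\circ T_s^j$. $M(\mathbb T,T_s)$ is the set of $T_s$-invariant Borel probability measures, $h_m(T_s)$ is the metric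 entropy, and $P(T_s,f)=\sup_{m\in M(\mathbb T,T_s)}\{h_m(T_s)+\int f\,dm\}$ is the topological pressure. The measure $h\nu$ is the one with density $h$ with respect to $\nu$. *)

theory Defs
  imports "HOL-Probability.Probability"
begin

typedef circle = "{0..<1::real}"
  morphisms rep_circle of_rep_circle
  by (rule exI[of _ 0]) simp

instantiation circle :: metric_space
begin

definition dist_circle :: "circle \<Rightarrow> circle \<Rightarrow> real" where
  "dist_circle x y =
     min \<bar>rep_circle x - rep_circle y\<bar>
       (min \<bar>rep_circle x - rep_circle y + 1\<bar> \<bar>rep_circle x - rep_circle y - 1\<bar>)"

definition uniformity_circle :: "(circle \<times> circle) filter" where
  "uniformity_circle = (INF e\<in>{0<..}. principal {(x, y). dist x y < e})"

definition open_circle :: "circle set \<Rightarrow> bool" where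
  "open_circle U \<longleftrightarrow> (\<forall>x\<in>U. eventually (\<lambda>(x', y). x' = x \<longrightarrow> y \<in> U) uniformity)"

instance
proof
  fix x y z :: circle
  have range: "0 \<le> rep_circle u" "rep_circle u < 1" for u
    using rep_circle[of u] by auto
  show "dist x y = 0 \<longleftrightarrow> x = y"
    using range[of x] range[of y] rep_circle_inject[of x y]
    unfolding dist_circle_def min_def by (auto split: if_splits)
  show "dist x y \<le> dist x z + dist y z"
    using range[of x] range[of y] range[of z]
    unfolding dist_circle_def min_def by (auto simp: abs_if split: if_splits)
qed (rule uniformity_circle_def open_circle_def)+

end

definition manneville_pomeau :: "real \<Rightarrow> circle \<Rightarrow> circle" where
  "manneville_pomeau s x = of_rep_circle (frac (rep_circle x + rep_circle x powr (s + 1)))"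

definition log_modulus :: "real \<Rightarrow> real \<Rightarrow> real \<Rightarrow> real \<Rightarrow> real" where
  "log_modulus \<alpha> \<beta> x0 x =
     (if x \<le> 0 then 0
      else if x < x0 then x powr \<alpha> * (- ln x) powr (- \<beta>)
      else x0 powr \<alpha> * (- ln x0) powr (- \<beta>))"

definition admissible_cutoff :: "real \<Rightarrow> real \<Rightarrow> real \<Rightarrow> bool" where
  "admissible_cutoff \<alpha> \<beta> x0 \<longleftrightarrow>
     0 < x0 \<and> x0 < 1 \<and>
     concave_on {0..} (log_modulus \<alpha> \<beta> x0) \<and> mono_on {0..} (log_modulus \<alpha> \<beta> x0)"

definition modulus_space :: "(real \<Rightarrow> real) \<Rightarrow> ('a::metric_space \<Rightarrow> real) set" where
  "modulus_space \<omega> = {\<phi>. \<exists>C>0. \<forall>x y. \<bar>\<phi> x - \<phi> y\<bar> \<le> C * \<omega> (dist x y)}"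

text \<open>The definition is meant for maps with finite fibres: a sum over an infinite fibre is 0.\<close>

definition transfer_operator ::
    "('a \<Rightarrow> 'a) \<Rightarrow> ('a \<Rightarrow> real) \<Rightarrow> ('a \<Rightarrow> 'b::real_normed_vector) \<Rightarrow> 'a \<Rightarrow> 'b" where
  "transfer_operator T f \<phi> x = (\<Sum>y\<in>T -` {x}. exp (f y) *\<^sub>R \<phi> y)"

text \<open>The relation says that the finite Borel measure \<open>m'\<close> is the image of \<open>m\<close> under the
  dual operator. As the transfer operator is positive, positive measures are sent to positive
  measures, and no signed measures are needed here.\<close>

definition is_dual_transfer ::
    "('a::topological_space \<Rightarrow> 'a) \<Rightarrow> ('a \<Rightarrow> real) \<Rightarrow> 'a measure \<Rightarrow> 'a measure \<Rightarrow> bool" where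
  "is_dual_transfer T f m m' \<longleftrightarrow>
     finite_measure m \<and> sets m = sets borel \<and> finite_measure m' \<and> sets m' = sets borel \<and>
     (\<forall>\<phi>::'a \<Rightarrow> real. continuous_on UNIV \<phi> \<longrightarrow>
        (\<integral>x. \<phi> x \<partial>m') = (\<integral>x. transfer_operator T f \<phi> x \<partial>m))"

definition continuous_functions :: "('a::topological_space \<Rightarrow> 'b::topological_space) set" where
  "continuous_functions = {\<phi>. continuous_on UNIV \<phi>}"

definition eigenvalue_on ::
    "('a \<Rightarrow> 'b::field) set \<Rightarrow> (('a \<Rightarrow> 'b) \<Rightarrow> 'a \<Rightarrow> 'b) \<Rightarrow> 'b \<Rightarrow> bool" where
  "eigenvalue_on V L c \<longleftrightarrow> (\<exists>\<phi>\<in>V. \<phi> \<noteq> (\<lambda>_. 0) \<and> L \<phi> = (\<lambda>x. c * \<phi> x))"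

text \<open>Simplicity is algebraic: the generalized eigenspace
  \<open>\<Union>k. ker (L - c)^k\<close> in \<open>V\<close> is one-dimensional.\<close>

definition simple_eigenvalue_on ::
    "('a \<Rightarrow> 'b::field) set \<Rightarrow> (('a \<Rightarrow> 'b) \<Rightarrow> 'a \<Rightarrow> 'b) \<Rightarrow> 'b \<Rightarrow> bool" where
  "simple_eigenvalue_on V L c \<longleftrightarrow>
     eigenvalue_on V L c \<and>
     (\<exists>\<phi>\<in>V. \<phi> \<noteq> (\<lambda>_. 0) \<and>
        {\<psi> \<in> V. \<exists>k. ((\<lambda>\<theta> x. L \<theta> x - c * \<theta> x) ^^ k) \<psi> = (\<lambda>_. 0)} = range (\<lambda>a x. a * \<phi> x))"

definition invariant_measures :: "('a::topological_space \<Rightarrow> 'a) \<Rightarrow> 'a measure set" where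
  "invariant_measures T =
     {m. prob_space m \<and> sets m = sets borel \<and> T \<in> measurable m m \<and> distr m m T = m}"

definition finite_partitions :: "'a measure \<Rightarrow> 'a set set set" where
  "finite_partitions m = {P. finite P \<and> P \<subseteq> sets m \<and> partition_on (space m) P}"

definition partition_entropy :: "'a measure \<Rightarrow> 'a set set \<Rightarrow> real" where
  "partition_entropy m P = - (\<Sum>A\<in>P. measure m A * ln (measure m A))"

text \<open>The nonempty atoms of the join of the partitions \<open>T^{-j} P\<close> for \<open>j < n\<close>.\<close>

definition iterated_join :: "'a measure \<Rightarrow> ('a \<Rightarrow> 'a) \<Rightarrow> 'a set set \<Rightarrow> nat \<Rightarrow> 'a set set" where
  "iterated_join m T P n =
     {B. B \<noteq> {} \<and>
        (\<exists>A::nat \<Rightarrow> 'a set. (\<forall>j<n. A j \<in> P) \<and> B = {x \<in> space m. \<forall>j<n. (T ^^ j) x \<in> A j})}"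

definition entropy_of_partition :: "'a measure \<Rightarrow> ('a \<Rightarrow> 'a) \<Rightarrow> 'a set set \<Rightarrow> real" where
  "entropy_of_partition m T P = lim (\<lambda>n. partition_entropy m (iterated_join m T P n) / real n)"

definition metric_entropy :: "'a measure \<Rightarrow> ('a \<Rightarrow> 'a) \<Rightarrow> ereal" where
  "metric_entropy m T = (SUP P\<in>finite_partitions m. ereal (entropy_of_partition m T P))"

definition pressure :: "('a::topological_space \<Rightarrow> 'a) \<Rightarrow> ('a \<Rightarrow> real) \<Rightarrow> ereal" where
  "pressure T f = (SUP m\<in>invariant_measures T. metric_entropy m T + ereal (\<integral>x. f x \<partial>m))"

definition birkhoff_sum :: "('a \<Rightarrow> 'a) \<Rightarrow> ('a \<Rightarrow> real) \<Rightarrow> nat \<Rightarrow> 'a \<Rightarrow> real" where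
  "birkhoff_sum T f n x = (\<Sum>j<n. f ((T ^^ j) x))"

text \<open>The time range \<open>0 \<le> j \<le> n\<close> includes \<open>n\<close>.\<close>

definition bowen_ball :: "('a::metric_space \<Rightarrow> 'a) \<Rightarrow> nat \<Rightarrow> real \<Rightarrow> 'a \<Rightarrow> 'a set" where
  "bowen_ball T n r x = {y. \<forall>j\<le>n. dist ((T ^^ j) x) ((T ^^ j) y) < r}"

end

theory Submission
  imports Defs
begin

text \<open>Two features of the map \<open>T = T\<^sub>s\<close> carry the whole theorem. First, the two fibres over points \<open>x\<close>, \<open>x'\<close>
can be matched so that matched preimages at distance \<open>d\<close> satisfy
\<open>d + d\<^bsup>1+s\<^esup>/4 \<le> dist x x'\<close> (\<open>mp_branch_pairing\<close>). Inverse branches thus contract, though at the rate of a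
neutral fixed point only. Second, the two moduli fit this rate: for a suitable constant,
\<open>W(d) = C (\<omega>\<^bsub>\<alpha>-s,\<beta>\<^esub>(d) + d)\<close> satisfies \<open>\<omega>\<^bsub>\<alpha>,\<beta>\<^esub>(d) + W(d) \<le> W(d + d\<^bsup>1+s\<^esup>/4)\<close> (\<open>log_modulus_telescopes\<close>).
Along a matched pair of backward orbits the variation of \<open>f\<close> therefore telescopes, and the bound
\<open>\<phi>(x) \<le> exp(W(dist x y)) \<phi>(y)\<close> is inherited by \<open>\<L> \<phi>\<close>, where \<open>\<L>\<close> is the transfer operator.

Eigenfunction. The functions \<open>\<L>\<^sup>n 1\<close> have uniformly bounded oscillation, so their growth is exactly of
order \<open>\<kappa>\<^sup>n\<close>. The pointwise lower limit of \<open>\<kappa>\<^bsup>-n\<^esup> \<L>\<^sup>n 1\<close> is a subinvariant function, its iterates decrease,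
and their limit is a positive eigenfunction \<open>h\<close>. Monotone limits replace a fixed point theorem here, and
\<open>h\<close> inherits the modulus \<open>W\<close>, which is the regularity that is claimed.

Convergence. Dividing by \<open>h\<close> turns \<open>\<L>/\<kappa>\<close> into an averaging operator \<open>P\<close> over preimages. Its iterates of a
continuous function are equicontinuous. Preimages become dense, so a value near the minimum
enters all later averages with a weight bounded below; maximum and minimum approach
each other and \<open>P\<^sup>n \<phi>\<close> converges uniformly to a constant. This constant is the integral of \<open>\<phi>\<close> with respect to a
weak limit \<open>\<mu>\<close> of the laws of the random walk on preimages (Helly's theorem on the circle), and \<open>\<nu> = \<mu>/h\<close>
is the eigenmeasure. All spectral statements follow from the uniform convergence of \<open>\<kappa>\<^bsup>-n\<^esup> \<L>\<^sup>n \<phi>\<close>.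

Gibbs property. Since \<open>\<nu>\<close> is conformal, the measure of a dynamical ball changes by the factor \<open>exp f / \<kappa>\<close> at each step, up to
an error that telescopes by the second feature.

Equilibrium. If \<open>g\<close> is continuous and \<open>exp g\<close> sums to 1 over each fibre, every invariant \<open>m\<close> satisfies
\<open>h\<^sub>m(T) \<le> - \<integral> g dm\<close> (\<open>entropy_of_partition_le\<close>): the Gibbs inequality is applied to a probability on words that record the
atoms of a partition together with the branches that are used. For \<open>g = f + ln h - ln (h \<circ> T) - ln \<kappa>\<close> this is
the variational inequality, and the measures of cylinders show that \<open>\<mu>\<close> attains equality. If \<open>m\<close> attains equality
too, the same bound for the perturbed normalized potentials \<open>g + t \<psi> - ln (P (exp (t \<psi>)) \<circ> T)\<close> and \<open>t \<rightarrow> 0\<close> gives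
\<open>\<integral> \<psi> dm \<le> \<integral> P \<psi> dm\<close>; hence \<open>\<integral> \<psi> dm \<le> \<integral> P\<^sup>n \<psi> dm\<close>, which tends to \<open>\<integral> \<psi> d\<mu>\<close>, and \<open>m = \<mu>\<close>.\<close>

section \<open>The circle as a compact metric space\<close>

definition circle_of :: "real \<Rightarrow> circle" where
  "circle_of t = of_rep_circle (frac t)"

lemma rep_circle_bounds: "0 \<le> rep_circle x" "rep_circle x < 1"
  using rep_circle[of x] by auto

lemma rep_circle_of [simp]: "rep_circle (circle_of t) = frac t"
  unfolding circle_of_def by (rule of_rep_circle_inverse) (simp add: frac_lt_1)

lemma circle_of_rep [simp]: "circle_of (rep_circle x) = x"
  unfolding circle_of_def by (simp add: frac_eq[THEN iffD2] rep_circle_inverse rep_circle_bounds)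

lemma circle_of_eqI: "circle_of u = circle_of v" if "u - v = of_int k"
proof -
  have "u = v + of_int k" using that by simp
  then show ?thesis by (simp add: circle_of_def)
qed

lemma dist_circle_le_half: "dist x y \<le> (1/2 :: real)" for x y :: circle
  unfolding dist_circle_def min_def
  using rep_circle_bounds[of x] rep_circle_bounds[of y] by (auto simp: abs_if split: if_splits)

text \<open>Up to an integer, \<open>u - v\<close> is the difference of the representatives. Integers beyond \<open>-1, 0, 1\<close> only
occur when \<open>\<bar>u - v\<bar>\<close> exceeds the diameter of the circle.\<close>

lemma dist_circle_of_le: "dist (circle_of u) (circle_of v) \<le> \<bar>u - v\<bar>"
proof -
  define k where "k = \<lfloor>u\<rfloor> - \<lfloor>v\<rfloor>"
  have uv: "u - v = frac u - frac v + of_int k"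
    by (simp add: k_def frac_def)
  have b: "0 \<le> frac u" "frac u < 1" "0 \<le> frac v" "frac v < 1"
    by (auto simp: frac_lt_1)
  consider "k = 0" | "k = 1" | "k = -1" | "k \<ge> 2" | "k \<le> -2" by linarith
  then show ?thesis
  proof cases
    case 4
    then have "real_of_int k \<ge> 2" by simp
    then show ?thesis using b dist_circle_le_half[of "circle_of u" "circle_of v"] uv by linarith
  next
    case 5
    then have "real_of_int k \<le> -2" by simp
    then show ?thesis using b dist_circle_le_half[of "circle_of u" "circle_of v"] uv by linarith
  qed (use uv in \<open>auto simp: dist_circle_def\<close>)
qed

lemma dist_circle_le_rep: "dist x y \<le> \<bar>rep_circle x - rep_circle y\<bar>"
  by (simp add: dist_circle_def)

lemma continuous_circle_of: "continuous_on A circle_of"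
proof (rule continuous_onI)
  fix u e :: real assume "0 < e"
  then show "\<exists>d>0. \<forall>v\<in>A. dist v u < d \<longrightarrow> dist (circle_of v) (circle_of u) \<le> e"
    by (intro exI[of _ e])
       (metis dist_circle_of_le dist_real_def less_eq_real_def order_le_less_trans)
qed

lemma circle_of_surj: "circle_of ` {0..1} = UNIV"
proof -
  have "x \<in> circle_of ` {0..1}" for x
    by (rule image_eqI[of _ _ "rep_circle x"]) (auto simp: rep_circle_bounds less_imp_le)
  then show ?thesis by auto
qed

lemma compact_circle: "compact (UNIV :: circle set)"
  using compact_continuous_image[OF continuous_circle_of, of "{0..1}"] circle_of_surj by simp

text \<open>The coordinate is continuous except at the point 0, where it jumps.\<close>

lemma rep_circle_measurable: "rep_circle \<in> borel_measurable borel"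
proof (rule borel_measurable_continuous_countable_exceptions)
  show "countable {circle_of 0}" by simp
  show "continuous_on (- {circle_of 0}) rep_circle"
  proof (rule continuous_onI)
    fix x :: circle and e :: real assume x: "x \<in> - {circle_of 0}" and "0 < e"
    have "rep_circle x \<noteq> 0" using x circle_of_rep[of x] by force
    then have x0: "0 < rep_circle x" using rep_circle_bounds[of x] by linarith
    have "\<bar>rep_circle y - rep_circle x\<bar> = dist y x"
      if "dist y x < min (rep_circle x) (1 - rep_circle x)" for y
      using that rep_circle_bounds[of y] rep_circle_bounds[of x] unfolding dist_circle_def by (auto simp: min_def abs_if split: if_splits)
    then show "\<exists>d>0. \<forall>y\<in>- {circle_of 0}. dist y x < d \<longrightarrow> dist (rep_circle y) (rep_circle x) \<le> e"
      using x0 \<open>0 < e\<close>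
      by (intro exI[of _ "min e (min (rep_circle x) (1 - rep_circle x))"]) (auto simp: dist_real_def rep_circle_bounds)
  qed
qed

text \<open>Weak compactness of probabilities. The laws are read as distributions on the interval from 0 to 1, where
Helly's selection theorem applies, and the limit is wrapped around the circle. A continuous function of the circle
is a continuous function of the coordinate after composition with the covering map, so mass that escapes to the endpoint 1 does
no harm.\<close>

lemma circle_weakly_compact:
  fixes p :: "nat \<Rightarrow> circle pmf"
  shows "\<exists>r \<mu>. strict_mono (r :: nat \<Rightarrow> nat) \<and> prob_space \<mu> \<and> sets \<mu> = sets borel \<and>
    (\<forall>\<phi> :: circle \<Rightarrow> real. continuous_on UNIV \<phi> \<longrightarrow>
      (\<lambda>n. measure_pmf.expectation (p (r n)) \<phi>) \<longlonglongrightarrow> (\<integral>x. \<phi> x \<partial>\<mu>))"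
proof -
  define q where "q n = distr (measure_pmf (p n)) borel rep_circle" for n
  have q_dist: "real_distribution (q n)" for n
  proof -
    interpret prob_space "q n"
      unfolding q_def by (rule measure_pmf.prob_space_distr) simp
    show ?thesis by unfold_locales (auto simp: q_def)
  qed
  have q_conc: "measure (q n) {-1<..1} = 1" for n
  proof -
    have "rep_circle -` {-1<..1} = (UNIV :: circle set)"
    proof -
      have "-1 < rep_circle x \<and> rep_circle x \<le> 1" for x
        using rep_circle_bounds[of x] by linarith
      then show ?thesis by auto
    qed
    then show ?thesis unfolding q_def by (subst measure_distr) auto
  qed
  have "tight q"
    unfolding tight_def
  proof (intro conjI allI impI)
    fix \<epsilon> :: real assume "0 < \<epsilon>"
    then show "\<exists>a b. a < b \<and> (\<forall>n. 1 - \<epsilon> < measure (q n) {a<..b})"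
      by (intro exI[of _ "-1::real"] exI[of _ "1::real"]) (simp add: q_conc)
  qed (rule q_dist)
  from tight_imp_convergent_subsubsequence[OF this strict_mono_id]
  obtain r M where r: "strict_mono (r :: nat \<Rightarrow> nat)" and M: "real_distribution M"
    and conv: "weak_conv_m (q \<circ> r) M" by (auto simp: id_def comp_def)
  interpret M: real_distribution M by fact
  define \<mu> where "\<mu> = distr M borel circle_of"
  have meas: "circle_of \<in> measurable M borel"
    using borel_measurable_continuous_onI[OF continuous_circle_of] measurable_cong_sets[OF M.events_eq_borel refl] by blast
  have "prob_space \<mu>" unfolding \<mu>_def by (rule M.prob_space_distr[OF meas])
  moreover have "(\<lambda>n. measure_pmf.expectation (p (r n)) \<phi>) \<longlonglongrightarrow> (\<integral>x. \<phi> x \<partial>\<mu>)"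
    if \<phi>: "continuous_on UNIV \<phi>" for \<phi> :: "circle \<Rightarrow> real"
  proof -
    have cont: "continuous_on UNIV (\<phi> \<circ> circle_of)"
      by (intro continuous_on_compose continuous_circle_of continuous_on_subset[OF \<phi>]) auto
    then have isC: "isCont (\<phi> \<circ> circle_of) t" for t
      using continuous_on_eq_continuous_at[OF open_UNIV] by blast
    have "compact (range \<phi>)" by (rule compact_continuous_image[OF \<phi> compact_circle])
    then obtain B where B: "\<And>x. norm (\<phi> x) \<le> B"
      using compact_imp_bounded bounded_iff by (metis rangeI)
    have "(\<lambda>n. integral\<^sup>L ((q \<circ> r) n) (\<phi> \<circ> circle_of)) \<longlonglongrightarrow> integral\<^sup>L M (\<phi> \<circ> circle_of)"
      by (rule weak_conv_imp_integral_bdd_continuous_conv[OF _ M conv isC, where B = B])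
         (use q_dist B in auto)
    moreover have "integral\<^sup>L ((q \<circ> r) n) (\<phi> \<circ> circle_of) = measure_pmf.expectation (p (r n)) \<phi>" for n
      unfolding q_def comp_def
      by (subst integral_distr)
         (use borel_measurable_continuous_onI[OF cont] in \<open>auto simp: comp_def\<close>)
    moreover have "integral\<^sup>L M (\<phi> \<circ> circle_of) = (\<integral>x. \<phi> x \<partial>\<mu>)"
      unfolding \<mu>_def using borel_measurable_continuous_onI[OF \<phi>]
      by (subst integral_distr[OF meas]) (auto simp: comp_def)
    ultimately show ?thesis by simp
  qed
  ultimately show ?thesis using r by (intro exI[of _ r] exI[of _ \<mu>]) (auto simp: \<mu>_def)
qed

lemma open_indicator_limit:
  fixes U :: "'a::metric_space set"
  assumes "open U" and "U \<noteq> UNIV"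
  shows "(\<lambda>k. min 1 (real k * infdist x (- U))) \<longlonglongrightarrow> indicator U x"
proof (cases "x \<in> U")
  case True
  have "0 < infdist x (- U)"
    using True assms by (intro infdist_pos_not_in_closed) (auto simp: closed_def)
  then obtain N where N: "1 < real N * infdist x (- U)" using ex_less_of_nat_mult by blast
  have "\<forall>k\<ge>N. min 1 (real k * infdist x (- U)) = 1"
  proof (intro allI impI)
    fix k assume "N \<le> k"
    then have "real N * infdist x (- U) \<le> real k * infdist x (- U)"
      by (intro mult_right_mono) (auto simp: infdist_nonneg)
    then show "min 1 (real k * infdist x (- U)) = 1" using N by simp
  qed
  then show ?thesis using True
    by (intro tendsto_eventually) (auto simp: eventually_sequentially)
qed simp

text \<open>Indicators of open sets are limits of continuous functions with values between 0 and 1, and open sets generate the Borel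
sets.\<close>

lemma finite_measure_eqI_continuous:
  fixes M N :: "'a::metric_space measure"
  assumes M: "finite_measure M" "sets M = sets borel" and N: "finite_measure N" "sets N = sets borel"
    and eq: "\<And>\<phi> :: 'a \<Rightarrow> real. continuous_on UNIV \<phi> \<Longrightarrow> (\<And>x. 0 \<le> \<phi> x \<and> \<phi> x \<le> 1) \<Longrightarrow>
      (\<integral>x. \<phi> x \<partial>M) = (\<integral>x. \<phi> x \<partial>N)"
  shows "M = N"
proof -
  interpret M: finite_measure M by fact
  interpret N: finite_measure N by fact
  have sp: "space M = UNIV" "space N = UNIV"
    using M(2) N(2) by (metis sets_eq_imp_space_eq space_borel)+
  have eqm: "measure M U = measure N U" if U: "open U" for U
  proof (cases "U = UNIV")
    case True
    then show ?thesis using eq[of "\<lambda>_. 1"] sp by simp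
  next
    case False
    define \<phi> where "\<phi> k x = min 1 (real k * infdist x (- U))" for k and x :: 'a
    have c: "continuous_on UNIV (\<phi> k)" for k
      unfolding \<phi>_def by (intro continuous_intros)
    have b: "0 \<le> \<phi> k x \<and> \<phi> k x \<le> 1" for k x
      by (auto simp: \<phi>_def infdist_nonneg)
    have lim: "(\<lambda>k. \<integral>x. \<phi> k x \<partial>K) \<longlonglongrightarrow> measure K U"
      if K: "finite_measure K" "sets K = sets borel" for K
    proof -
      interpret K: finite_measure K by fact
      have spK: "space K = UNIV" using K(2) by (metis sets_eq_imp_space_eq space_borel)
      have [measurable]: "\<phi> k \<in> borel_measurable K" for k
        using borel_measurable_continuous_onI[OF c] measurable_cong_sets[OF K(2) refl] by blast
      have UK: "U \<in> sets K" using U K(2) by simp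
      have "(\<lambda>k. \<integral>x. \<phi> k x \<partial>K) \<longlonglongrightarrow> (\<integral>x. indicator U x \<partial>K)"
      proof (rule integral_dominated_convergence[where w = "\<lambda>_. 1"])
        show "AE x in K. (\<lambda>k. \<phi> k x) \<longlonglongrightarrow> indicator U x"
          using open_indicator_limit[OF U False] by (simp add: \<phi>_def)
      qed (use b UK in \<open>auto simp: abs_of_nonneg\<close>)
      then show ?thesis using UK spK by simp
    qed
    have "(\<lambda>k. \<integral>x. \<phi> k x \<partial>M) = (\<lambda>k. \<integral>x. \<phi> k x \<partial>N)"
      using eq[OF c b] by blast
    then show ?thesis using lim[OF M] lim[OF N] LIMSEQ_unique by metis
  qed
  show ?thesis
  proof (rule measure_eqI_generator_eq[where E = "{S. open S}" and \<Omega> = UNIV and A = "\<lambda>_. UNIV"])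
    show "sets M = sigma_sets UNIV {S. open S}" "sets N = sigma_sets UNIV {S. open S}"
      using M(2) N(2) by (auto simp: borel_def)
    show "Int_stable {S :: 'a set. open S}" by (auto simp: Int_stable_def)
  qed (auto simp: eqm M.emeasure_eq_measure N.emeasure_eq_measure)
qed

text \<open>Inner regularity on the circle follows from inner regularity on the real line: a compact set of
representatives is carried to a compact subset of the circle.\<close>

lemma circle_inner_closed:
  fixes m :: "circle measure"
  assumes m: "finite_measure m" "sets m = sets borel" and A: "A \<in> sets borel" and e: "0 < e"
  shows "\<exists>K\<subseteq>A. closed K \<and> measure m (A - K) < e"
proof -
  interpret m: finite_measure m by fact
  have sp: "space m = UNIV" using m(2) by (metis sets_eq_imp_space_eq space_borel)
  have [measurable]: "rep_circle \<in> measurable m borel"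
    using rep_circle_measurable measurable_cong_sets[OF m(2) refl] by blast
  define M where "M = distr m borel rep_circle"
  interpret M: finite_measure M unfolding M_def by (rule m.finite_measure_distr) simp
  define B where "B = circle_of -` A \<inter> {0..<1}"
  have "circle_of -` A \<in> sets borel"
    using measurable_sets[OF borel_measurable_continuous_onI[OF continuous_circle_of], of A] A m(2) by simp
  then have B: "B \<in> sets borel" by (auto simp: B_def)
  have vB: "rep_circle -` B = A" by (auto simp: B_def rep_circle_bounds)
  have "emeasure M B = (SUP K \<in> {K. K \<subseteq> B \<and> compact K}. emeasure M K)"
    by (rule inner_regular) (use B in \<open>auto simp: M_def M.emeasure_finite[unfolded M_def]\<close>)
  moreover have MB: "emeasure M B = ennreal (measure m A)"
    unfolding M_def using B vB sp by (subst emeasure_distr) (auto simp: m.emeasure_eq_measure)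
  have "\<exists>K \<in> {K. K \<subseteq> B \<and> compact K}. measure m A - e < measure M K"
  proof (rule ccontr)
    assume neg: "\<not> ?thesis"
    then have "(SUP K \<in> {K. K \<subseteq> B \<and> compact K}. emeasure M K) \<le> ennreal (measure m A - e)"
      by (intro SUP_least) (auto simp: M.emeasure_eq_measure not_less intro!: ennreal_leI)
    then have le: "ennreal (measure m A) \<le> ennreal (measure m A - e)"
      using MB calculation by simp
    show False
    proof (cases "measure m A = 0")
      case True
      have "measure M {} > measure m A - e" using e True by simp
      moreover have "{} \<in> {K. K \<subseteq> B \<and> compact K}" by simp
      ultimately show False using neg by metis
    next
      case False
      then have "0 < measure m A" using measure_nonneg[of m A] by linarith
      then show False using le e by (auto simp: ennreal_le_iff2)
    qed
  qed
  then obtain K where K: "K \<subseteq> B" "compact K" "measure m A - e < measure M K" by blast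
  define K' where "K' = circle_of ` K"
  have "compact K'" unfolding K'_def by (rule compact_continuous_image[OF continuous_circle_of K(2)])
  then have cl: "closed K'" by (rule compact_imp_closed)
  have sub: "K' \<subseteq> A" using K(1) by (auto simp: K'_def B_def)
  have "rep_circle -` K \<subseteq> K'"
    unfolding K'_def by (metis circle_of_rep imageI subsetI vimageE)
  moreover have K'm: "K' \<in> sets m" using cl m(2) by simp
  ultimately have "measure M K \<le> measure m K'"
    unfolding M_def using borel_compact[OF K(2)] sp
    by (subst measure_distr) (auto intro!: m.finite_measure_mono)
  then have "measure m (A - K') < e"
    using K(3) m.finite_measure_Diff[OF _ K'm sub] A m(2) by simp
  then show ?thesis using cl sub by blast
qed

section \<open>Inverse branches of the Manneville-Pomeau map\<close>

definition stretch :: "real \<Rightarrow> real \<Rightarrow> real" where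
  "stretch s d = d + d powr (s + 1) / 4"

definition mp_lift :: "real \<Rightarrow> real \<Rightarrow> real" where
  "mp_lift s t = t + t powr (s + 1)"

lemma powr_superadd:
  fixes a c s :: real
  assumes "0 \<le> a" "0 \<le> c" "0 < s"
  shows "a powr (s + 1) + c powr (s + 1) \<le> (a + c) powr (s + 1)"
proof -
  have eq: "t powr (s + 1) = t * t powr s" if "0 \<le> t" for t :: real
    using that by (cases "t = 0") (auto simp: powr_add)
  have "a * a powr s \<le> a * (a + c) powr s" "c * c powr s \<le> c * (a + c) powr s"
    using assms by (auto intro!: mult_left_mono powr_mono2)
  then show ?thesis using assms by (simp add: eq distrib_right)
qed

text \<open>The neutral fixed point is at 0, and convexity of the power makes the expansion at 0 the weakest one.\<close>

lemma mp_lift_expands: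
  assumes "0 < s" "0 \<le> u" "u \<le> v"
  shows "(v - u) + (v - u) powr (s + 1) \<le> mp_lift s v - mp_lift s u"
  using powr_superadd[of u "v - u" s] assms by (simp add: mp_lift_def)

lemma mp_lift_Lipschitz:
  assumes s: "0 < s" "s < 1" and uv: "0 \<le> u" "u \<le> v" "v \<le> 1"
  shows "mp_lift s v - mp_lift s u \<le> 3 * (v - u)"
proof (cases "u = 0")
  case True
  have "v powr (s + 1) \<le> v"
  proof (cases "v = 0")
    case False
    have "v powr (s + 1) \<le> v powr 1"
      using s uv False by (intro powr_mono') auto
    then show ?thesis using uv False by simp
  qed simp
  then show ?thesis using True uv by (simp add: mp_lift_def)
next
  case False
  then have pos: "0 < u" "0 < v" using uv by auto
  have eq: "t powr (s + 1) = t * t powr s" if "0 < t" for t :: real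
    using that by (simp add: powr_add)
  have "v powr (s - 1) \<le> u powr (s - 1)"
    using s uv pos by (intro powr_mono2') auto
  then have "u * v * v powr (s - 1) \<le> u * v * u powr (s - 1)"
    using pos by (intro mult_left_mono) auto
  then have 1: "u * v powr s \<le> v * u powr s"
    using pos by (simp add: powr_diff field_simps)
  have le1: "v powr s \<le> 1" "u powr s \<le> 1"
    using s uv pos by (auto intro!: powr_le1)
  have "v * v powr s - u * u powr s = (v * v powr s - v * u powr s) + (v - u) * u powr s"
    by (simp add: algebra_simps)
  also have "\<dots> \<le> (v - u) * v powr s + (v - u) * u powr s"
    using 1 by (simp add: algebra_simps)
  also have "\<dots> \<le> (v - u) * 1 + (v - u) * 1"
    using le1 uv by (intro add_mono mult_left_mono) auto
  finally show ?thesis using pos by (simp add: mp_lift_def eq)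
qed

lemma mp_lift_strict_mono: "0 < s \<Longrightarrow> 0 \<le> u \<Longrightarrow> u < v \<Longrightarrow> mp_lift s u < mp_lift s v"
  using mp_lift_expands[of s u v] powr_ge_zero[of "v - u" "s + 1"] by linarith

lemma mp_lift_0 [simp]: "mp_lift s 0 = 0" and mp_lift_1 [simp]: "mp_lift s 1 = 2"
  by (auto simp: mp_lift_def)

lemma stretch_mono: "0 < s \<Longrightarrow> 0 \<le> d \<Longrightarrow> d \<le> e \<Longrightarrow> stretch s d \<le> stretch s e"
  unfolding stretch_def by (intro add_mono divide_right_mono powr_mono2) auto

lemma le_stretch: "d \<le> stretch s d"
  by (simp add: stretch_def)

lemma stretch_le_lift:
  assumes s: "0 < s" and uv: "0 \<le> u" "0 \<le> v"
  shows "stretch s \<bar>u - v\<bar> \<le> \<bar>mp_lift s u - mp_lift s v\<bar>"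
proof -
  have *: "stretch s (v - u) \<le> mp_lift s v - mp_lift s u" if "0 \<le> u" "u \<le> v" for u v
    using mp_lift_expands[OF s that] powr_ge_zero[of "v - u" "s + 1"] unfolding stretch_def by linarith
  show ?thesis
    using *[of u v] *[of v u] uv by (cases "u \<le> v") (auto simp: abs_if split: if_splits)
qed

text \<open>For two points on opposite sides of the fixed point 0, the displacement splits into a piece at 0 and a piece
at 1. The larger piece is at least half of the displacement, and \<open>2\<^bsup>s+1\<^esup> \<le> 4\<close>; this is where the factor 1/4
of \<open>stretch\<close> comes from.\<close>

lemma stretch_le_wrapped:
  assumes s: "0 < s" "s < 1" and uv: "0 \<le> u" "u \<le> 1" "0 \<le> v" "v \<le> 1"
  shows "stretch s (u + (1 - v)) \<le> mp_lift s u + (2 - mp_lift s v)"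
proof -
  let ?m = "max u (1 - v)"
  have "((u + (1 - v)) / 2) powr (s + 1) \<le> ?m powr (s + 1)"
    using s uv by (intro powr_mono2) (auto simp: max_def)
  also have "?m powr (s + 1) \<le> u powr (s + 1) + (1 - v) powr (s + 1)"
    by (auto simp: max_def)
  finally have 1: "((u + (1 - v)) / 2) powr (s + 1) \<le> u powr (s + 1) + (1 - v) powr (s + 1)" .
  have "(2::real) powr (s + 1) \<le> 2 powr 2"
    using s by (intro powr_mono) auto
  then have "(u + (1 - v)) powr (s + 1) / 4 \<le> (u + (1 - v)) powr (s + 1) / 2 powr (s + 1)"
    by (intro divide_left_mono) auto
  also have "\<dots> = ((u + (1 - v)) / 2) powr (s + 1)"
    using uv by (simp add: powr_divide)
  finally have "(u + (1 - v)) powr (s + 1) / 4 \<le> u powr (s + 1) + (1 - v) powr (s + 1)"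
    using 1 by linarith
  then show ?thesis
    using mp_lift_expands[of s v 1] s uv by (simp add: stretch_def mp_lift_def)
qed

definition mp_inv :: "real \<Rightarrow> real \<Rightarrow> real" where
  "mp_inv s u = (SOME t. 0 \<le> t \<and> t \<le> 1 \<and> mp_lift s t = u)"

lemma mp_inv:
  assumes "0 < s" "0 \<le> u" "u \<le> 2"
  shows "0 \<le> mp_inv s u" "mp_inv s u \<le> 1" "mp_lift s (mp_inv s u) = u"
proof -
  have "continuous_on {0..1} (mp_lift s)"
    unfolding mp_lift_def using assms by (intro continuous_intros continuous_on_powr') auto
  then have "\<exists>t. 0 \<le> t \<and> t \<le> 1 \<and> mp_lift s t = u"
    using assms by (intro IVT') auto
  from someI_ex[OF this] show "0 \<le> mp_inv s u" "mp_inv s u \<le> 1" "mp_lift s (mp_inv s u) = u"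
    unfolding mp_inv_def by auto
qed

lemma mp_inv_lt_1:
  assumes "0 < s" "0 \<le> u" "u < 2"
  shows "mp_inv s u < 1"
  using mp_inv[of s u] assms by (cases "mp_inv s u = 1") auto

lemma mp_inv_lift:
  assumes "0 < s" "0 \<le> t" "t \<le> 1"
  shows "mp_inv s (mp_lift s t) = t"
proof -
  have r: "0 \<le> mp_lift s t" "mp_lift s t \<le> 2"
    using mp_lift_expands[of s 0 t] mp_lift_expands[of s t 1] assms
      powr_ge_zero[of t "s + 1"] powr_ge_zero[of "1 - t" "s + 1"] by (auto simp del: powr_ge_zero)
  show ?thesis
    using mp_inv[OF assms(1) r] mp_lift_strict_mono[of s t "mp_inv s (mp_lift s t)"]
      mp_lift_strict_mono[of s "mp_inv s (mp_lift s t)" t] assms by force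
qed

definition mp_branch :: "real \<Rightarrow> bool \<Rightarrow> circle \<Rightarrow> circle" where
  "mp_branch s i x = circle_of (mp_inv s (rep_circle x + of_bool i))"

definition mp_code :: "real \<Rightarrow> circle \<Rightarrow> bool" where
  "mp_code s y \<longleftrightarrow> 1 \<le> mp_lift s (rep_circle y)"

lemma manneville_pomeau_lift: "manneville_pomeau s x = circle_of (mp_lift s (rep_circle x))"
  by (simp add: manneville_pomeau_def circle_of_def mp_lift_def)

lemma dist_circle_cases:
  fixes x y :: circle
  obtains "dist x y = \<bar>rep_circle x - rep_circle y\<bar>"
  | "dist x y = rep_circle x + 1 - rep_circle y"
  | "dist x y = rep_circle y + 1 - rep_circle x"
proof -
  have "dist x y = \<bar>rep_circle x - rep_circle y\<bar> \<or> dist x y = rep_circle x + 1 - rep_circle y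
      \<or> dist x y = rep_circle y + 1 - rep_circle x"
    using rep_circle_bounds[of x] rep_circle_bounds[of y]
    unfolding dist_circle_def min_def by (auto simp: abs_if)
  then show thesis using that by blast
qed

context
  fixes s :: real
  assumes s: "0 < s" "s < 1"
begin

lemma rep_mp_branch:
  "rep_circle (mp_branch s i x) = mp_inv s (rep_circle x + of_bool i)"
  "mp_lift s (rep_circle (mp_branch s i x)) = rep_circle x + of_bool i"
proof -
  have "0 \<le> rep_circle x + of_bool i" "rep_circle x + of_bool i < 2"
    using rep_circle_bounds[of x] by (cases i; simp)+
  note r = this mp_inv[OF s(1) this(1) less_imp_le[OF this(2)]] mp_inv_lt_1[OF s(1) this]
  then show *: "rep_circle (mp_branch s i x) = mp_inv s (rep_circle x + of_bool i)"
    unfolding mp_branch_def by (simp add: frac_eq[THEN iffD2])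
  show "mp_lift s (rep_circle (mp_branch s i x)) = rep_circle x + of_bool i"
    unfolding * using r by simp
qed

lemma mp_branch_section: "manneville_pomeau s (mp_branch s i x) = x"
proof -
  have "circle_of (rep_circle x + of_bool i) = circle_of (rep_circle x)"
    by (rule circle_of_eqI[where k = "of_bool i"]) simp
  then show ?thesis by (simp add: manneville_pomeau_lift rep_mp_branch(2))
qed

lemma mp_code_branch: "mp_code s (mp_branch s i x) = i"
  using rep_circle_bounds[of x] by (simp add: mp_code_def rep_mp_branch(2))

lemma mp_lift_rep_bounds: "0 \<le> mp_lift s (rep_circle y)" "mp_lift s (rep_circle y) < 2"
  using mp_lift_strict_mono[of s "rep_circle y" 1] s rep_circle_bounds[of y] 
  by (auto simp: mp_lift_def)

lemma rep_manneville_pomeau: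
  "rep_circle (manneville_pomeau s y) = mp_lift s (rep_circle y) - of_bool (mp_code s y)"
proof -
  have "\<lfloor>mp_lift s (rep_circle y)\<rfloor> = of_bool (mp_code s y)"
    using mp_lift_rep_bounds[of y] by (auto simp: mp_code_def floor_eq_iff)
  then show ?thesis by (simp add: manneville_pomeau_lift frac_def)
qed

lemma mp_branch_code: "mp_branch s (mp_code s y) (manneville_pomeau s y) = y"
  using mp_inv_lift[OF s(1), of "rep_circle y"] rep_circle_bounds[of y]
  by (simp add: mp_branch_def rep_manneville_pomeau)

text \<open>Two points of the circle have lifts to the real line at their circle distance. If the short arc
avoids 0, equal branches are matched, otherwise opposite ones; in both cases the lift of the map expands the
distance of the matched preimages.\<close>

lemma mp_branch_pairing:
  "\<exists>j. \<forall>i. stretch s (dist (mp_branch s i x) (mp_branch s (i \<noteq> j) y)) \<le> dist x y"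
proof -
  have b01: "0 \<le> rep_circle z" "rep_circle z \<le> 1" for z
    using rep_circle_bounds[of z] by auto
  have straight: "stretch s (dist z w) \<le> \<bar>mp_lift s (rep_circle z) - mp_lift s (rep_circle w)\<bar>" for z w
    by (rule order_trans[OF stretch_mono stretch_le_lift])
       (use s dist_circle_le_rep b01 in auto)
  have wrapped: "stretch s (dist z w) \<le> mp_lift s (rep_circle z) + (2 - mp_lift s (rep_circle w))" for z w
  proof (rule order_trans[OF stretch_mono stretch_le_wrapped])
    show "dist z w \<le> rep_circle z + (1 - rep_circle w)"
      using rep_circle_bounds[of z] rep_circle_bounds[of w] by (auto simp: dist_circle_def)
  qed (use s b01 in auto)
  have far: "\<forall>i. stretch s (dist (mp_branch s i x) (mp_branch s (i \<noteq> True) y)) \<le> dist x y"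
    if d: "dist x y = rep_circle x + 1 - rep_circle y" for x y
  proof
    fix i
    show "stretch s (dist (mp_branch s i x) (mp_branch s (i \<noteq> True) y)) \<le> dist x y"
      using straight[of "mp_branch s i x" "mp_branch s (\<not> i) y"]
        wrapped[of "mp_branch s i x" "mp_branch s (\<not> i) y"] d rep_circle_bounds[of x] rep_circle_bounds[of y]
      by (cases i) (auto simp: rep_mp_branch(2))
  qed
  show ?thesis
  proof (cases x y rule: dist_circle_cases)
    case 1
    have "stretch s (dist (mp_branch s i x) (mp_branch s (i \<noteq> False) y)) \<le> dist x y" for i
      using straight[of "mp_branch s i x" "mp_branch s i y"] 1 by (simp add: rep_mp_branch(2))
    then show ?thesis by blast
  next
    case 2
    then show ?thesis using far by blast
  next
    case 3
    have "stretch s (dist (mp_branch s i x) (mp_branch s (i \<noteq> True) y)) \<le> dist x y" for i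
      using far[of y x, rule_format, of "\<not> i"] 3 by (simp add: dist_commute)
    then show ?thesis by blast
  qed
qed

text \<open>The lift is Lipschitz with constant 3, and the lifted images of two preimages of a point differ by 1 along either arc.\<close>

lemma mp_branches_apart: "1 / 3 \<le> dist (mp_branch s False x) (mp_branch s True x)"
proof -
  define t0 where "t0 = rep_circle (mp_branch s False x)"
  define t1 where "t1 = rep_circle (mp_branch s True x)"
  have b: "0 \<le> t0" "t0 < 1" "0 \<le> t1" "t1 < 1" unfolding t0_def t1_def by (auto simp: rep_circle_bounds)
  have L: "mp_lift s t0 = rep_circle x" "mp_lift s t1 = rep_circle x + 1"
    by (auto simp: t0_def t1_def rep_mp_branch(2))
  have lt: "t0 < t1"
    using mp_lift_strict_mono[of s t1 t0] L b s by (cases "t1 < t0"; cases "t1 = t0") auto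
  have "1 \<le> 3 * (t1 - t0)" "1 \<le> 3 * (1 - t1) + 3 * (t0 - 0)"
    using mp_lift_Lipschitz[OF s, of t0 t1] mp_lift_Lipschitz[OF s, of t1 1]
      mp_lift_Lipschitz[OF s, of 0 t0] L b lt by auto
  then show ?thesis
    using b lt unfolding dist_circle_def t0_def[symmetric] t1_def[symmetric] by (auto simp: min_def abs_if)
qed

lemma manneville_pomeau_Lipschitz:
  "dist (manneville_pomeau s x) (manneville_pomeau s y) \<le> 3 * dist x y"
proof -
  have b01: "0 \<le> rep_circle z" "rep_circle z \<le> 1" for z
    using rep_circle_bounds[of z] by auto
  have far: "dist (manneville_pomeau s x) (manneville_pomeau s y) \<le> 3 * dist x y"
    if d: "dist x y = rep_circle x + 1 - rep_circle y" for x y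
  proof -
    have "circle_of (mp_lift s (rep_circle x)) = circle_of (mp_lift s (rep_circle x) + 2)"
      by (rule circle_of_eqI[where k = "-2"]) simp
    then have "dist (manneville_pomeau s x) (manneville_pomeau s y)
        \<le> \<bar>mp_lift s (rep_circle x) + 2 - mp_lift s (rep_circle y)\<bar>"
      unfolding manneville_pomeau_lift using dist_circle_of_le by metis
    also have "\<dots> \<le> 3 * dist x y"
      using mp_lift_Lipschitz[OF s, of 0 "rep_circle x"] mp_lift_Lipschitz[OF s, of "rep_circle y" 1]
        mp_lift_rep_bounds[of x] mp_lift_rep_bounds[of y] b01 d by (auto simp: abs_if)
    finally show ?thesis .
  qed
  show ?thesis
  proof (cases x y rule: dist_circle_cases)
    case 1
    have "dist (manneville_pomeau s x) (manneville_pomeau s y)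
        \<le> \<bar>mp_lift s (rep_circle x) - mp_lift s (rep_circle y)\<bar>"
      unfolding manneville_pomeau_lift by (rule dist_circle_of_le)
    also have "\<dots> \<le> 3 * dist x y"
    proof -
      have "\<bar>mp_lift s v - mp_lift s u\<bar> \<le> 3 * \<bar>v - u\<bar>" if "0 \<le> u" "u \<le> v" "v \<le> 1" for u v
        using mp_lift_Lipschitz[OF s that] mp_lift_strict_mono[of s u v] s that
        by (cases "u = v") auto
      then show ?thesis unfolding 1 using b01 by (metis abs_minus_commute linear)
    qed
    finally show ?thesis .
  next
    case 2 then show ?thesis by (rule far)
  next
    case 3 then show ?thesis using far[of y x] by (simp add: dist_commute)
  qed
qed

lemma continuous_manneville_pomeau: "continuous_on UNIV (manneville_pomeau s)"
proof (rule continuous_onI)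
  fix x :: circle and e :: real assume e: "0 < e"
  have "dist (manneville_pomeau s y) (manneville_pomeau s x) \<le> e" if "dist y x < e / 3" for y
    using manneville_pomeau_Lipschitz[of y x] that by simp
  then show "\<exists>d>0. \<forall>y\<in>UNIV. dist y x < d \<longrightarrow> dist (manneville_pomeau s y) (manneville_pomeau s x) \<le> e"
    using e by (intro exI[of _ "e/3"]) simp
qed

lemma mp_branch_measurable: "mp_branch s i \<in> borel_measurable borel"
proof -
  have cont: "continuous_on {0..2} (mp_inv s)"
  proof (rule continuous_onI)
    fix u e :: real assume u: "u \<in> {0..2}" and e: "0 < e"
    have "dist (mp_inv s v) (mp_inv s u) \<le> dist v u" if "v \<in> {0..2}" for v
      using stretch_le_lift[OF s(1), of "mp_inv s v" "mp_inv s u"] mp_inv[OF s(1), of u]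
        mp_inv[OF s(1), of v] u that powr_ge_zero[of "\<bar>mp_inv s v - mp_inv s u\<bar>" "s + 1"]
      by (auto simp: stretch_def dist_real_def simp del: powr_ge_zero)
    then show "\<exists>d>0. \<forall>v\<in>{0..2}. dist v u < d \<longrightarrow> dist (mp_inv s v) (mp_inv s u) \<le> e"
      using e by (intro exI[of _ e]) force
  qed
  have *: "continuous_on {0..2} (\<lambda>t. circle_of (mp_inv s t))"
    using continuous_on_compose[OF cont continuous_circle_of] by (simp add: comp_def)
  have [measurable]: "rep_circle \<in> borel_measurable borel" by (rule rep_circle_measurable)
  have m1: "(\<lambda>x. rep_circle x + of_bool i) \<in> measurable borel (restrict_space borel {0..2})"
  proof (rule measurable_restrict_space2)
    have "rep_circle x + of_bool i \<in> {0..2}" for x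
      using rep_circle_bounds[of x] by (cases i) auto
    then show "(\<lambda>x. rep_circle x + of_bool i) \<in> space borel \<rightarrow> {0..2}" by auto
  qed measurable
  show ?thesis
    unfolding mp_branch_def
    by (rule measurable_compose[OF m1 borel_measurable_continuous_on_restrict[OF *]])
qed

lemma mp_code_measurable: "Measurable.pred borel (mp_code s)"
proof -
  have [measurable]: "rep_circle \<in> borel_measurable borel" by (rule rep_circle_measurable)
  show ?thesis unfolding mp_code_def mp_lift_def by measurable
qed

text \<open>As long as the codes agree, the distance of the coordinates grows by at least \<open>e\<^bsup>s+1\<^esup>/4\<close> at each step once it is at
least \<open>e\<close>; it cannot exceed 1.\<close>

lemma mp_code_separates:
  assumes e: "0 < e"
  shows "\<exists>k. \<forall>x y. (\<forall>j<k. mp_code s ((manneville_pomeau s ^^ j) x) = mp_code s ((manneville_pomeau s ^^ j) y))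
    \<longrightarrow> dist x y < e"
proof -
  let ?T = "manneville_pomeau s"
  have grow: "e + real k * (e powr (s + 1) / 4) \<le> \<bar>rep_circle ((?T ^^ k) x) - rep_circle ((?T ^^ k) y)\<bar>"
    if "\<forall>j<k. mp_code s ((?T ^^ j) x) = mp_code s ((?T ^^ j) y)" "e \<le> \<bar>rep_circle x - rep_circle y\<bar>" for k x y
    using that
  proof (induction k)
    case (Suc k)
    let ?x = "(?T ^^ k) x" and ?y = "(?T ^^ k) y"
    let ?d = "\<bar>rep_circle ?x - rep_circle ?y\<bar>"
    have IH: "e + real k * (e powr (s + 1) / 4) \<le> ?d" using Suc by auto
    have "e \<le> e + real k * (e powr (s + 1) / 4)" by simp
    then have "e \<le> ?d" using IH by linarith
    then have "e powr (s + 1) \<le> ?d powr (s + 1)" using e s by (intro powr_mono2) auto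
    moreover have "stretch s ?d \<le> \<bar>rep_circle (?T ?x) - rep_circle (?T ?y)\<bar>"
      using stretch_le_lift[OF s(1), of "rep_circle ?x" "rep_circle ?y"] Suc.prems(1)
      by (auto simp: rep_manneville_pomeau rep_circle_bounds)
    moreover have "real (Suc k) * (e powr (s + 1) / 4) = e powr (s + 1) / 4 + real k * (e powr (s + 1) / 4)"
      by (simp add: algebra_simps)
    ultimately have "e + real (Suc k) * (e powr (s + 1) / 4) \<le> \<bar>rep_circle (?T ?x) - rep_circle (?T ?y)\<bar>"
      using IH unfolding stretch_def by linarith
    then show ?case by simp
  qed simp
  obtain k where k: "1 < real k * (e powr (s + 1) / 4)"
    using ex_less_of_nat_mult[of "e powr (s + 1) / 4" 1] e by auto
  show ?thesis
  proof (intro exI[of _ k] allI impI)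
    fix x y assume c: "\<forall>j<k. mp_code s ((?T ^^ j) x) = mp_code s ((?T ^^ j) y)"
    have "\<not> e \<le> \<bar>rep_circle x - rep_circle y\<bar>"
      using grow[OF c] k e rep_circle_bounds[of "(?T ^^ k) x"] rep_circle_bounds[of "(?T ^^ k) y"]
      by (auto simp: abs_if split: if_splits)
    then show "dist x y < e" using dist_circle_le_rep[of x y] by linarith
  qed
qed

end

section \<open>Subadditive and almost additive sequences\<close>

text \<open>Fekete's lemma: division with remainder by a fixed \<open>N\<close> gives \<open>u n / n \<le> u N / N + O(1/n)\<close>.\<close>

lemma fekete:
  fixes u :: "nat \<Rightarrow> real"
  assumes sub: "\<And>m n. u (m + n) \<le> u m + u n" and bdd: "bdd_below ((\<lambda>n. u n / real n) ` {1..})"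
  shows "\<exists>l. (\<lambda>n. u n / real n) \<longlonglongrightarrow> l \<and> (\<forall>n\<ge>1. l \<le> u n / real n)"
proof -
  define l where "l = (INF n\<in>{1..}. u n / real n)"
  have le: "l \<le> u n / real n" if "n \<ge> 1" for n
    unfolding l_def using that by (intro cINF_lower[OF bdd]) auto
  have "(\<lambda>n. u n / real n) \<longlonglongrightarrow> l"
  proof (rule LIMSEQ_I)
    fix r :: real assume r: "0 < r"
    have "\<exists>N\<in>{1..}. u N / real N < l + r / 2"
      using r cINF_less_iff[OF _ bdd, of "l + r / 2"] unfolding l_def by auto
    then obtain N where N: "1 \<le> N" "u N / real N < l + r / 2" by auto
    define K where "K = (\<Sum>j<N. \<bar>u j\<bar>) + \<bar>u N\<bar>"
    have mult: "u (q * N + j) \<le> real q * u N + u j" for q j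
    proof (induction q)
      case (Suc q)
      show ?case using sub[of N "q * N + j"] Suc by (simp add: algebra_simps)
    qed simp
    obtain M where M: "K / (r / 2) < real M" using reals_Archimedean2 by blast
    show "\<exists>no. \<forall>n\<ge>no. norm (u n / real n - l) < r"
    proof (intro exI[of _ "max M 1"] allI impI)
      fix n assume n: "max M 1 \<le> n"
      then have n0: "0 < real n" by auto
      define q j where "q = n div N" and "j = n mod N"
      have nqj: "n = q * N + j" by (simp add: q_def j_def)
      have j: "j < N" using N by (simp add: j_def)
      have "u j \<le> (\<Sum>j<N. \<bar>u j\<bar>)"
        using j member_le_sum[of j "{..<N}" "\<lambda>j. \<bar>u j\<bar>"] by simp
      moreover have "real q * u N \<le> real n * (u N / real N) + \<bar>u N\<bar>"
      proof -
        have "real n = real q * real N + real j" using nqj by (metis of_nat_add of_nat_mult)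
        then have "real n * (u N / real N) = real q * u N + (real j / real N) * u N"
          using N by (simp add: field_simps)
        moreover have "\<bar>(real j / real N) * u N\<bar> \<le> 1 * \<bar>u N\<bar>"
          unfolding abs_mult using j by (intro mult_right_mono) auto
        ultimately show ?thesis by linarith
      qed
      ultimately have "u n \<le> real n * (u N / real N) + K"
        using mult[of q j] unfolding nqj[symmetric] K_def by linarith
      then have "u n / real n \<le> u N / real N + K / real n"
        using n0 by (simp add: field_simps)
      moreover have "K / real n < r / 2"
      proof -
        have "K / (r / 2) < real n" using M n by linarith
        then show ?thesis using r n0 by (simp add: field_simps)
      qed
      moreover have "l \<le> u n / real n" using n by (intro le) auto
      ultimately have "l \<le> u n / real n" "u n / real n < l + r" using N(2) by linarith+
      then show "norm (u n / real n - l) < r" by simp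
    qed
  qed
  then show ?thesis using le by blast
qed

text \<open>A sequence that is additive up to \<open>C\<close> stays within \<open>C\<close> of a linear one. Fekete's lemma for \<open>u + C\<close> provides the
slope and one inequality; the other one follows from superadditivity of \<open>u - C\<close> along multiples of \<open>n\<close>.\<close>

lemma almost_additive:
  fixes u :: "nat \<Rightarrow> real"
  assumes C: "\<And>m n. \<bar>u (m + n) - u m - u n\<bar> \<le> C"
  obtains l where "\<And>n. \<bar>u n - real n * l\<bar> \<le> C"
proof -
  have C0: "0 \<le> C" using C[of 0 0] abs_ge_zero order_trans by blast
  have lin: "\<bar>u n - u 0\<bar> \<le> real n * (\<bar>u 1\<bar> + C)" for n
  proof (induction n)
    case (Suc n)
    then show ?case using C[of n 1] by (simp add: algebra_simps)
  qed simp
  have bd: "u n / real n \<le> \<bar>u 0\<bar> + \<bar>u 1\<bar> + C" "- (\<bar>u 0\<bar> + \<bar>u 1\<bar> + C) \<le> u n / real n" if "1 \<le> n" for n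
  proof -
    have "\<bar>u n\<bar> \<le> 1 * \<bar>u 0\<bar> + real n * (\<bar>u 1\<bar> + C)" using lin[of n] by linarith
    also have "\<dots> \<le> real n * \<bar>u 0\<bar> + real n * (\<bar>u 1\<bar> + C)"
      using that C0 by (intro add_mono mult_right_mono) auto
    finally have "\<bar>u n\<bar> / real n \<le> (real n * \<bar>u 0\<bar> + real n * (\<bar>u 1\<bar> + C)) / real n"
      by (rule divide_right_mono) simp
    also have "\<dots> = \<bar>u 0\<bar> + \<bar>u 1\<bar> + C" using that by (simp add: add_divide_distrib)
    finally have "\<bar>u n / real n\<bar> \<le> \<bar>u 0\<bar> + \<bar>u 1\<bar> + C" using that by (simp add: abs_divide)
    then show "u n / real n \<le> \<bar>u 0\<bar> + \<bar>u 1\<bar> + C" "- (\<bar>u 0\<bar> + \<bar>u 1\<bar> + C) \<le> u n / real n"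
      unfolding abs_le_iff by linarith+
  qed
  have Cn: "0 \<le> C / real n" "C / real n \<le> C" if "1 \<le> n" for n
    using that C0 by (auto simp: field_simps mult_le_cancel_left1)
  have "\<exists>l. (\<lambda>n. (u n + C) / real n) \<longlonglongrightarrow> l \<and> (\<forall>n\<ge>1. l \<le> (u n + C) / real n)"
  proof (rule fekete)
    show "bdd_below ((\<lambda>n. (u n + C) / real n) ` {1..})"
    proof (rule bdd_belowI2[where m = "- (\<bar>u 0\<bar> + \<bar>u 1\<bar> + C)"])
      fix n :: nat assume "n \<in> {1..}"
      then show "- (\<bar>u 0\<bar> + \<bar>u 1\<bar> + C) \<le> (u n + C) / real n"
        using bd[of n] Cn[of n] unfolding add_divide_distrib by auto
    qed
    show "u (m + n) + C \<le> u m + C + (u n + C)" for m n using C[of m n] by linarith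
  qed
  then obtain l where l: "(\<lambda>n. (u n + C) / real n) \<longlonglongrightarrow> l" "\<And>n. n \<ge> 1 \<Longrightarrow> l \<le> (u n + C) / real n"
    by blast
  have low: "(u n - C) / real n \<le> l" if n: "1 \<le> n" for n
  proof -
    have mult: "real (Suc k) * u n - real k * C \<le> u (Suc k * n)" for k
    proof (induction k)
      case (Suc k)
      then show ?case using C[of n "Suc k * n"] by (simp add: algebra_simps abs_le_iff)
    qed simp
    have "(u n - C) / real n \<le> (u (Suc k * n) + C) / real (Suc k * n)" for k
    proof -
      have "real (Suc k) * (u n - C) \<le> u (Suc k * n) + C"
        using mult[of k] C0 by (simp add: algebra_simps)
      then have "real (Suc k) * (u n - C) / real (Suc k * n) \<le> (u (Suc k * n) + C) / real (Suc k * n)"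
        by (rule divide_right_mono) simp
      moreover have "real (Suc k) * (u n - C) / real (Suc k * n) = (u n - C) / real n"
        unfolding of_nat_mult by (rule mult_divide_mult_cancel_left) simp
      ultimately show ?thesis by simp
    qed
    moreover have "(\<lambda>k. (u (Suc k * n) + C) / real (Suc k * n)) \<longlonglongrightarrow> l"
    proof -
      have "strict_mono (\<lambda>k. Suc k * n)" using n by (intro strict_monoI) simp
      then show ?thesis using LIMSEQ_subseq_LIMSEQ[OF l(1)] by (fastforce simp: comp_def)
    qed
    ultimately show ?thesis by (intro LIMSEQ_le_const) blast+
  qed
  have "\<bar>u n - real n * l\<bar> \<le> C" for n
  proof (cases "n = 0")
    case True
    then show ?thesis using C[of 0 0] by simp
  next
    case False
    then show ?thesis using l(2)[of n] low[of n] by (auto simp: field_simps)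
  qed
  then show thesis by (rule that)
qed

section \<open>Transfer operators of double covers\<close>

text \<open>A map with two global inverse branches \<open>b False\<close> and \<open>b True\<close>; \<open>code\<close> tells which branch leads back to a point. The
essential hypothesis is \<open>pairing\<close>: it matches the fibres of any two points so that the inverse branches contract at the
rate \<open>stretch\<close>. The branches themselves may be discontinuous, as they are on the circle. The last two conditions
are the measure-theoretic properties of the compact space that the construction draws on: weak compactness of
probabilities and inner regularity of finite Borel measures.\<close>

locale double_cover =
  fixes T :: "'a::metric_space \<Rightarrow> 'a" and b :: "bool \<Rightarrow> 'a \<Rightarrow> 'a" and code :: "'a \<Rightarrow> bool" and s :: real
  assumes s_pos: "0 < s"
    and compact_space: "compact (UNIV :: 'a set)"
    and dist_le_1: "dist (x :: 'a) y \<le> 1"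
    and T_continuous: "continuous_on UNIV T"
    and T_branch [simp]: "T (b i x) = x"
    and code_branch [simp]: "code (b i x) = i"
    and branch_code [simp]: "b (code y) (T y) = y"
    and pairing: "\<exists>j. \<forall>i. stretch s (dist (b i x) (b (i \<noteq> j) y)) \<le> dist x y"
    and branches_apart: "1 / 3 \<le> dist (b False x) (b True x)"
    and branch_measurable: "b i \<in> borel_measurable borel"
    and code_measurable: "Measurable.pred borel code"
    and code_separates: "0 < e \<Longrightarrow>
      \<exists>k. \<forall>x y. (\<forall>j<k. code ((T ^^ j) x) = code ((T ^^ j) y)) \<longrightarrow> dist x y < e"
    and weakly_compact: "\<exists>r \<mu>. strict_mono (r :: nat \<Rightarrow> nat) \<and> prob_space \<mu> \<and> sets \<mu> = sets borel \<and>
      (\<forall>\<phi> :: 'a \<Rightarrow> real. continuous_on UNIV \<phi> \<longrightarrow>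
        (\<lambda>n. measure_pmf.expectation (p (r n)) \<phi>) \<longlonglongrightarrow> (\<integral>x. \<phi> x \<partial>\<mu>))"
    and inner_closed: "finite_measure (m :: 'a measure) \<Longrightarrow> sets m = sets borel \<Longrightarrow> A \<in> sets borel \<Longrightarrow> 0 < e \<Longrightarrow>
      \<exists>K\<subseteq>A. closed K \<and> measure m (A - K) < (e :: real)"
begin

lemma branch_inj [simp]: "b i x = b j y \<longleftrightarrow> i = j \<and> x = y"
proof
  assume eq: "b i x = b j y"
  have "x = y" using arg_cong[OF eq, of T] by simp
  moreover have "i = j" using arg_cong[OF eq, of code] by simp
  ultimately show "i = j \<and> x = y" by simp
qed simp

lemma vimage_T: "T -` {x} = {b False x, b True x}"
proof -
  have "y \<in> {b False x, b True x}" if "T y = x" for y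
    using branch_code[of y] that by (cases "code y") auto
  then show ?thesis by auto
qed

lemma transfer_eq: "transfer_operator T g \<phi> x = (\<Sum>i\<in>UNIV. exp (g (b i x)) *\<^sub>R \<phi> (b i x))"
  unfolding transfer_operator_def vimage_T UNIV_bool by (subst (1 2) sum.insert) auto

lemma transfer_real: 
  "transfer_operator T g (\<phi> :: 'a \<Rightarrow> real) x = (\<Sum>i\<in>UNIV. exp (g (b i x)) * \<phi> (b i x))"
  by (simp add: transfer_eq)

lemma sum_paired: 
  fixes F :: "bool \<Rightarrow> 'c::ab_group_add" and j :: bool
  shows "(\<Sum>i\<in>UNIV. F (i \<noteq> j)) = (\<Sum>i\<in>UNIV. F i)"
  by (cases j) (simp_all add: UNIV_bool add.commute)

lemma stretch_dist: "dist x y \<le> stretch s (dist x y)"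
  by (rule le_stretch)

lemma continuous_bounded:
  fixes \<phi> :: "'a \<Rightarrow> 'b::real_normed_vector"
  assumes "continuous_on UNIV \<phi>"
  obtains B where "0 < B" "\<And>x. norm (\<phi> x) \<le> B"
proof -
  have "bounded (range \<phi>)"
    by (intro compact_imp_bounded compact_continuous_image assms compact_space)
  then show thesis using that bounded_pos by (metis rangeI)
qed

lemma uniformly_continuous:
  fixes \<phi> :: "'a \<Rightarrow> 'b::metric_space"
  assumes "continuous_on UNIV \<phi>" and "0 < e"
  obtains d where "0 < d" "\<And>x y. dist x y < d \<Longrightarrow> dist (\<phi> x) (\<phi> y) < e"
  using compact_uniformly_continuous[OF assms(1) compact_space] assms(2)
  unfolding uniformly_continuous_on_def by (metis UNIV_I dist_commute)

lemma transfer_continuous: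
  fixes \<phi> :: "'a \<Rightarrow> 'b::real_normed_vector"
  assumes g: "continuous_on UNIV g" and \<phi>: "continuous_on UNIV \<phi>"
  shows "continuous_on UNIV (transfer_operator T g \<phi>)"
proof (rule continuous_onI)
  fix x :: 'a and e :: real assume e: "0 < e"
  define F where "F y = exp (g y) *\<^sub>R \<phi> y" for y
  have "continuous_on UNIV F" unfolding F_def by (intro continuous_intros g \<phi>)
  then obtain d where d: "0 < d" "\<And>x y. dist x y < d \<Longrightarrow> dist (F x) (F y) < e / 2"
    using uniformly_continuous[of F "e / 2"] e by auto
  have "dist (transfer_operator T g \<phi> y) (transfer_operator T g \<phi> x) \<le> e" if yx: "dist y x < d" for y
  proof -
    obtain j where j: "\<And>i. stretch s (dist (b i y) (b (i \<noteq> j) x)) \<le> dist y x"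
      using pairing by blast
    have F: "dist (F (b i y)) (F (b (i \<noteq> j) x)) \<le> e / 2" for i
      using j[of i] stretch_dist[of "b i y" "b (i \<noteq> j) x"] yx by (intro less_imp_le d) linarith
    have "dist (transfer_operator T g \<phi> y) (transfer_operator T g \<phi> x)
        = norm (\<Sum>i\<in>UNIV. F (b i y) - F (b (i \<noteq> j) x))"
      using sum_paired[of "\<lambda>i. F (b i x)" j] by (simp add: transfer_eq F_def dist_norm sum_subtractf)
    also have "\<dots> \<le> (\<Sum>i\<in>(UNIV :: bool set). e / 2)"
      using F by (intro sum_norm_le) (simp add: dist_norm)
    also have "\<dots> = e" by simp
    finally show ?thesis .
  qed
  then show "\<exists>d>0. \<forall>y\<in>UNIV. dist y x < d \<longrightarrow> dist (transfer_operator T g \<phi> y) (transfer_operator T g \<phi> x) \<le> e"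
    using d(1) by blast
qed

lemma transfer_iter_continuous:
  assumes "continuous_on UNIV g" and "continuous_on UNIV \<phi>"
  shows "continuous_on UNIV ((transfer_operator T g ^^ n) \<phi>)"
  by (induction n) (auto intro: transfer_continuous assms)

lemma transfer_linear:
  fixes \<phi> \<psi> :: "'a \<Rightarrow> real"
  shows "transfer_operator T g (\<lambda>y. a * \<phi> y + c * \<psi> y)
    = (\<lambda>x. a * transfer_operator T g \<phi> x + c * transfer_operator T g \<psi> x)"
  by (rule ext) (simp add: transfer_real UNIV_bool algebra_simps)

lemma transfer_iter_linear:
  fixes \<phi> \<psi> :: "'a \<Rightarrow> real"
  shows "(transfer_operator T g ^^ n) (\<lambda>y. a * \<phi> y + c * \<psi> y)
    = (\<lambda>x. a * (transfer_operator T g ^^ n) \<phi> x + c * (transfer_operator T g ^^ n) \<psi> x)"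
  by (induction n) (simp_all add: transfer_linear)

lemma transfer_iter_scale:
  fixes \<phi> :: "'a \<Rightarrow> real"
  shows "(transfer_operator T g ^^ n) (\<lambda>y. a * \<phi> y) = (\<lambda>x. a * (transfer_operator T g ^^ n) \<phi> x)"
  using transfer_iter_linear[of n g a \<phi> 0 \<phi>] by simp

lemma transfer_mono:
  fixes \<phi> \<psi> :: "'a \<Rightarrow> real"
  assumes "\<And>x. \<phi> x \<le> \<psi> x"
  shows "transfer_operator T g \<phi> x \<le> transfer_operator T g \<psi> x"
  unfolding transfer_real by (intro sum_mono mult_left_mono assms) auto

lemma transfer_iter_mono:
  fixes \<phi> \<psi> :: "'a \<Rightarrow> real"
  assumes "\<And>x. \<phi> x \<le> \<psi> x"
  shows "(transfer_operator T g ^^ n) \<phi> x \<le> (transfer_operator T g ^^ n) \<psi> x"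
  by (induction n arbitrary: x) (auto intro: transfer_mono assms)

lemma transfer_pos:
  fixes \<phi> :: "'a \<Rightarrow> real"
  assumes "\<And>x. 0 < \<phi> x"
  shows "0 < transfer_operator T g \<phi> x"
  unfolding transfer_real by (intro sum_pos mult_pos_pos assms) auto

lemma transfer_iter_pos:
  fixes \<phi> :: "'a \<Rightarrow> real"
  assumes "\<And>x. 0 < \<phi> x"
  shows "0 < (transfer_operator T g ^^ n) \<phi> x"
  by (induction n arbitrary: x) (auto intro: transfer_pos assms)

text \<open>Pulling \<open>z\<close> back along the orbit of \<open>x\<close> by matched preimages gives a point \<open>y\<close> of the fibre of \<open>T\<^sup>N\<close> over \<open>z\<close>. If
\<open>dist x y \<ge> \<delta>\<close>, each of the \<open>N\<close> steps has contributed at least \<open>\<delta>\<^bsup>s+1\<^esup>/4\<close> to a distance that is at most 1.\<close>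

lemma preimages_dense:
  assumes \<delta>: "0 < \<delta>"
  obtains N where "\<And>x z. \<exists>y. (T ^^ N) y = z \<and> dist x y < \<delta>"
proof -
  have *: "\<exists>y. (T ^^ N) y = z \<and>
      (\<delta> \<le> dist x y \<longrightarrow> dist x y + real N * (\<delta> powr (s + 1) / 4) \<le> dist ((T ^^ N) x) z)" for N x z
  proof (induction N arbitrary: z)
    case (Suc N)
    define p where "p = (T ^^ N) x"
    obtain j where j: "\<And>i. stretch s (dist (b i (T p)) (b (i \<noteq> j) z)) \<le> dist (T p) z"
      using pairing by blast
    define q where "q = b (code p \<noteq> j) z"
    have q: "stretch s (dist p q) \<le> dist (T p) z" "T q = z"
      using j[of "code p"] by (auto simp: q_def)
    obtain y where y: "(T ^^ N) y = q"
      "\<delta> \<le> dist x y \<longrightarrow> dist x y + real N * (\<delta> powr (s + 1) / 4) \<le> dist p q"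
      using Suc.IH[of q] unfolding p_def by blast
    have "dist x y + real (Suc N) * (\<delta> powr (s + 1) / 4) \<le> dist (T p) z" if le: "\<delta> \<le> dist x y"
    proof -
      have 1: "dist x y + real N * (\<delta> powr (s + 1) / 4) \<le> dist p q" using y le by blast
      moreover have "0 \<le> real N * (\<delta> powr (s + 1) / 4)" by simp
      ultimately have "\<delta> \<le> dist p q" using le by linarith
      then have "\<delta> powr (s + 1) \<le> dist p q powr (s + 1)" using \<delta> s_pos by (intro powr_mono2) auto
      moreover have "real (Suc N) * (\<delta> powr (s + 1) / 4) = \<delta> powr (s + 1) / 4 + real N * (\<delta> powr (s + 1) / 4)"
        by (simp add: algebra_simps)
      ultimately show ?thesis using 1 q(1) unfolding stretch_def by linarith
    qed
    then show ?case using y(1) q(2) by (intro exI[of _ y]) (simp add: p_def)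
  qed auto
  obtain N where N: "1 < real N * (\<delta> powr (s + 1) / 4)"
    using ex_less_of_nat_mult[of "\<delta> powr (s + 1) / 4" 1] \<delta> by auto
  have "\<exists>y. (T ^^ N) y = z \<and> dist x y < \<delta>" for x z
  proof -
    obtain y where y: "(T ^^ N) y = z"
      "\<delta> \<le> dist x y \<longrightarrow> dist x y + real N * (\<delta> powr (s + 1) / 4) \<le> dist ((T ^^ N) x) z"
      using * by blast
    have "dist x y < \<delta>"
      using y(2) N dist_le_1[of "(T ^^ N) x" z] zero_le_dist[of x y] by linarith
    then show ?thesis using y(1) by blast
  qed
  then show thesis by (rule that)
qed

end

section \<open>The positive eigenfunction\<close>

text \<open>The variation \<open>w\<close> of \<open>f\<close> is absorbed by the increase of \<open>W\<close> under \<open>stretch\<close>. This is the only form in which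
the modulus of continuity of \<open>f\<close> enters.\<close>

locale cover_potential = double_cover T b code s
  for T :: "'a::metric_space \<Rightarrow> 'a" and b code s +
  fixes f :: "'a \<Rightarrow> real" and w W :: "real \<Rightarrow> real"
  assumes f_continuous: "continuous_on UNIV f"
    and f_modulus: "\<bar>f x - f y\<bar> \<le> w (dist x y)"
    and w_mono: "0 \<le> d \<Longrightarrow> d \<le> e \<Longrightarrow> w d \<le> w e"
    and W_nonneg: "0 \<le> d \<Longrightarrow> 0 \<le> W d"
    and W_mono: "0 \<le> d \<Longrightarrow> d \<le> e \<Longrightarrow> W d \<le> W e"
    and W_small: "0 < \<epsilon> \<Longrightarrow> \<exists>\<delta>>0. \<forall>d. 0 \<le> d \<and> d < \<delta> \<longrightarrow> W d < \<epsilon>"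
    and W_step: "0 \<le> d \<Longrightarrow> stretch s d \<le> e \<Longrightarrow> w d + W d \<le> W e"
begin

abbreviation L :: "('a \<Rightarrow> real) \<Rightarrow> 'a \<Rightarrow> real" where "L \<equiv> transfer_operator T f"

definition log_regular :: "real \<Rightarrow> real \<Rightarrow> ('a \<Rightarrow> real) \<Rightarrow> bool" where
  "log_regular \<epsilon> \<delta> \<phi> \<longleftrightarrow>
     (\<forall>x. 0 \<le> \<phi> x) \<and> (\<forall>x y. dist x y < \<delta> \<longrightarrow> \<phi> x \<le> exp (\<epsilon> + W (dist x y)) * \<phi> y)"

text \<open>Matched preimages satisfy \<open>w d + W d \<le> W (dist x y)\<close>, so the bound reproduces itself without loss. The slack
\<open>\<epsilon>\<close> and the range \<open>\<delta>\<close> serve later for arbitrary continuous functions; they are preserved because matched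
preimages are closer than their images.\<close>

lemma log_regular_transfer:
  assumes "log_regular \<epsilon> \<delta> \<phi>"
  shows "log_regular \<epsilon> \<delta> (L \<phi>)"
proof -
  have pos: "0 \<le> \<phi> x" and reg: "dist x y < \<delta> \<Longrightarrow> \<phi> x \<le> exp (\<epsilon> + W (dist x y)) * \<phi> y" for x y
    using assms by (auto simp: log_regular_def)
  have "L \<phi> x \<le> exp (\<epsilon> + W (dist x y)) * L \<phi> y" if xy: "dist x y < \<delta>" for x y
  proof -
    obtain j where j: "\<And>i. stretch s (dist (b i x) (b (i \<noteq> j) y)) \<le> dist x y"
      using pairing by blast
    have "exp (f (b i x)) * \<phi> (b i x)
        \<le> exp (\<epsilon> + W (dist x y)) * (exp (f (b (i \<noteq> j) y)) * \<phi> (b (i \<noteq> j) y))" for i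
    proof -
      let ?u = "b i x" and ?v = "b (i \<noteq> j) y"
      have st: "w (dist ?u ?v) + W (dist ?u ?v) \<le> W (dist x y)"
        by (rule W_step[OF _ j]) simp
      have "dist ?u ?v < \<delta>" using stretch_dist[of ?u ?v] j[of i] xy by linarith
      then have "exp (f ?u) * \<phi> ?u \<le> exp (f ?v + w (dist ?u ?v)) * (exp (\<epsilon> + W (dist ?u ?v)) * \<phi> ?v)"
        using f_modulus[of ?u ?v] pos by (intro mult_mono reg) auto
      also have "\<dots> = exp (\<epsilon> + (w (dist ?u ?v) + W (dist ?u ?v))) * (exp (f ?v) * \<phi> ?v)"
        by (simp add: exp_add ac_simps)
      also have "\<dots> \<le> exp (\<epsilon> + W (dist x y)) * (exp (f ?v) * \<phi> ?v)"
        using st pos by (intro mult_right_mono) auto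
      finally show ?thesis .
    qed
    then have "L \<phi> x \<le> (\<Sum>i\<in>UNIV. exp (\<epsilon> + W (dist x y)) * (exp (f (b (i \<noteq> j) y)) * \<phi> (b (i \<noteq> j) y)))"
      unfolding transfer_real by (rule sum_mono)
    also have "\<dots> = exp (\<epsilon> + W (dist x y)) * L \<phi> y"
      unfolding sum_distrib_left[symmetric] transfer_real
      using sum_paired[of "\<lambda>i. exp (f (b i y)) * \<phi> (b i y)" j] by simp
    finally show ?thesis .
  qed
  moreover have "0 \<le> L \<phi> x" for x
    unfolding transfer_real using pos by (intro sum_nonneg) auto
  ultimately show ?thesis by (simp add: log_regular_def)
qed

lemma log_regular_transfer_iter: "log_regular \<epsilon> \<delta> \<phi> \<Longrightarrow> log_regular \<epsilon> \<delta> ((L ^^ n) \<phi>)"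
  by (induction n) (auto intro: log_regular_transfer)

lemma log_regular_limit:
  assumes "\<And>n. log_regular \<epsilon> \<delta> (\<phi> n)" and lim: "\<And>x. (\<lambda>n. \<phi> n x) \<longlonglongrightarrow> \<psi> x"
  shows "log_regular \<epsilon> \<delta> \<psi>"
proof -
  have pos: "0 \<le> \<phi> n x" and reg: "dist x y < \<delta> \<Longrightarrow> \<phi> n x \<le> exp (\<epsilon> + W (dist x y)) * \<phi> n y" for n x y
    using assms(1)[of n] by (auto simp: log_regular_def)
  have "0 \<le> \<psi> x" for x
    using LIMSEQ_le_const[OF lim] pos by blast
  moreover have "\<psi> x \<le> exp (\<epsilon> + W (dist x y)) * \<psi> y" if "dist x y < \<delta>" for x y
    using LIMSEQ_le[OF lim tendsto_mult_left[OF lim]] reg[OF that] by blast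
  ultimately show ?thesis by (simp add: log_regular_def)
qed

lemma log_regular_scale: "0 \<le> a \<Longrightarrow> log_regular \<epsilon> \<delta> \<phi> \<Longrightarrow> log_regular \<epsilon> \<delta> (\<lambda>x. a * \<phi> x)"
  unfolding log_regular_def by (auto simp: mult.left_commute intro: mult_left_mono)

lemma log_regular_global:
  assumes "log_regular 0 2 \<phi>"
  shows "\<phi> x \<le> exp (W (dist x y)) * \<phi> y" and "\<phi> x \<le> exp (W 1) * \<phi> y"
proof -
  show 1: "\<phi> x \<le> exp (W (dist x y)) * \<phi> y"
    using assms dist_le_1[of x y] by (auto simp: log_regular_def)
  also have "\<dots> \<le> exp (W 1) * \<phi> y"
    using assms dist_le_1[of x y] by (intro mult_right_mono) (auto simp: log_regular_def intro: W_mono)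
  finally show "\<phi> x \<le> exp (W 1) * \<phi> y" .
qed

lemma transfer_tendsto:
  assumes "\<And>x. (\<lambda>n. \<phi> n x) \<longlonglongrightarrow> \<psi> x"
  shows "(\<lambda>n. L (\<phi> n) x) \<longlonglongrightarrow> L \<psi> x"
  unfolding transfer_real by (intro tendsto_sum tendsto_mult_left assms)

text \<open>The values of \<open>L\<^sup>n 1\<close> at any two points are comparable up to \<open>exp (W 1)\<close>, so \<open>ln (L\<^sup>n 1)\<close> at a reference point is
almost additive in \<open>n\<close>.\<close>

lemma growth_rate:
  obtains \<kappa> where "0 < \<kappa>"
    "\<And>n x. (L ^^ n) (\<lambda>_. 1) x \<le> exp (2 * W 1) * \<kappa> ^ n"
    "\<And>n x. exp (- 2 * W 1) * \<kappa> ^ n \<le> (L ^^ n) (\<lambda>_. 1) x"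
proof -
  define u where "u n = (L ^^ n) (\<lambda>_. 1 :: real)" for n
  define c where "c n = u n undefined" for n
  have "log_regular 0 2 (\<lambda>_. 1)" using W_nonneg by (auto simp: log_regular_def)
  then have reg: "log_regular 0 2 (u n)" for n unfolding u_def by (rule log_regular_transfer_iter)
  have u_pos: "0 < u n x" for n x unfolding u_def by (rule transfer_iter_pos) simp
  have up: "u n x \<le> exp (W 1) * c n" and lo: "exp (- W 1) * c n \<le> u n x" for n x
    using log_regular_global(2)[OF reg, of n x undefined] log_regular_global(2)[OF reg, of n undefined x]
    by (auto simp: c_def exp_minus field_simps)
  have add: "u (m + n) x = (L ^^ m) (u n) x" for m n x
    by (simp add: u_def funpow_add)
  have scale: "(L ^^ m) (\<lambda>_. a) x = a * u m x" for m a x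
    using transfer_iter_scale[of m f a "\<lambda>_. 1"] by (simp add: u_def)
  have c_pos: "0 < c n" for n by (simp add: c_def u_pos)
  have "\<bar>ln (c (m + n)) - ln (c m) - ln (c n)\<bar> \<le> W 1" for m n
  proof -
    have "c (m + n) \<le> exp (W 1) * c n * c m"
    proof -
      have "(L ^^ m) (u n) undefined \<le> (L ^^ m) (\<lambda>_. exp (W 1) * c n) undefined"
        by (rule transfer_iter_mono) (rule up)
      then show ?thesis by (simp add: c_def add scale)
    qed
    then have "ln (c (m + n)) \<le> ln (exp (W 1) * c n * c m)"
      using c_pos by (intro ln_mono) auto
    moreover have "exp (- W 1) * c n * c m \<le> c (m + n)"
    proof -
      have "(L ^^ m) (\<lambda>_. exp (- W 1) * c n) undefined \<le> (L ^^ m) (u n) undefined"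
        by (rule transfer_iter_mono) (rule lo)
      then show ?thesis by (simp add: c_def add scale)
    qed
    then have "ln (exp (- W 1) * c n * c m) \<le> ln (c (m + n))"
      using c_pos by (intro ln_mono) auto
    ultimately show ?thesis using c_pos[of n] c_pos[of m] by (simp add: ln_mult)
  qed
  from almost_additive[of "\<lambda>n. ln (c n)", OF this]
  obtain l where l: "\<And>n. \<bar>ln (c n) - real n * l\<bar> \<le> W 1" by blast
  have cn: "c n \<le> exp (W 1) * exp l ^ n" "exp (- W 1) * exp l ^ n \<le> c n" for n
  proof -
    have e: "exp (W 1) * exp l ^ n = exp (W 1 + real n * l)"
      "exp (- W 1) * exp l ^ n = exp (- W 1 + real n * l)"
      by (simp_all only: exp_of_nat_mult exp_add)
    have "exp (ln (c n)) \<le> exp (W 1 + real n * l)" "exp (- W 1 + real n * l) \<le> exp (ln (c n))"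
      using l[of n] by (auto simp: abs_le_iff)
    then show "c n \<le> exp (W 1) * exp l ^ n" "exp (- W 1) * exp l ^ n \<le> c n"
      using c_pos[of n] unfolding e by (simp_all only: exp_ln)
  qed
  have "u n x \<le> exp (2 * W 1) * exp l ^ n" for n x
  proof -
    have "u n x \<le> exp (W 1) * (exp (W 1) * exp l ^ n)"
      using up[of n x] cn(1)[of n] by (meson exp_ge_zero mult_left_mono order_trans)
    then show ?thesis by (simp add: exp_double power2_eq_square mult.assoc)
  qed
  moreover have "exp (- 2 * W 1) * exp l ^ n \<le> u n x" for n x
  proof -
    have "exp (- W 1) * (exp (- W 1) * exp l ^ n) \<le> u n x"
      using lo[of n x] cn(2)[of n] by (meson exp_ge_zero mult_left_mono order_trans)
    then show ?thesis by (simp add: mult_exp_exp mult.assoc[symmetric])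
  qed
  ultimately show thesis using that[of "exp l"] by (simp add: u_def)
qed

text \<open>The lower limit \<open>w0\<close> of \<open>v\<^sub>n = \<kappa>\<^bsup>-n\<^esup> L\<^sup>n 1\<close> satisfies \<open>L w0 \<le> \<kappa> w0\<close> because \<open>L\<close> is positive. Hence
\<open>\<kappa>\<^bsup>-n\<^esup> L\<^sup>n w0\<close> is decreasing; it is bounded below by a positive constant, and its limit is an eigenfunction. The
regularity bound passes through infima and pointwise limits.\<close>

lemma ex_eigenfunction:
  obtains \<kappa> h where "0 < \<kappa>" "\<And>x. 0 < h x" "log_regular 0 2 h" "L h = (\<lambda>x. \<kappa> * h x)"
proof -
  obtain \<kappa> where \<kappa>: "0 < \<kappa>"
    and up: "\<And>n x. (L ^^ n) (\<lambda>_. 1) x \<le> exp (2 * W 1) * \<kappa> ^ n"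
    and low: "\<And>n x. exp (- 2 * W 1) * \<kappa> ^ n \<le> (L ^^ n) (\<lambda>_. 1) x"
    by (rule growth_rate) blast
  define A where "A = exp (- 2 * W 1)"
  have A: "0 < A" by (simp add: A_def)
  define v where "v n x = (L ^^ n) (\<lambda>_. 1) x / \<kappa> ^ n" for n x
  have vA: "A \<le> v n x" and vB: "v n x \<le> exp (2 * W 1)" for n x
    using up[of n x] low[of n x] \<kappa> by (auto simp: v_def A_def field_simps)
  have "log_regular 0 2 (\<lambda>_. 1)" using W_nonneg by (auto simp: log_regular_def)
  then have regv: "log_regular 0 2 (v n)" for n
    using log_regular_scale[of "1 / \<kappa> ^ n", OF _ log_regular_transfer_iter] \<kappa> by (simp add: v_def[abs_def])
  have L_v: "L (v n) x = \<kappa> * v (Suc n) x" for n x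
    using transfer_iter_scale[of 1 f "1 / \<kappa> ^ n" "(L ^^ n) (\<lambda>_. 1)"] \<kappa> by (simp add: v_def[abs_def])
  \<comment> \<open>tail infima, whose increasing limit is the lower limit of \<open>v\<close>\<close>
  define lo where "lo n x = (INF k\<in>{n..}. v k x)" for n x
  have bdd: "bdd_below ((\<lambda>k. v k x) ` {n..})" for n x
    using vA by (intro bdd_belowI2[where m = A])
  have lo_le: "lo n x \<le> v k x" if "n \<le> k" for n k x
    unfolding lo_def using that by (intro cINF_lower[OF bdd]) auto
  have le_lo: "a \<le> lo n x" if "\<And>k. n \<le> k \<Longrightarrow> a \<le> v k x" for a n x
    unfolding lo_def using that by (intro cINF_greatest) auto
  have reg_lo: "log_regular 0 2 (lo n)" for n
  proof -
    have "lo n x \<le> exp (W (dist x y)) * lo n y" for x y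
    proof -
      have "lo n x / exp (W (dist x y)) \<le> lo n y"
      proof (rule le_lo)
        fix k assume "n \<le> k"
        then have "lo n x \<le> exp (W (dist x y)) * v k y"
          using lo_le log_regular_global(1)[OF regv] order_trans by blast
        then show "lo n x / exp (W (dist x y)) \<le> v k y" by (simp add: field_simps)
      qed
      then show ?thesis by (simp add: field_simps)
    qed
    moreover have "0 \<le> lo n x" for x
      using A vA by (intro le_lo) (meson less_imp_le order_trans)
    ultimately show ?thesis by (simp add: log_regular_def)
  qed
  have inc: "incseq (\<lambda>n. lo n x)" for x
    by (rule incseq_SucI) (auto intro!: le_lo lo_le)
  have "\<exists>l. (\<lambda>n. lo n x) \<longlonglongrightarrow> l" for x
  proof -
    have "\<forall>n. lo n x \<le> exp (2 * W 1)" using lo_le vB order_trans order_refl by blast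
    then show ?thesis using incseq_convergent[OF inc] by metis
  qed
  then obtain w0 where w0: "\<And>x. (\<lambda>n. lo n x) \<longlonglongrightarrow> w0 x" by metis
  have reg_w0: "log_regular 0 2 w0" by (rule log_regular_limit[OF reg_lo w0])
  have w0_ge: "A \<le> w0 x" for x
    by (rule LIMSEQ_le_const[OF w0]) (auto intro!: le_lo vA)
  have step: "L (lo n) x \<le> \<kappa> * lo (Suc n) x" for n x
  proof -
    have "L (lo n) x / \<kappa> \<le> lo (Suc n) x"
    proof (rule le_lo)
      fix k assume k: "Suc n \<le> k"
      have "L (lo n) x \<le> L (v (k - 1)) x"
        using k by (intro transfer_mono lo_le) auto
      then show "L (lo n) x / \<kappa> \<le> v k x" using k \<kappa> by (simp add: L_v field_simps)
    qed
    then show ?thesis using \<kappa> by (simp add: field_simps)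
  qed
  have sub: "L w0 x \<le> \<kappa> * w0 x" for x
  proof (rule LIMSEQ_le[OF transfer_tendsto[OF w0]])
    show "(\<lambda>n. \<kappa> * lo (Suc n) x) \<longlonglongrightarrow> \<kappa> * w0 x"
      by (intro tendsto_mult_left LIMSEQ_Suc w0)
  qed (use step in auto)
  \<comment> \<open>by subinvariance this sequence is decreasing\<close>
  define z where "z n x = (L ^^ n) w0 x / \<kappa> ^ n" for n x
  have z_Suc: "L (z n) x = \<kappa> * z (Suc n) x" for n x
    using transfer_iter_scale[of 1 f "1 / \<kappa> ^ n" "(L ^^ n) w0"] \<kappa> by (simp add: z_def[abs_def])
  have reg_z: "log_regular 0 2 (z n)" for n
    using log_regular_scale[of "1 / \<kappa> ^ n", OF _ log_regular_transfer_iter[OF reg_w0]] \<kappa> by (simp add: z_def[abs_def])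
  have z_dec: "decseq (\<lambda>n. z n x)" for x
  proof (rule decseq_SucI)
    fix n
    have "(L ^^ Suc n) w0 x \<le> \<kappa> * (L ^^ n) w0 x"
      using transfer_iter_mono[where \<phi> = "L w0" and \<psi> = "\<lambda>x. \<kappa> * w0 x" and n = n and g = f and x = x] sub
      by (simp add: funpow_Suc_right transfer_iter_scale del: funpow.simps)
    then show "z (Suc n) x \<le> z n x" using \<kappa> by (simp add: z_def field_simps del: funpow.simps)
  qed
  have z_ge: "A * A \<le> z n x" for n x
  proof -
    have "A * (L ^^ n) (\<lambda>_. 1) x \<le> (L ^^ n) w0 x"
      using transfer_iter_mono[where \<phi> = "\<lambda>_. A * 1" and \<psi> = w0 and n = n and g = f and x = x] w0_ge
      unfolding transfer_iter_scale by simp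
    then have "A * v n x \<le> z n x" using \<kappa> by (simp add: v_def z_def field_simps)
    moreover have "A * A \<le> A * v n x" using A vA by (intro mult_left_mono) auto
    ultimately show ?thesis by linarith
  qed
  have "\<exists>l. (\<lambda>n. z n x) \<longlonglongrightarrow> l" for x
    using decseq_convergent[OF z_dec] z_ge by metis
  then obtain h where h: "\<And>x. (\<lambda>n. z n x) \<longlonglongrightarrow> h x" by metis
  have "L h x = \<kappa> * h x" for x
  proof (rule LIMSEQ_unique[OF transfer_tendsto[OF h]])
    show "(\<lambda>n. L (z n) x) \<longlonglongrightarrow> \<kappa> * h x"
      unfolding z_Suc by (intro tendsto_mult_left LIMSEQ_Suc h)
  qed
  moreover have "0 < h x" for x
    using LIMSEQ_le_const[OF h, of "A * A" x] z_ge A by (meson mult_pos_pos order_less_le_trans)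
  moreover have "log_regular 0 2 h" by (rule log_regular_limit[OF reg_z h])
  ultimately show thesis using that \<kappa> by blast
qed

end

section \<open>Averages over preimages\<close>

text \<open>Multiplicative bounds with a constant close to 1 become additive ones on a bounded range.\<close>

lemma exp_slack:
  fixes M e :: real
  assumes "0 < M" "0 < e"
  obtains \<eta> where "0 < \<eta>" "\<And>a c. 0 \<le> a \<Longrightarrow> a \<le> M \<Longrightarrow> c \<le> exp \<eta> * a \<Longrightarrow> c \<le> a + e"
proof
  show "0 < ln (1 + e / M)" using assms by (intro ln_gt_zero) simp
  fix a c :: real assume a: "0 \<le> a" "a \<le> M" and c: "c \<le> exp (ln (1 + e / M)) * a"
  have "exp (ln (1 + e / M)) = 1 + e / M" using assms by (intro exp_ln) (simp add: add_pos_pos)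
  then have "c \<le> a + e * (a / M)" using c by (simp add: algebra_simps)
  also have "e * (a / M) \<le> e * 1" using assms a by (intro mult_left_mono) auto
  finally show "c \<le> a + e" by simp
qed

context double_cover
begin

text \<open>For such a \<open>g\<close>, the transfer operator is the Markov operator that averages over preimages with weights \<open>exp g\<close>.\<close>

definition normalized :: "('a \<Rightarrow> real) \<Rightarrow> bool" where
  "normalized g \<longleftrightarrow> continuous_on UNIV g \<and> (\<forall>x. (\<Sum>i\<in>UNIV. exp (g (b i x))) = 1)"

lemma transfer_normalized_const:
  "normalized g \<Longrightarrow> transfer_operator T g (\<lambda>_. a) = (\<lambda>_. a :: real)"
  by (rule ext) (simp add: normalized_def transfer_real sum_distrib_right[symmetric])

lemma transfer_normalized_le:
  assumes g: "normalized g" and "\<And>x. \<phi> x \<le> (M :: real)"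
  shows "transfer_operator T g \<phi> x \<le> M"
  using transfer_mono[of \<phi> "\<lambda>_. M" g x] assms by (simp add: transfer_normalized_const)

lemma transfer_normalized_ge:
  assumes g: "normalized g" and "\<And>x. (M :: real) \<le> \<phi> x"
  shows "M \<le> transfer_operator T g \<phi> x"
  using transfer_mono[of "\<lambda>_. M" \<phi> g x] assms by (simp add: transfer_normalized_const)

lemma transfer_normalized_compose:
  "normalized g \<Longrightarrow> transfer_operator T g (\<lambda>y. \<phi> (T y)) = (\<phi> :: 'a \<Rightarrow> real)"
  by (rule ext) (simp add: normalized_def transfer_real sum_distrib_right[symmetric])

lemma transfer_iter_ge_preimage:
  fixes \<phi> :: "'a \<Rightarrow> real"
  assumes pos: "\<And>y. 0 \<le> \<phi> y" and m: "0 \<le> m" "\<And>y. m \<le> exp (g y)"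
  shows "m ^ N * \<phi> y \<le> (transfer_operator T g ^^ N) \<phi> ((T ^^ N) y)"
proof (induction N)
  case (Suc N)
  define z where "z = (T ^^ N) y"
  define \<psi> where "\<psi> = (transfer_operator T g ^^ N) \<phi>"
  have \<psi>: "0 \<le> \<psi> u" for u
    using transfer_iter_mono[of "\<lambda>_. 0" \<phi> N g u] transfer_iter_scale[of N g 0 \<phi>] pos
    by (simp add: \<psi>_def)
  have "m ^ Suc N * \<phi> y = m * (m ^ N * \<phi> y)" by simp
  also have "\<dots> \<le> exp (g z) * \<psi> z"
    using Suc m \<psi> pos by (intro mult_mono) (auto simp: \<psi>_def z_def)
  also have "\<dots> = exp (g (b (code z) (T z))) * \<psi> (b (code z) (T z))" by simp
  also have "\<dots> \<le> transfer_operator T g \<psi> (T z)"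
    unfolding transfer_real
    by (rule member_le_sum[where f = "\<lambda>i. exp (g (b i (T z))) * \<psi> (b i (T z))"]) (auto simp: \<psi>)
  finally show ?case by (simp add: \<psi>_def z_def)
qed simp

text \<open>The maxima of the averages decrease and the minima increase. If their limits differed by \<open>3\<eta>\<close>, equicontinuity would keep
the averages below the minimum plus \<open>2\<eta>\<close> on balls of a fixed radius, every fibre of \<open>T\<^sup>N\<close> meets such a ball,
and so \<open>N\<close> further steps would lower the maximum by a fixed fraction of \<open>\<eta>\<close>.\<close>

lemma equicontinuous_averages_converge:
  fixes \<phi> :: "'a \<Rightarrow> real"
  assumes g: "normalized g"
    and bound: "\<And>x. \<bar>\<phi> x\<bar> \<le> B"
    and equi: "\<And>e. 0 < e \<Longrightarrow> \<exists>\<delta>>0. \<forall>n x y. dist x y < \<delta> \<longrightarrow>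
      (transfer_operator T g ^^ n) \<phi> y \<le> (transfer_operator T g ^^ n) \<phi> x + e"
  obtains c where "uniform_limit UNIV (\<lambda>n. (transfer_operator T g ^^ n) \<phi>) (\<lambda>_. c) sequentially"
proof -
  define p where "p n = (transfer_operator T g ^^ n) \<phi>" for n
  have p_Suc: "p (Suc n) = transfer_operator T g (p n)" for n by (simp add: p_def)
  have pb: "- B \<le> p n x \<and> p n x \<le> B" for n x
  proof (induction n arbitrary: x)
    case 0
    then show ?case using bound[of x] by (auto simp: p_def abs_le_iff)
  next
    case (Suc n)
    then show ?case unfolding p_Suc
      by (intro conjI transfer_normalized_ge[OF g] transfer_normalized_le[OF g]) auto
  qed
  define S I where "S n = (SUP x. p n x)" and "I n = (INF x. p n x)" for n
  have ba: "bdd_above (range (p n))" and bb: "bdd_below (range (p n))" for n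
    using pb by (auto intro: bdd_aboveI2[where M = B] bdd_belowI2[where m = "- B"])
  have leS: "p n x \<le> S n" and geI: "I n \<le> p n x" for n x
    unfolding S_def I_def using ba bb by (auto intro: cSUP_upper cINF_lower)
  have S_le: "S n \<le> a" if "\<And>x. p n x \<le> a" for n a
    unfolding S_def using that by (intro cSUP_least) auto
  have I_ge: "a \<le> I n" if "\<And>x. a \<le> p n x" for n a
    unfolding I_def using that by (intro cINF_greatest) auto
  \<comment> \<open>an average lies between the extremes of the averaged function\<close>
  have decS: "decseq S"
    by (rule decseq_SucI) (auto intro!: S_le transfer_normalized_le[OF g] leS simp: p_Suc)
  have incI: "incseq I"
    by (rule incseq_SucI) (auto intro!: I_ge transfer_normalized_ge[OF g] geI simp: p_Suc)
  have "- B \<le> S n" "I n \<le> B" for n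
    using leS[of n undefined] geI[of n undefined] pb[of n undefined] by linarith+
  then obtain Sl Il where Sl: "S \<longlonglongrightarrow> Sl" "\<And>n. Sl \<le> S n" and Il: "I \<longlonglongrightarrow> Il" "\<And>n. I n \<le> Il"
    using decseq_convergent[OF decS] incseq_convergent[OF incI] by metis
  have "Il \<le> Sl"
    using LIMSEQ_le[OF Il(1) Sl(1)] leS geI by (meson order_trans)
  moreover have "\<not> Il < Sl"
  proof
    assume "Il < Sl"
    define \<eta> where "\<eta> = (Sl - Il) / 3"
    have \<eta>: "0 < \<eta>" using \<open>Il < Sl\<close> by (simp add: \<eta>_def)
    obtain \<delta> where \<delta>: "0 < \<delta>" "\<And>n x y. dist x y < \<delta> \<Longrightarrow> p n y \<le> p n x + \<eta>"
      using equi[OF \<eta>] unfolding p_def by blast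
    obtain N where N: "\<And>x z. \<exists>y. (T ^^ N) y = z \<and> dist x y < \<delta>"
      using preimages_dense[OF \<delta>(1)] by blast
    obtain C where C: "\<And>x. \<bar>g x\<bar> \<le> C"
      using continuous_bounded[of g] g unfolding normalized_def by (metis real_norm_def)
    define \<theta> where "\<theta> = exp (- C) ^ N"
    have \<theta>: "0 < \<theta>" by (simp add: \<theta>_def)
    have step: "S (n + N) \<le> S n - \<theta> * (S n - (Il + 2 * \<eta>))" for n
    proof (rule S_le)
      fix z
      have "\<exists>x. p n x < I n + \<eta>"
        using cINF_less_iff[OF _ bb[of n], of "I n + \<eta>"] \<eta> by (auto simp: I_def)
      then obtain x where "p n x < I n + \<eta>" by blast
      moreover obtain y where y: "(T ^^ N) y = z" "dist x y < \<delta>" using N by blast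
      ultimately have py: "p n y \<le> Il + 2 * \<eta>" using \<delta>(2)[of x y n] Il(2)[of n] by linarith
      have "\<theta> * (S n - p n y) \<le> (transfer_operator T g ^^ N) (\<lambda>u. S n - p n u) ((T ^^ N) y)"
        unfolding \<theta>_def by (rule transfer_iter_ge_preimage)
          (use leS[of n] C in \<open>auto simp: abs_le_iff minus_le_iff\<close>)
      also have "(\<lambda>u. S n - p n u) = (\<lambda>u. 1 * S n + (- 1) * p n u)" by simp
      also have "(transfer_operator T g ^^ N) \<dots> ((T ^^ N) y) = S n - p (n + N) z"
      proof -
        have const: "(transfer_operator T g ^^ N) (\<lambda>_. a) = (\<lambda>_. a :: real)" for a
          by (induction N) (simp_all add: transfer_normalized_const[OF g])
        have "p (n + N) = (transfer_operator T g ^^ N) (p n)"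
          by (simp add: p_def funpow_add add.commute[of n])
        then show ?thesis unfolding transfer_iter_linear const y(1) by simp
      qed
      finally have "p (n + N) z \<le> S n - \<theta> * (S n - p n y)" by simp
      also have "\<dots> \<le> S n - \<theta> * (S n - (Il + 2 * \<eta>))"
        using \<theta> py by (intro diff_left_mono mult_left_mono) auto
      finally show "p (n + N) z \<le> S n - \<theta> * (S n - (Il + 2 * \<eta>))" .
    qed
    have "Sl \<le> Sl - \<theta> * (Sl - (Il + 2 * \<eta>))"
    proof (rule LIMSEQ_le)
      show "(\<lambda>n. S (n + N)) \<longlonglongrightarrow> Sl" by (rule LIMSEQ_ignore_initial_segment[OF Sl(1)])
      show "(\<lambda>n. S n - \<theta> * (S n - (Il + 2 * \<eta>))) \<longlonglongrightarrow> Sl - \<theta> * (Sl - (Il + 2 * \<eta>))"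
        by (intro tendsto_intros Sl(1))
    qed (use step in auto)
    then have "\<theta> * \<eta> \<le> 0" by (simp add: \<eta>_def field_simps)
    then show False using \<theta> \<eta> by (simp add: mult_le_0_iff)
  qed
  ultimately have eq: "Il = Sl" by simp
  have "uniform_limit UNIV p (\<lambda>_. Sl) sequentially"
  proof (rule uniform_limitI)
    fix e :: real assume e: "0 < e"
    have "\<forall>\<^sub>F n in sequentially. S n < Sl + e" "\<forall>\<^sub>F n in sequentially. Il - e < I n"
      using order_tendstoD(2)[OF Sl(1), of "Sl + e"] order_tendstoD(1)[OF Il(1), of "Il - e"] e by auto
    then show "\<forall>\<^sub>F n in sequentially. \<forall>x\<in>UNIV. dist (p n x) Sl < e"
    proof eventually_elim
      case (elim n)
      have "p n x < Sl + e" "Sl - e < p n x" for x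
        using elim leS[of n x] geI[of n x] eq by linarith+
      then show ?case by (auto simp: dist_real_def abs_less_iff algebra_simps)
    qed
  qed
  then show thesis using that by (simp add: p_def[abs_def])
qed

text \<open>The walk jumps from a point to one of its two preimages with the probabilities \<open>exp g\<close>.\<close>

lemma random_walk:
  assumes g: "normalized g"
  obtains p :: "nat \<Rightarrow> 'a pmf" where
    "\<And>n \<phi>. measure_pmf.expectation (p n) \<phi> = ((transfer_operator T g ^^ n) \<phi> x0 :: real)"
proof -
  define K where "K x = map_pmf (\<lambda>i. b i x) (bernoulli_pmf (exp (g (b True x))))" for x
  define p where "p n = ((\<lambda>q. bind_pmf q K) ^^ n) (return_pmf x0)" for n
  have fin: "finite (set_pmf (K x))" for x by (simp add: K_def)
  have finp: "finite (set_pmf (p n))" for n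
    by (induction n) (auto simp: p_def fin)
  have K: "measure_pmf.expectation (K x) \<phi> = transfer_operator T g \<phi> x" for x and \<phi> :: "'a \<Rightarrow> real"
  proof -
    have s: "exp (g (b False x)) + exp (g (b True x)) = 1"
      using g by (simp add: normalized_def UNIV_bool)
    then have "exp (g (b True x)) \<le> 1" using exp_gt_zero[of "g (b False x)"] by linarith
    moreover have "exp (g (b False x)) = 1 - exp (g (b True x))" using s by simp
    ultimately show ?thesis by (simp add: K_def transfer_real UNIV_bool)
  qed
  have "measure_pmf.expectation (p n) \<phi> = ((transfer_operator T g ^^ n) \<phi> x0 :: real)" for n \<phi>
  proof (induction n arbitrary: \<phi>)
    case (Suc n)
    have "measure_pmf.expectation (p (Suc n)) \<phi> = measure_pmf.expectation (bind_pmf (p n) K) \<phi>"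
      by (simp add: p_def)
    also have "\<dots> = (\<Sum>a\<in>set_pmf (p n). pmf (p n) a *\<^sub>R measure_pmf.expectation (K a) \<phi>)"
      by (rule pmf_expectation_bind) (auto simp: finp fin)
    also have "\<dots> = measure_pmf.expectation (p n) (transfer_operator T g \<phi>)"
      unfolding K by (subst integral_measure_pmf[OF finp]) (auto simp: mult.commute)
    also have "\<dots> = (transfer_operator T g ^^ Suc n) \<phi> x0"
      by (simp add: Suc funpow_Suc_right del: funpow.simps)
    finally show ?case .
  qed (simp add: p_def)
  then show thesis by (rule that)
qed

lemma measurable_continuous:
  fixes \<phi> :: "'a \<Rightarrow> 'b::{topological_space}"
  shows "continuous_on UNIV \<phi> \<Longrightarrow> sets m = sets borel \<Longrightarrow> \<phi> \<in> borel_measurable m"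
  using borel_measurable_continuous_onI measurable_cong_sets by blast

lemma integrable_continuous:
  fixes \<phi> :: "'a \<Rightarrow> real"
  assumes "continuous_on UNIV \<phi>" "finite_measure m" "sets m = sets borel"
  shows "integrable m \<phi>"
proof -
  interpret finite_measure m by fact
  obtain B where "\<And>x. norm (\<phi> x) \<le> B" using continuous_bounded[OF assms(1)] by blast
  then show ?thesis
    using measurable_continuous[OF assms(1,3)] by (intro integrable_const_bound[of _ B]) auto
qed

text \<open>The duality with continuous functions extends to Borel indicators: to open sets by dominated convergence, then to all
Borel sets by Dynkin's argument.\<close>

lemma conformal_indicator:
  fixes \<nu> :: "'a measure"
  assumes \<nu>: "finite_measure \<nu>" "sets \<nu> = sets borel" and g: "continuous_on UNIV g"
    and conf: "\<And>\<phi> :: 'a \<Rightarrow> real. continuous_on UNIV \<phi> \<Longrightarrow>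
      (\<integral>x. transfer_operator T g \<phi> x \<partial>\<nu>) = \<kappa> * (\<integral>x. \<phi> x \<partial>\<nu>)"
    and A: "A \<in> sets borel"
  shows "(\<integral>x. transfer_operator T g (indicator A) x \<partial>\<nu>) = \<kappa> * measure \<nu> A"
    and "integrable \<nu> (transfer_operator T g (indicator A :: 'a \<Rightarrow> real))"
proof -
  interpret finite_measure \<nu> by fact
  have sp: "space \<nu> = UNIV" using \<nu>(2) by (metis sets_eq_imp_space_eq space_borel)
  obtain C where C: "\<And>x. \<bar>g x\<bar> \<le> C"
    using continuous_bounded[OF g] by (metis real_norm_def)
  have bound: "norm (transfer_operator T g \<phi> x) \<le> 2 * exp C"
    if "\<And>y. 0 \<le> \<phi> y \<and> \<phi> y \<le> 1" for x and \<phi> :: "'a \<Rightarrow> real"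
  proof -
    have "norm (transfer_operator T g \<phi> x) \<le> (\<Sum>i\<in>(UNIV :: bool set). exp C * 1)"
      unfolding transfer_real
    proof (rule sum_norm_le)
      fix i
      have "norm (exp (g (b i x)) * \<phi> (b i x)) = exp (g (b i x)) * \<phi> (b i x)" using that by simp
      also have "\<dots> \<le> exp C * 1" using that C by (intro mult_mono) (auto simp: abs_le_iff)
      finally show "norm (exp (g (b i x)) * \<phi> (b i x)) \<le> exp C * 1" .
    qed
    then show ?thesis by simp
  qed
  have [measurable]: "b i \<in> measurable \<nu> borel" for i
    using branch_measurable measurable_cong_sets[OF \<nu>(2) refl] by blast
  have [measurable]: "g \<in> borel_measurable borel" by (rule borel_measurable_continuous_onI[OF g])
  have meas: "transfer_operator T g \<phi> \<in> borel_measurable \<nu>"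
    if [measurable]: "\<phi> \<in> borel_measurable borel" for \<phi> :: "'a \<Rightarrow> real"
    unfolding transfer_real by measurable
  define F where "F A x = transfer_operator T g (indicator A :: 'a \<Rightarrow> real) x" for A x
  have measF: "F A \<in> borel_measurable \<nu>" if "A \<in> sets borel" for A
    unfolding F_def using that by (intro meas) simp
  have boundF: "norm (F A x) \<le> 2 * exp C" for A x
    unfolding F_def by (rule bound) (simp add: indicator_def)
  have intF: "integrable \<nu> (F A)" if "A \<in> sets borel" for A
    using measF[OF that] boundF by (intro integrable_const_bound[of _ "2 * exp C"]) auto
  have limF: "(\<lambda>n. \<integral>x. transfer_operator T g (\<phi> n) x \<partial>\<nu>) \<longlonglongrightarrow> (\<integral>x. F A x \<partial>\<nu>)"
    if "\<And>n. \<phi> n \<in> borel_measurable borel" "\<And>n y. 0 \<le> \<phi> n y \<and> \<phi> n y \<le> 1"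
      "\<And>x. (\<lambda>n. \<phi> n x) \<longlonglongrightarrow> indicator A x" "A \<in> sets borel" for \<phi> :: "nat \<Rightarrow> 'a \<Rightarrow> real" and A
  proof (rule integral_dominated_convergence[where w = "\<lambda>_. 2 * exp C"])
    have "(\<lambda>n. transfer_operator T g (\<phi> n) x) \<longlonglongrightarrow> F A x" for x
      unfolding F_def transfer_real by (intro tendsto_sum tendsto_mult_left that)
    then show "AE x in \<nu>. (\<lambda>n. transfer_operator T g (\<phi> n) x) \<longlonglongrightarrow> F A x" by simp
  qed (use meas that measF bound in auto)
  have "sets (borel :: 'a measure) = sigma_sets UNIV {S. open S}" by (simp add: borel_def)
  then have A': "A \<in> sigma_sets UNIV {S. open S}" using A by simp
  have borel: "X \<in> sets borel" if "X \<in> sigma_sets UNIV {S. open S}" for X :: "'a set"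
    using that by (simp add: borel_def)
  have UNIV: "(\<integral>x. F UNIV x \<partial>\<nu>) = \<kappa> * measure \<nu> UNIV"
    using conf[of "\<lambda>_. 1"] sp by (simp add: F_def indicator_UNIV)
  have "(\<integral>x. F A x \<partial>\<nu>) = \<kappa> * measure \<nu> A"
  proof (rule sigma_sets_induct_disjoint[OF _ _ A'])
    show "Int_stable {S :: 'a set. open S}" by (auto simp: Int_stable_def)
    show "(\<integral>x. F {} x \<partial>\<nu>) = \<kappa> * measure \<nu> {}" by (simp add: F_def transfer_real)
  next
    fix U :: "'a set" assume "U \<in> {S. open S}"
    then have U: "open U" by simp
    show "(\<integral>x. F U x \<partial>\<nu>) = \<kappa> * measure \<nu> U"
    proof (cases "U = UNIV")
      case False
      define \<phi> where "\<phi> k x = min 1 (real k * infdist x (- U))" for k x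
      have c: "continuous_on UNIV (\<phi> k)" for k unfolding \<phi>_def by (intro continuous_intros)
      have b: "0 \<le> \<phi> k x \<and> \<phi> k x \<le> 1" for k x by (auto simp: \<phi>_def infdist_nonneg)
      have l: "(\<lambda>k. \<phi> k x) \<longlonglongrightarrow> indicator U x" for x
        unfolding \<phi>_def by (rule open_indicator_limit[OF U False])
      have 1: "(\<lambda>n. \<integral>x. transfer_operator T g (\<phi> n) x \<partial>\<nu>) \<longlonglongrightarrow> (\<integral>x. F U x \<partial>\<nu>)"
        using U by (intro limF b l) (auto intro: borel_measurable_continuous_onI c)
      have "(\<lambda>n. \<integral>x. \<phi> n x \<partial>\<nu>) \<longlonglongrightarrow> (\<integral>x. indicator U x \<partial>\<nu>)"
        by (rule integral_dominated_convergence[where w = "\<lambda>_. 1"])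
           (use b l U \<nu>(2) in \<open>auto intro: measurable_continuous[OF c] borel_measurable_indicator simp: abs_of_nonneg\<close>)
      then have "(\<lambda>n. \<kappa> * (\<integral>x. \<phi> n x \<partial>\<nu>)) \<longlonglongrightarrow> \<kappa> * measure \<nu> U"
        using U sp \<nu>(2) by (intro tendsto_mult_left) simp
      then show ?thesis using 1 conf[OF c] LIMSEQ_unique by simp
    qed (use UNIV in simp)
  next
    fix X :: "'a set" assume X: "X \<in> sigma_sets UNIV {S. open S}"
      and eq: "(\<integral>x. F X x \<partial>\<nu>) = \<kappa> * measure \<nu> X"
    have ind: "indicator (UNIV - X) y = (1 :: real) - indicator X y" for y
      by (simp add: indicator_def)
    have "F (UNIV - X) x = F UNIV x - F X x" for x
      unfolding F_def transfer_real ind by (simp add: right_diff_distrib sum_subtractf)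
    then have "(\<integral>x. F (UNIV - X) x \<partial>\<nu>) = (\<integral>x. F UNIV x \<partial>\<nu>) - (\<integral>x. F X x \<partial>\<nu>)"
      using intF borel[OF X] by simp
    also have "\<dots> = \<kappa> * (measure \<nu> UNIV - measure \<nu> X)"
      unfolding UNIV eq by (simp add: right_diff_distrib)
    also have "\<dots> = \<kappa> * measure \<nu> (UNIV - X)"
      using finite_measure_compl[of X] borel[OF X] \<nu>(2) sp by simp
    finally show "(\<integral>x. F (UNIV - X) x \<partial>\<nu>) = \<kappa> * measure \<nu> (UNIV - X)" .
  next
    fix X :: "nat \<Rightarrow> 'a set"
    assume disj: "disjoint_family X" and X: "range X \<subseteq> sigma_sets UNIV {S. open S}"
      and eq: "\<And>i. (\<integral>x. F (X i) x \<partial>\<nu>) = \<kappa> * measure \<nu> (X i)"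
    have Xb: "X i \<in> sets borel" for i using X borel by auto
    have part: "F (\<Union>i<n. X i) x = (\<Sum>i<n. F (X i) x)" for n x
    proof -
      have "indicator (\<Union>i<n. X i) y = (\<Sum>i<n. indicator (X i) y :: real)" for y
        by (rule indicator_UN_disjoint) (auto intro: disjoint_family_on_mono[OF _ disj])
      then show ?thesis
        unfolding F_def transfer_real sum_distrib_left by (simp only: sum_distrib_left sum.swap[of _ UNIV])
    qed
    have "(\<lambda>n. \<integral>x. transfer_operator T g (indicator (\<Union>i<n. X i)) x \<partial>\<nu>) \<longlonglongrightarrow> (\<integral>x. F (\<Union>i. X i) x \<partial>\<nu>)"
    proof (rule limF)
      show "(\<lambda>n. indicator (\<Union>i<n. X i) x :: real) \<longlonglongrightarrow> indicator (\<Union>i. X i) x" for x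
        by (rule LIMSEQ_indicator_UN)
      show "0 \<le> (indicator (\<Union>i<n. X i) y :: real) \<and> indicator (\<Union>i<n. X i) y \<le> (1 :: real)" for n y
        by (simp add: indicator_def)
    qed (use Xb in auto)
    then have "(\<lambda>n. \<integral>x. F (\<Union>i<n. X i) x \<partial>\<nu>) \<longlonglongrightarrow> (\<integral>x. F (\<Union>i. X i) x \<partial>\<nu>)"
      by (simp add: F_def)
    moreover have "(\<integral>x. F (\<Union>i<n. X i) x \<partial>\<nu>) = \<kappa> * (\<Sum>i<n. measure \<nu> (X i))" for n
      unfolding part using intF[OF Xb] eq by (simp add: sum_distrib_left)
    moreover have "(\<lambda>n. \<kappa> * (\<Sum>i<n. measure \<nu> (X i))) \<longlonglongrightarrow> \<kappa> * measure \<nu> (\<Union>i. X i)"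
      using finite_measure_UNION[OF _ disj] Xb \<nu>(2) by (intro tendsto_mult_left) (auto simp: sums_def)
    ultimately show "(\<integral>x. F (\<Union>i. X i) x \<partial>\<nu>) = \<kappa> * measure \<nu> (\<Union>i. X i)"
      using LIMSEQ_unique by simp
  qed simp
  then show "(\<integral>x. transfer_operator T g (indicator A) x \<partial>\<nu>) = \<kappa> * measure \<nu> A"
    and "integrable \<nu> (transfer_operator T g (indicator A :: 'a \<Rightarrow> real))"
    using intF[OF A] by (simp_all add: F_def[abs_def])
qed

end

locale cover_eigenfunction = cover_potential T b code s f w W
  for T :: "'a::metric_space \<Rightarrow> 'a" and b code s f w W +
  fixes \<kappa> :: real and h :: "'a \<Rightarrow> real"
  assumes kappa_pos: "0 < \<kappa>" and h_pos: "0 < h x" and h_regular: "log_regular 0 2 h"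
    and h_eigen: "L h = (\<lambda>x. \<kappa> * h x)"
begin

lemma h_bounds:
  obtains M where "0 < M" "\<And>x. h x \<le> M" "\<And>x. 1 / M \<le> h x"
proof -
  let ?c = "h undefined"
  define M where "M = max (exp (W 1) * ?c) (exp (W 1) / ?c)"
  have "0 < M" using h_pos[of undefined] by (auto simp: M_def max_def)
  moreover have "h x \<le> M" for x
    using log_regular_global(2)[OF h_regular, of x undefined] by (simp add: M_def)
  moreover have "1 / M \<le> h x" for x
  proof -
    have "?c / exp (W 1) \<le> h x"
      using log_regular_global(2)[OF h_regular, of undefined x] by (simp add: field_simps)
    moreover have "1 / M \<le> 1 / (exp (W 1) / ?c)"
      using h_pos[of undefined] by (intro divide_left_mono) (auto simp: M_def max_def)
    ultimately show ?thesis by simp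
  qed
  ultimately show thesis by (rule that)
qed

lemma h_continuous: "continuous_on UNIV h"
proof (rule continuous_onI)
  fix x :: 'a and e :: real assume e: "0 < e"
  obtain M where M: "0 < M" "\<And>x. h x \<le> M" by (rule h_bounds) blast
  obtain \<eta> where \<eta>: "0 < \<eta>" "\<And>a c. 0 \<le> a \<Longrightarrow> a \<le> M \<Longrightarrow> c \<le> exp \<eta> * a \<Longrightarrow> c \<le> a + e"
    using exp_slack[OF M(1) e] by blast
  obtain \<delta> where \<delta>: "0 < \<delta>" "\<And>d. 0 \<le> d \<Longrightarrow> d < \<delta> \<Longrightarrow> W d < \<eta>" using W_small[OF \<eta>(1)] by blast
  have "h u \<le> h v + e" if "dist u v < \<delta>" for u v
  proof (rule \<eta>(2))
    have "h u \<le> exp (W (dist u v)) * h v" by (rule log_regular_global(1)[OF h_regular])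
    also have "\<dots> \<le> exp \<eta> * h v"
      using \<delta>(2)[of "dist u v"] that h_pos[of v] by (intro mult_right_mono) auto
    finally show "h u \<le> exp \<eta> * h v" .
  qed (use M h_pos in \<open>auto intro: less_imp_le\<close>)
  then have "dist (h y) (h x) \<le> e" if "dist y x < \<delta>" for y
    using that by (force simp: dist_real_def dist_commute abs_le_iff algebra_simps)
  then show "\<exists>d>0. \<forall>y\<in>UNIV. dist y x < d \<longrightarrow> dist (h y) (h x) \<le> e" using \<delta>(1) by blast
qed

text \<open>The potential \<open>f\<close> up to a coboundary and a constant, chosen so that its transfer operator is \<open>L\<close> conjugated by \<open>h\<close> and
divided by \<open>\<kappa>\<close>.\<close>

definition G :: "'a \<Rightarrow> real" where
  "G y = f y + ln (h y) - ln (h (T y)) - ln \<kappa>"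

abbreviation P :: "('a \<Rightarrow> real) \<Rightarrow> 'a \<Rightarrow> real" where "P \<equiv> transfer_operator T G"

lemma exp_G: "exp (G (b i x)) = exp (f (b i x)) * h (b i x) / (\<kappa> * h x)"
  using h_pos kappa_pos by (simp add: G_def exp_diff exp_add)

lemma P_eq: "P \<phi> x = L (\<lambda>y. h y * \<phi> y) x / (\<kappa> * h x)"
  unfolding transfer_real exp_G by (simp add: sum_divide_distrib mult.assoc)

lemma P_iter: "(P ^^ n) \<phi> x = (L ^^ n) (\<lambda>y. h y * \<phi> y) x / (\<kappa> ^ n * h x)"
proof (induction n arbitrary: x)
  case 0
  then show ?case using h_pos[of x] by simp
next
  case (Suc n)
  have "(P ^^ Suc n) \<phi> x = L (\<lambda>y. h y * (P ^^ n) \<phi> y) x / (\<kappa> * h x)" by (simp add: P_eq)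
  also have "(\<lambda>y. h y * (P ^^ n) \<phi> y) = (\<lambda>y. (1 / \<kappa> ^ n) * (L ^^ n) (\<lambda>y. h y * \<phi> y) y)"
    using h_pos by (auto simp: Suc fun_eq_iff less_imp_neq[symmetric])
  also have "L \<dots> x = (1 / \<kappa> ^ n) * (L ^^ Suc n) (\<lambda>y. h y * \<phi> y) x"
    using transfer_iter_scale[of 1 f "1 / \<kappa> ^ n" "(L ^^ n) (\<lambda>y. h y * \<phi> y)"] by simp
  finally show ?case by simp
qed

lemma G_normalized: "normalized G"
proof -
  have "continuous_on UNIV (\<lambda>y. h (T y))"
    using continuous_on_compose[OF T_continuous continuous_on_subset[OF h_continuous]] by (simp add: comp_def)
  then have "continuous_on UNIV G"
    unfolding G_def using h_pos by (intro continuous_intros f_continuous h_continuous) (auto simp: less_imp_neq[symmetric])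
  moreover have "(\<Sum>i\<in>UNIV. exp (G (b i x))) = 1" for x
    using P_eq[of "\<lambda>_. 1" x] h_pos[of x] kappa_pos by (simp add: transfer_real[of G] h_eigen)
  ultimately show ?thesis by (simp add: normalized_def)
qed

text \<open>For \<open>\<phi> \<ge> 1\<close> the logarithm of \<open>\<phi>\<close> is uniformly continuous, so \<open>h \<phi>\<close> is log-regular up to an arbitrarily small slack, and so
are all \<open>L\<^sup>n (h \<phi>)\<close>. Dividing by \<open>h\<close> shows that the averages \<open>P\<^sup>n \<phi>\<close> are equicontinuous.\<close>

lemma averages_converge_positive:
  assumes \<phi>: "continuous_on UNIV \<phi>" and ge1: "\<And>x. 1 \<le> \<phi> x"
  obtains c where "uniform_limit UNIV (\<lambda>n. (P ^^ n) \<phi>) (\<lambda>_. c) sequentially"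
proof -
  obtain B where B: "0 < B" "\<And>x. \<bar>\<phi> x\<bar> \<le> B" using continuous_bounded[OF \<phi>] by (metis real_norm_def)
  have Pb: "1 \<le> (P ^^ n) \<phi> x \<and> (P ^^ n) \<phi> x \<le> B" for n x
  proof (induction n arbitrary: x)
    case 0
    show ?case using ge1 B by (auto simp: abs_le_iff)
  qed (auto intro!: transfer_normalized_ge transfer_normalized_le G_normalized)
  have "\<exists>\<delta>>0. \<forall>n x y. dist x y < \<delta> \<longrightarrow> (P ^^ n) \<phi> y \<le> (P ^^ n) \<phi> x + e" if e: "0 < e" for e
  proof -
    obtain \<eta> where \<eta>: "0 < \<eta>" "\<And>a c. 0 \<le> a \<Longrightarrow> a \<le> B \<Longrightarrow> c \<le> exp \<eta> * a \<Longrightarrow> c \<le> a + e"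
      using exp_slack[OF B(1) e] by blast
    have "continuous_on UNIV (\<lambda>x. ln (\<phi> x))"
      using ge1 by (intro continuous_intros \<phi>) (metis not_one_le_zero)
    then obtain \<delta>1 where \<delta>1: "0 < \<delta>1" "\<And>x y. dist x y < \<delta>1 \<Longrightarrow> dist (ln (\<phi> x)) (ln (\<phi> y)) < \<eta> / 2"
      using uniformly_continuous[of "\<lambda>x. ln (\<phi> x)" "\<eta> / 2"] \<eta>(1) by (metis half_gt_zero)
    obtain \<delta>2 where \<delta>2: "0 < \<delta>2" "\<And>d. 0 \<le> d \<Longrightarrow> d < \<delta>2 \<Longrightarrow> W d < \<eta> / 4"
      using W_small[of "\<eta> / 4"] \<eta>(1) by (metis divide_pos_pos zero_less_numeral)
    have "log_regular (\<eta> / 2) \<delta>1 (\<lambda>y. h y * \<phi> y)"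
    proof -
      have "h x * \<phi> x \<le> exp (\<eta> / 2 + W (dist x y)) * (h y * \<phi> y)" if d: "dist x y < \<delta>1" for x y
      proof -
        have "exp (ln (\<phi> x)) \<le> exp (\<eta> / 2 + ln (\<phi> y))"
          using \<delta>1(2)[OF d] by (simp add: dist_real_def abs_if split: if_splits)
        moreover have "0 < \<phi> x" "0 < \<phi> y" using ge1[of x] ge1[of y] by linarith+
        ultimately have "\<phi> x \<le> exp (\<eta> / 2) * \<phi> y" by (simp add: exp_add)
        then have "h x * \<phi> x \<le> (exp (W (dist x y)) * h y) * (exp (\<eta> / 2) * \<phi> y)"
          using h_pos \<open>0 < \<phi> x\<close> by (intro mult_mono log_regular_global(1)[OF h_regular]) (auto intro: less_imp_le)
        then show ?thesis by (simp add: exp_add ac_simps)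
      qed
      moreover have "0 \<le> h x * \<phi> x" for x
        using h_pos[of x] ge1[of x] by (intro mult_nonneg_nonneg) linarith+
      ultimately show ?thesis by (simp add: log_regular_def)
    qed
    then have reg: "log_regular (\<eta> / 2) \<delta>1 ((L ^^ n) (\<lambda>y. h y * \<phi> y))" for n
      by (rule log_regular_transfer_iter)
    have "(P ^^ n) \<phi> y \<le> (P ^^ n) \<phi> x + e" if d: "dist x y < min \<delta>1 \<delta>2" for n x y
    proof (rule \<eta>(2))
      let ?l = "(L ^^ n) (\<lambda>y. h y * \<phi> y)"
      have W: "W (dist x y) < \<eta> / 4" using \<delta>2(2)[of "dist x y"] d by simp
      have "?l y \<le> exp (\<eta> / 2 + W (dist x y)) * ?l x"
      proof -
        have "dist y x < \<delta>1" using d by (simp add: dist_commute)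
        then have "?l y \<le> exp (\<eta> / 2 + W (dist y x)) * ?l x"
          using reg[of n] unfolding log_regular_def by blast
        then show ?thesis by (simp only: dist_commute[of y x])
      qed
      moreover have "h x \<le> exp (W (dist x y)) * h y"
        by (rule log_regular_global(1)[OF h_regular])
      moreover have l0: "0 \<le> ?l x" using reg[of n] by (auto simp: log_regular_def)
      ultimately have "?l y * h x \<le> (exp (\<eta> / 2 + W (dist x y)) * ?l x) * (exp (W (dist x y)) * h y)"
        using h_pos[of x] by (intro mult_mono) auto
      also have "\<dots> = exp (\<eta> / 2 + 2 * W (dist x y)) * (?l x * h y)"
        by (simp add: exp_add exp_double power2_eq_square)
      also have "\<dots> \<le> exp \<eta> * (?l x * h y)"
        using W l0 h_pos[of y] by (intro mult_right_mono) auto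
      finally have "?l y / h y \<le> exp \<eta> * (?l x / h x)"
        using h_pos[of x] h_pos[of y] by (simp add: field_simps)
      then have "?l y / h y / \<kappa> ^ n \<le> exp \<eta> * (?l x / h x) / \<kappa> ^ n"
        using kappa_pos by (intro divide_right_mono) auto
      then show "(P ^^ n) \<phi> y \<le> exp \<eta> * (P ^^ n) \<phi> x"
        by (simp add: P_iter mult.commute)
      show "0 \<le> (P ^^ n) \<phi> x" "(P ^^ n) \<phi> x \<le> B" using Pb[of n x] by auto
    qed
    then show ?thesis using \<delta>1(1) \<delta>2(1) by (intro exI[of _ "min \<delta>1 \<delta>2"]) simp
  qed
  from equicontinuous_averages_converge[OF G_normalized B(2) this]
  show thesis using that by blast
qed

lemma averages_converge:
  assumes \<phi>: "continuous_on UNIV \<phi>"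
  obtains c where "uniform_limit UNIV (\<lambda>n. (P ^^ n) \<phi>) (\<lambda>_. c) sequentially"
proof -
  obtain B where B: "\<And>x. \<bar>\<phi> x\<bar> \<le> B" using continuous_bounded[OF \<phi>] by (metis real_norm_def)
  have "1 \<le> \<phi> x + (B + 1)" for x using B[of x] by linarith
  moreover have "continuous_on UNIV (\<lambda>x. \<phi> x + (B + 1))" by (intro continuous_intros \<phi>)
  ultimately obtain c where c: "uniform_limit UNIV (\<lambda>n. (P ^^ n) (\<lambda>x. \<phi> x + (B + 1))) (\<lambda>_. c) sequentially"
    using averages_converge_positive[of "\<lambda>x. \<phi> x + (B + 1)"] by blast
  have "(P ^^ n) (\<lambda>_. 1 :: real) = (\<lambda>_. 1)" for n
    by (induction n) (simp_all add: transfer_normalized_const[OF G_normalized])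
  then have "(P ^^ n) (\<lambda>x. \<phi> x + (B + 1)) = (\<lambda>x. (P ^^ n) \<phi> x + (B + 1))" for n
    using transfer_iter_linear[of n G 1 \<phi> "B + 1" "\<lambda>_. 1"] by simp
  then have "uniform_limit UNIV (\<lambda>n x. ((P ^^ n) \<phi> x + (B + 1)) - (B + 1)) (\<lambda>_. c - (B + 1)) sequentially"
    using c by (intro uniform_limit_intros) simp
  then show thesis using that by simp
qed

text \<open>The laws of the random walk have a weakly convergent subsequence. Since the averages converge to a constant, this limit
identifies the constant as an integral.\<close>

lemma ex_stationary_measure:
  obtains \<mu> where "prob_space \<mu>" "sets \<mu> = sets borel"
    "\<And>\<phi>. continuous_on UNIV \<phi> \<Longrightarrow> uniform_limit UNIV (\<lambda>n. (P ^^ n) \<phi>) (\<lambda>_. \<integral>x. \<phi> x \<partial>\<mu>) sequentially"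
proof -
  obtain p :: "nat \<Rightarrow> 'a pmf" where p: "\<And>n \<phi>. measure_pmf.expectation (p n) \<phi> = (P ^^ n) \<phi> undefined"
    by (rule random_walk[OF G_normalized]) blast
  obtain r \<mu> where r: "strict_mono (r :: nat \<Rightarrow> nat)" and \<mu>: "prob_space \<mu>" "sets \<mu> = sets borel"
    and lim: "\<And>\<phi> :: 'a \<Rightarrow> real. continuous_on UNIV \<phi> \<Longrightarrow>
      (\<lambda>n. measure_pmf.expectation (p (r n)) \<phi>) \<longlonglongrightarrow> (\<integral>x. \<phi> x \<partial>\<mu>)"
    using weakly_compact[of p] by blast
  have "uniform_limit UNIV (\<lambda>n. (P ^^ n) \<phi>) (\<lambda>_. \<integral>x. \<phi> x \<partial>\<mu>) sequentially"
    if \<phi>: "continuous_on UNIV \<phi>" for \<phi>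
  proof -
    obtain c where c: "uniform_limit UNIV (\<lambda>n. (P ^^ n) \<phi>) (\<lambda>_. c) sequentially"
      by (rule averages_converge[OF \<phi>])
    have "(\<lambda>n. (P ^^ n) \<phi> undefined) \<longlonglongrightarrow> c" by (rule tendsto_uniform_limitI[OF c]) simp
    then have "(\<lambda>n. (P ^^ r n) \<phi> undefined) \<longlonglongrightarrow> c"
      using LIMSEQ_subseq_LIMSEQ[OF _ r] by (simp add: comp_def)
    moreover have "(\<lambda>n. (P ^^ r n) \<phi> undefined) \<longlonglongrightarrow> (\<integral>x. \<phi> x \<partial>\<mu>)"
      using lim[OF \<phi>] by (simp add: p)
    ultimately have "c = (\<integral>x. \<phi> x \<partial>\<mu>)" using LIMSEQ_unique by blast
    then show ?thesis using c by simp
  qed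
  then show thesis using that \<mu> by blast
qed

end

section \<open>Eigenmeasure, spectrum and Gibbs property\<close>

lemma birkhoff_sum_Suc: "birkhoff_sum T f (Suc n) x = f x + birkhoff_sum T f n (T x)"
  unfolding birkhoff_sum_def sum.lessThan_Suc_shift by (simp add: funpow_swap1)

lemma bowen_ball_Suc: "bowen_ball T (Suc n) r x = {y. dist x y < r \<and> T y \<in> bowen_ball T n r (T x)}"
proof -
  have "(\<forall>j\<le>Suc n. Q j) \<longleftrightarrow> Q 0 \<and> (\<forall>j\<le>n. Q (Suc j))" for Q
    by (metis Suc_le_mono bot_nat_0.extremum not0_implies_Suc)
  then show ?thesis unfolding bowen_ball_def by (simp add: funpow_swap1)
qed

lemma stretch_le_cancel:
  assumes s: "0 < s" "0 \<le> e" and le: "stretch s d \<le> stretch s e"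
  shows "d \<le> e"
proof (rule ccontr)
  assume "\<not> d \<le> e"
  then have "e powr (s + 1) \<le> d powr (s + 1)" using s by (intro powr_mono2) auto
  then show False using le \<open>\<not> d \<le> e\<close> unfolding stretch_def by linarith
qed

lemma ex_stretch_inverse:
  assumes s: "0 < s" and D: "0 \<le> D"
  shows "\<exists>e\<ge>0. stretch s e = D"
proof -
  have "continuous_on {0..D} (stretch s)"
    unfolding stretch_def using s by (intro continuous_intros continuous_on_powr') auto
  moreover have "stretch s 0 \<le> D" "D \<le> stretch s D" using D le_stretch by (auto simp: stretch_def)
  ultimately have "\<exists>e. 0 \<le> e \<and> e \<le> D \<and> stretch s e = D" using D by (intro IVT')
  then show ?thesis by blast
qed

context double_cover
begin

lemma T_iter_continuous: "continuous_on UNIV (T ^^ n)"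
proof (induction n)
  case (Suc n)
  show ?case
    using continuous_on_compose[OF Suc continuous_on_subset[OF T_continuous]] by (simp add: comp_def)
qed (simp add: id_def)

lemma same_preimage:
  assumes "T y = T z" "dist y z < 1 / 3"
  shows "y = z"
proof (rule ccontr)
  assume "y \<noteq> z"
  then have ne: "code y \<noteq> code z"
  proof (rule contrapos_nn)
    assume "code y = code z"
    then have "b (code y) (T y) = b (code z) (T z)" using assms(1) by simp
    then show "y = z" by (simp only: branch_code)
  qed
  have "dist (b (code y) (T y)) (b (code z) (T z)) < 1 / 3"
    using assms(2) by (simp only: branch_code)
  then have "dist (b False (T y)) (b True (T y)) < 1 / 3"
    unfolding assms(1)[symmetric]
    using ne by (cases "code y"; cases "code z") (auto simp: dist_commute)
  then show False using branches_apart[of "T y"] by linarith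
qed

text \<open>The partner of \<open>x\<close> in the fibre over \<open>z\<close> is near \<open>x\<close>; the other point of that fibre is at distance at
least 1/3 from this partner.\<close>

lemma local_inverse:
  assumes "dist (T x) z < 1 / 6"
  obtains i where "stretch s (dist x (b i z)) \<le> dist (T x) z"
    "\<And>j. dist x (b j z) < 1 / 6 \<Longrightarrow> j = i"
proof -
  obtain j where j: "\<And>i. stretch s (dist (b i (T x)) (b (i \<noteq> j) z)) \<le> dist (T x) z"
    using pairing by blast
  define i where "i = (code x \<noteq> j)"
  have 1: "stretch s (dist x (b i z)) \<le> dist (T x) z"
    using j[of "code x"] by (simp add: i_def)
  then have "dist x (b i z) < 1 / 6" using assms stretch_dist[of x "b i z"] by linarith
  then have "k = i" if "dist x (b k z) < 1 / 6" for k
    using same_preimage[of "b k z" "b i z"] dist_triangle3[of "b k z" "b i z" x] that by simp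
  then show thesis using 1 that by blast
qed

lemma bowen_ball_borel: "bowen_ball T n r x \<in> sets borel"
proof -
  have "open {y. dist ((T ^^ j) x) ((T ^^ j) y) < r}" for j
    by (intro open_Collect_less continuous_intros T_iter_continuous)
  then have "open (\<Inter>j\<in>{..n}. {y. dist ((T ^^ j) x) ((T ^^ j) y) < r})" by (intro open_INT) auto
  moreover have "(\<Inter>j\<in>{..n}. {y. dist ((T ^^ j) x) ((T ^^ j) y) < r}) = bowen_ball T n r x"
    by (auto simp: bowen_ball_def)
  ultimately show ?thesis by simp
qed

end

text \<open>The measure \<open>\<mu>\<close> represents the limits of the averages. It turns out to be the equilibrium state.\<close>

locale cover_equilibrium = cover_eigenfunction T b code s f w W \<kappa> h
  for T :: "'a::metric_space \<Rightarrow> 'a" and b code s f w W \<kappa> h +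
  fixes \<mu> :: "'a measure"
  assumes mu_prob: "prob_space \<mu>" and mu_sets [measurable_cong, simp]: "sets \<mu> = sets borel"
    and averages_limit: "continuous_on UNIV \<phi> \<Longrightarrow>
      uniform_limit UNIV (\<lambda>n. (P ^^ n) \<phi>) (\<lambda>_. \<integral>x. \<phi> x \<partial>\<mu>) sequentially"
begin

sublocale mu: prob_space \<mu> by (rule mu_prob)

lemma space_mu [simp]: "space \<mu> = UNIV"
  using mu_sets by (metis sets_eq_imp_space_eq space_borel)

lemma averages_tendsto: "continuous_on UNIV \<phi> \<Longrightarrow> (\<lambda>n. (P ^^ n) \<phi> x) \<longlonglongrightarrow> (\<integral>x. \<phi> x \<partial>\<mu>)"
  by (rule tendsto_uniform_limitI[OF averages_limit]) simp_all

lemma P_continuous: "continuous_on UNIV \<phi> \<Longrightarrow> continuous_on UNIV (P \<phi>)"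
  using G_normalized by (intro transfer_continuous) (auto simp: normalized_def)

lemma mu_P_invariant:
  assumes "continuous_on UNIV \<phi>"
  shows "(\<integral>x. P \<phi> x \<partial>\<mu>) = (\<integral>x. \<phi> x \<partial>\<mu>)"
proof (rule LIMSEQ_unique)
  show "(\<lambda>n. (P ^^ n) (P \<phi>) undefined) \<longlonglongrightarrow> (\<integral>x. P \<phi> x \<partial>\<mu>)"
    by (intro averages_tendsto P_continuous assms)
  show "(\<lambda>n. (P ^^ n) (P \<phi>) undefined) \<longlonglongrightarrow> (\<integral>x. \<phi> x \<partial>\<mu>)"
    using LIMSEQ_Suc[OF averages_tendsto[OF assms]] by (simp add: funpow_Suc_right del: funpow.simps)
qed

lemma T_measurable: "T \<in> measurable \<mu> \<mu>" "T \<in> borel_measurable borel"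
proof -
  show "T \<in> borel_measurable borel" by (rule borel_measurable_continuous_onI[OF T_continuous])
  then show "T \<in> measurable \<mu> \<mu>" using measurable_cong_sets[OF mu_sets mu_sets] by blast
qed

lemma mu_invariant: "\<mu> \<in> invariant_measures T"
proof -
  have "distr \<mu> \<mu> T = \<mu>"
  proof (rule finite_measure_eqI_continuous)
    show "finite_measure (distr \<mu> \<mu> T)" by (rule mu.finite_measure_distr[OF T_measurable(1)])
    fix \<phi> :: "'a \<Rightarrow> real" assume \<phi>: "continuous_on UNIV \<phi>"
    have c: "continuous_on UNIV (\<lambda>x. \<phi> (T x))"
      using continuous_on_compose[OF T_continuous continuous_on_subset[OF \<phi>]] by (simp add: comp_def)
    have "(\<integral>x. \<phi> x \<partial>distr \<mu> \<mu> T) = (\<integral>x. \<phi> (T x) \<partial>\<mu>)"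
      by (rule integral_distr[OF T_measurable(1) measurable_continuous[OF \<phi> mu_sets]])
    also have "\<dots> = (\<integral>x. P (\<lambda>x. \<phi> (T x)) x \<partial>\<mu>)" using mu_P_invariant[OF c] by simp
    also have "\<dots> = (\<integral>x. \<phi> x \<partial>\<mu>)" by (simp add: transfer_normalized_compose[OF G_normalized])
    finally show "(\<integral>x. \<phi> x \<partial>distr \<mu> \<mu> T) = (\<integral>x. \<phi> x \<partial>\<mu>)" .
  qed (simp_all add: mu.finite_measure_axioms)
  then show ?thesis using mu_prob T_measurable by (simp add: invariant_measures_def)
qed

text \<open>Normalization of the eigenfunction: with the factor \<open>\<integral> 1/h d\<mu>\<close>, the measure \<open>\<nu> = \<mu>/h\<close> has mass 1, and \<open>\<mu>\<close> is the
measure with density \<open>normalized_h\<close> with respect to \<open>\<nu>\<close>.\<close>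

definition inverse_h_mean :: real where "inverse_h_mean = (\<integral>x. 1 / h x \<partial>\<mu>)"

definition normalized_h :: "'a \<Rightarrow> real" where "normalized_h x = inverse_h_mean * h x"

definition \<nu> :: "'a measure" where "\<nu> = density \<mu> (\<lambda>x. ennreal (1 / normalized_h x))"

lemma inverse_h_continuous: "continuous_on UNIV (\<lambda>x. 1 / h x)"
  using h_pos by (intro continuous_intros h_continuous) (auto simp: less_imp_neq[symmetric])

lemma inverse_h_mean_pos: "0 < inverse_h_mean"
proof -
  obtain M where M: "0 < M" "\<And>x. h x \<le> M" by (rule h_bounds) blast
  have "(\<integral>x. 1 / M \<partial>\<mu>) \<le> inverse_h_mean"
    unfolding inverse_h_mean_def
  proof (rule integral_mono)
    show "integrable \<mu> (\<lambda>x. 1 / h x)"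
      by (rule integrable_continuous[OF inverse_h_continuous mu.finite_measure_axioms mu_sets])
    show "1 / M \<le> 1 / h x" for x
      using M h_pos[of x] by (simp add: field_simps)
  qed simp
  then have "1 / M \<le> inverse_h_mean" using mu.prob_space by simp
  moreover have "0 < 1 / M" using M(1) by simp
  ultimately show ?thesis by linarith
qed

lemma normalized_h_pos: "0 < normalized_h x"
  using inverse_h_mean_pos h_pos by (simp add: normalized_h_def)

lemma normalized_h_continuous: "continuous_on UNIV normalized_h"
  unfolding normalized_h_def[abs_def] by (intro continuous_intros h_continuous)

lemma normalized_h_measurable [measurable]: "normalized_h \<in> borel_measurable borel"
  by (rule borel_measurable_continuous_onI[OF normalized_h_continuous])

lemma normalized_h_bounds:
  obtains M where "0 < M" "\<And>x. normalized_h x \<le> M" "\<And>x. 1 / M \<le> normalized_h x"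
proof -
  obtain M where M: "0 < M" "\<And>x. h x \<le> M" "\<And>x. 1 / M \<le> h x" by (rule h_bounds) blast
  define K where "K = max (inverse_h_mean * M) (M / inverse_h_mean)"
  have K: "0 < K" using M(1) inverse_h_mean_pos by (simp add: K_def max_def)
  have "normalized_h x \<le> K" for x
    using mult_left_mono[OF M(2)[of x], of inverse_h_mean] inverse_h_mean_pos unfolding normalized_h_def K_def
    by (simp add: le_max_iff_disj)
  moreover have "1 / K \<le> normalized_h x" for x
  proof -
    have "1 / K \<le> 1 / (M / inverse_h_mean)" using M(1) inverse_h_mean_pos by (intro divide_left_mono) (auto simp: K_def max_def)
    also have "\<dots> = inverse_h_mean * (1 / M)" by simp
    also have "\<dots> \<le> normalized_h x" unfolding normalized_h_def using M(3) inverse_h_mean_pos by (intro mult_left_mono) auto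
    finally show ?thesis .
  qed
  ultimately show thesis using that K by blast
qed

lemma nu_sets [measurable_cong, simp]: "sets \<nu> = sets borel" and space_nu [simp]: "space \<nu> = UNIV"
  by (simp_all add: \<nu>_def)

lemma integral_nu:
  assumes "\<phi> \<in> borel_measurable borel"
  shows "(\<integral>x. \<phi> x \<partial>\<nu>) = (\<integral>x. \<phi> x / normalized_h x \<partial>\<mu>)"
  unfolding \<nu>_def using assms normalized_h_pos
  by (subst integral_density) (auto simp: less_imp_le)

lemma nu_prob: "prob_space \<nu>"
proof
  have int: "integrable \<mu> (\<lambda>x. 1 / normalized_h x)"
    using normalized_h_pos by (intro integrable_continuous continuous_intros normalized_h_continuous mu.finite_measure_axioms mu_sets)
      (auto simp: less_imp_neq[symmetric])
  have "emeasure \<nu> (space \<nu>) = (\<integral>\<^sup>+x. ennreal (1 / normalized_h x) \<partial>\<mu>)"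
    by (simp add: \<nu>_def emeasure_density)
  also have "\<dots> = ennreal (\<integral>x. 1 / normalized_h x \<partial>\<mu>)"
    using normalized_h_pos by (intro nn_integral_eq_integral int) (auto simp: less_imp_le)
  also have "(\<integral>x. 1 / normalized_h x \<partial>\<mu>) = (\<integral>x. (1 / inverse_h_mean) * (1 / h x) \<partial>\<mu>)" by (simp add: normalized_h_def)
  also have "\<dots> = (1 / inverse_h_mean) * inverse_h_mean"
    unfolding inverse_h_mean_def by (rule integral_mult_right_zero)
  finally show "emeasure \<nu> (space \<nu>) = 1" using inverse_h_mean_pos by simp
qed

sublocale nu: prob_space \<nu> by (rule nu_prob)

lemma mu_eq_density: "\<mu> = density \<nu> (\<lambda>x. ennreal (normalized_h x))"
proof -
  have "density \<nu> (\<lambda>x. ennreal (normalized_h x)) = density \<mu> (\<lambda>x. ennreal (1 / normalized_h x) * ennreal (normalized_h x))"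
    unfolding \<nu>_def by (rule density_density_eq) measurable
  also have "\<dots> = density \<mu> (\<lambda>_. 1)"
  proof (rule density_cong)
    have "ennreal (1 / normalized_h x) * ennreal (normalized_h x) = 1" for x
      using normalized_h_pos[of x] by (simp add: ennreal_mult'[symmetric] less_imp_le)
    then show "AE x in \<mu>. ennreal (1 / normalized_h x) * ennreal (normalized_h x) = 1" by simp
  qed measurable
  finally show ?thesis by (simp add: density_1)
qed

lemma integral_normalized_h: "(\<integral>x. normalized_h x \<partial>\<nu>) = 1"
  using normalized_h_pos mu.prob_space by (simp add: integral_nu less_imp_neq[symmetric])

text \<open>Conjugation by \<open>h\<close> turns the invariance \<open>\<integral> P \<phi> d\<mu> = \<integral> \<phi> d\<mu>\<close> into the eigenvalue equation for \<open>\<nu>\<close>.\<close>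

lemma nu_conformal:
  assumes \<phi>: "continuous_on UNIV \<phi>"
  shows "(\<integral>x. L \<phi> x \<partial>\<nu>) = \<kappa> * (\<integral>x. \<phi> x \<partial>\<nu>)"
proof -
  have c: "continuous_on UNIV (\<lambda>x. \<phi> x / h x)"
    using continuous_on_mult[OF \<phi> inverse_h_continuous] by simp
  have hne: "h x \<noteq> 0" for x using h_pos[of x] by simp
  have "(\<integral>x. L \<phi> x \<partial>\<nu>) = (\<integral>x. L \<phi> x / normalized_h x \<partial>\<mu>)"
    by (intro integral_nu borel_measurable_continuous_onI transfer_continuous f_continuous \<phi>)
  also have "\<dots> = (\<integral>x. (\<kappa> / inverse_h_mean) * P (\<lambda>x. \<phi> x / h x) x \<partial>\<mu>)"
    using hne kappa_pos by (simp add: P_eq normalized_h_def field_simps)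
  also have "\<dots> = (\<kappa> / inverse_h_mean) * (\<integral>x. \<phi> x / h x \<partial>\<mu>)"
    by (simp only: integral_mult_right_zero mu_P_invariant[OF c])
  also have "\<dots> = \<kappa> * (\<integral>x. (1 / inverse_h_mean) * (\<phi> x / h x) \<partial>\<mu>)"
    by (simp only: integral_mult_right_zero) simp
  also have "\<dots> = \<kappa> * (\<integral>x. \<phi> x \<partial>\<nu>)"
    using borel_measurable_continuous_onI[OF \<phi>] by (simp add: integral_nu normalized_h_def mult.commute)
  finally show ?thesis .
qed

lemma nu_dual: "is_dual_transfer T f \<nu> (scale_measure (ennreal \<kappa>) \<nu>)"
proof -
  have eq: "scale_measure (ennreal \<kappa>) \<nu> = density \<nu> (\<lambda>_. ennreal \<kappa>)"
    by (rule measure_eqI) (auto simp: emeasure_density nn_integral_cmult_indicator)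
  have "finite_measure (scale_measure (ennreal \<kappa>) \<nu>)"
    by (rule finite_measureI) (simp add: space_scale_measure ennreal_mult_eq_top_iff nu.emeasure_finite)
  moreover have "(\<integral>x. \<phi> x \<partial>scale_measure (ennreal \<kappa>) \<nu>) = (\<integral>x. L \<phi> x \<partial>\<nu>)"
    if \<phi>: "continuous_on UNIV \<phi>" for \<phi> :: "'a \<Rightarrow> real"
    unfolding eq nu_conformal[OF \<phi>] using borel_measurable_continuous_onI[OF \<phi>] kappa_pos
    by (subst integral_density) auto
  ultimately show ?thesis
    by (simp add: is_dual_transfer_def nu.finite_measure_axioms)
qed

lemma L_iter_P: "(L ^^ n) \<phi> x / \<kappa> ^ n = h x * (P ^^ n) (\<lambda>x. \<phi> x / h x) x"
proof -
  have "(\<lambda>y. h y * (\<phi> y / h y)) = \<phi>" using h_pos by (auto simp: less_imp_neq[symmetric])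
  then show ?thesis using h_pos[of x] kappa_pos by (simp add: P_iter)
qed

lemma L_iter_converges:
  assumes \<phi>: "continuous_on UNIV \<phi>"
  shows "uniform_limit UNIV (\<lambda>n x. (L ^^ n) \<phi> x / \<kappa> ^ n) (\<lambda>x. normalized_h x * (\<integral>y. \<phi> y \<partial>\<nu>)) sequentially"
proof (rule uniform_limitI)
  fix e :: real assume e: "0 < e"
  obtain M where M: "0 < M" "\<And>x. h x \<le> M" by (rule h_bounds) blast
  have c: "continuous_on UNIV (\<lambda>x. \<phi> x / h x)"
    using continuous_on_mult[OF \<phi> inverse_h_continuous] by simp
  have "inverse_h_mean * (\<integral>y. \<phi> y \<partial>\<nu>) = (\<integral>x. inverse_h_mean * (\<phi> x / normalized_h x) \<partial>\<mu>)"
    unfolding integral_nu[OF borel_measurable_continuous_onI[OF \<phi>]] by (rule integral_mult_right_zero[symmetric])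
  also have "\<dots> = (\<integral>x. \<phi> x / h x \<partial>\<mu>)" using inverse_h_mean_pos by (simp add: normalized_h_def)
  finally have lim: "normalized_h x * (\<integral>y. \<phi> y \<partial>\<nu>) = h x * (\<integral>x. \<phi> x / h x \<partial>\<mu>)" for x
    by (simp add: normalized_h_def mult.commute mult.left_commute)
  have "\<forall>\<^sub>F n in sequentially. \<forall>x\<in>UNIV. dist ((P ^^ n) (\<lambda>x. \<phi> x / h x) x) (\<integral>x. \<phi> x / h x \<partial>\<mu>) < e / M"
    using uniform_limitD[OF averages_limit[OF c], of "e / M"] e M(1) by simp
  then show "\<forall>\<^sub>F n in sequentially. \<forall>x\<in>UNIV. dist ((L ^^ n) \<phi> x / \<kappa> ^ n) (normalized_h x * (\<integral>y. \<phi> y \<partial>\<nu>)) < e"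
  proof eventually_elim
    case (elim n)
    have "dist ((L ^^ n) \<phi> x / \<kappa> ^ n) (normalized_h x * (\<integral>y. \<phi> y \<partial>\<nu>)) < e" for x
    proof -
      let ?d = "dist ((P ^^ n) (\<lambda>x. \<phi> x / h x) x) (\<integral>x. \<phi> x / h x \<partial>\<mu>)"
      have "dist ((L ^^ n) \<phi> x / \<kappa> ^ n) (normalized_h x * (\<integral>y. \<phi> y \<partial>\<nu>)) = h x * ?d"
        unfolding lim L_iter_P using h_pos[of x]
        by (simp add: dist_real_def right_diff_distrib[symmetric] abs_mult)
      also have "\<dots> \<le> M * ?d" using M(2) by (intro mult_right_mono) auto
      also have "\<dots> < e" using elim M(1) by (simp add: field_simps)
      finally show ?thesis .
    qed
    then show ?case by simp
  qed
qed

abbreviation Lc :: "('a \<Rightarrow> complex) \<Rightarrow> 'a \<Rightarrow> complex" where "Lc \<equiv> transfer_operator T f"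

lemma Lc_Re: "Re (Lc \<phi> x) = L (\<lambda>y. Re (\<phi> y)) x" and Lc_Im: "Im (Lc \<phi> x) = L (\<lambda>y. Im (\<phi> y)) x"
  by (simp_all add: transfer_eq)

lemma Lc_iter_Re: "Re ((Lc ^^ n) \<phi> x) = (L ^^ n) (\<lambda>y. Re (\<phi> y)) x"
  and Lc_iter_Im: "Im ((Lc ^^ n) \<phi> x) = (L ^^ n) (\<lambda>y. Im (\<phi> y)) x"
  by (induction n arbitrary: x) (simp_all add: Lc_Re Lc_Im)

lemma Lc_iter_converges:
  assumes \<phi>: "continuous_on UNIV \<phi>"
  obtains c where "\<And>x. (\<lambda>n. (Lc ^^ n) \<phi> x / complex_of_real \<kappa> ^ n) \<longlonglongrightarrow> c * complex_of_real (normalized_h x)"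
proof
  define c where "c = Complex (\<integral>y. Re (\<phi> y) \<partial>\<nu>) (\<integral>y. Im (\<phi> y) \<partial>\<nu>)"
  fix x
  have "(\<lambda>n. (L ^^ n) (\<lambda>y. Re (\<phi> y)) x / \<kappa> ^ n) \<longlonglongrightarrow> normalized_h x * (\<integral>y. Re (\<phi> y) \<partial>\<nu>)"
    by (rule tendsto_uniform_limitI[OF L_iter_converges]) (auto intro: continuous_intros \<phi>)
  moreover have "(\<lambda>n. (L ^^ n) (\<lambda>y. Im (\<phi> y)) x / \<kappa> ^ n) \<longlonglongrightarrow> normalized_h x * (\<integral>y. Im (\<phi> y) \<partial>\<nu>)"
    by (rule tendsto_uniform_limitI[OF L_iter_converges]) (auto intro: continuous_intros \<phi>)
  ultimately show "(\<lambda>n. (Lc ^^ n) \<phi> x / complex_of_real \<kappa> ^ n) \<longlonglongrightarrow> c * complex_of_real (normalized_h x)"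
    unfolding tendsto_complex_iff of_real_power[symmetric] Re_divide_of_real Im_divide_of_real Lc_iter_Re Lc_iter_Im
    by (simp add: c_def mult.commute)
qed

text \<open>For an eigenfunction \<open>\<phi>\<close> the convergence of \<open>\<kappa>\<^bsup>-n\<^esup> L\<^sup>n \<phi>\<close> forces \<open>(c/\<kappa>)\<^sup>n\<close> to converge; on or outside the unit circle the
only such number is 1.\<close>

lemma no_other_peripheral_eigenvalue:
  assumes c: "c \<noteq> complex_of_real \<kappa>" "\<kappa> \<le> cmod c"
  shows "\<not> eigenvalue_on (continuous_functions :: ('a \<Rightarrow> complex) set) Lc c"
proof
  assume "eigenvalue_on (continuous_functions :: ('a \<Rightarrow> complex) set) Lc c"
  then obtain \<phi> where \<phi>: "continuous_on UNIV \<phi>" "\<phi> \<noteq> (\<lambda>_. 0)" "Lc \<phi> = (\<lambda>x. c * \<phi> x)"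
    by (auto simp: eigenvalue_on_def continuous_functions_def)
  have scale: "Lc (\<lambda>x. a * \<psi> x) = (\<lambda>x. a * Lc \<psi> x)" for a \<psi>
    by (rule ext) (simp add: transfer_eq sum_distrib_left)
  have iter: "(Lc ^^ n) \<phi> = (\<lambda>x. c ^ n * \<phi> x)" for n
    by (induction n) (simp_all add: scale \<phi>(3) mult.assoc mult.left_commute)
  obtain x where x: "\<phi> x \<noteq> 0" using \<phi>(2) by blast
  define z where "z = c / complex_of_real \<kappa>"
  obtain l where "(\<lambda>n. (Lc ^^ n) \<phi> x / complex_of_real \<kappa> ^ n) \<longlonglongrightarrow> l"
    using Lc_iter_converges[OF \<phi>(1)] by metis
  then have "(\<lambda>n. z ^ n * \<phi> x / \<phi> x) \<longlonglongrightarrow> l / \<phi> x"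
    using x by (intro tendsto_divide tendsto_const) (simp_all add: iter z_def power_divide)
  then have lim: "(\<lambda>n. z ^ n) \<longlonglongrightarrow> l / \<phi> x" using x by simp
  have "1 \<le> cmod z" using c(2) kappa_pos by (simp add: z_def norm_divide)
  then have "1 \<le> cmod (z ^ n)" for n by (simp add: norm_power)
  then have "1 \<le> cmod (l / \<phi> x)"
    using LIMSEQ_le_const[OF tendsto_norm[OF lim]] by blast
  then have ne: "l / \<phi> x \<noteq> 0" by force
  have "(\<lambda>n. z * z ^ n) \<longlonglongrightarrow> l / \<phi> x" using LIMSEQ_Suc[OF lim] by simp
  then have "z * (l / \<phi> x) = l / \<phi> x" using LIMSEQ_unique tendsto_mult_left[OF lim] by blast
  then have "z = 1" using ne by simp
  then show False using c(1) kappa_pos by (simp add: z_def)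
qed

text \<open>By induction along the generalized eigenspace, \<open>(L - \<kappa>) \<psi>\<close> is a multiple \<open>a h\<close>. Then \<open>\<kappa>\<^bsup>-n\<^esup> L\<^sup>n \<psi>\<close> contains the term
\<open>n a h / \<kappa>\<close> and converges only if \<open>a = 0\<close>; in that case \<open>\<psi>\<close> is its own limit, a multiple of \<open>h\<close>.\<close>

lemma kappa_simple:
  "simple_eigenvalue_on (continuous_functions :: ('a \<Rightarrow> complex) set) Lc (complex_of_real \<kappa>)"
proof -
  let ?k = "complex_of_real \<kappa>" and ?h = "\<lambda>x. complex_of_real (normalized_h x)"
  let ?D = "\<lambda>\<theta> x. Lc \<theta> x - ?k * \<theta> x"
  have k0: "?k \<noteq> 0" using kappa_pos by simp
  have hc: "continuous_on UNIV ?h" by (intro continuous_intros normalized_h_continuous)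
  have h0: "?h x \<noteq> 0" for x using normalized_h_pos[of x] by simp
  have lin: "Lc (\<lambda>x. a * \<psi> x + d * \<theta> x) = (\<lambda>x. a * Lc \<psi> x + d * Lc \<theta> x)" for a d \<psi> \<theta>
    by (rule ext) (simp add: transfer_eq sum_distrib_left sum.distrib algebra_simps)
  have eig: "Lc ?h = (\<lambda>x. ?k * ?h x)"
  proof
    fix x
    have "L normalized_h x = \<kappa> * normalized_h x"
      using transfer_iter_scale[of 1 f inverse_h_mean h] by (simp add: normalized_h_def[abs_def] h_eigen)
    then show "Lc ?h x = ?k * ?h x"
      by (simp add: complex_eq_iff Lc_Re Lc_Im transfer_real)
  qed
  have gen: "\<exists>a. \<psi> = (\<lambda>x. a * ?h x)"
    if "continuous_on UNIV \<psi>" "(?D ^^ k) \<psi> = (\<lambda>_. 0)" for k \<psi>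
    using that
  proof (induction k arbitrary: \<psi>)
    case 0
    then show ?case by (intro exI[of _ 0]) (simp add: id_def)
  next
    case (Suc k)
    have "continuous_on UNIV (?D \<psi>)"
      by (intro continuous_intros transfer_continuous f_continuous Suc.prems(1))
    moreover have "(?D ^^ k) (?D \<psi>) = (\<lambda>_. 0)"
      using Suc.prems(2) by (simp add: funpow_Suc_right del: funpow.simps)
    ultimately obtain a where "?D \<psi> = (\<lambda>x. a * ?h x)" using Suc.IH by blast
    then have L\<psi>: "Lc \<psi> = (\<lambda>x. ?k * \<psi> x + a * ?h x)" by (simp add: fun_eq_iff algebra_simps)
    have iter: "(Lc ^^ n) \<psi> = (\<lambda>x. ?k ^ n * \<psi> x + (of_nat n * ?k ^ n * (a / ?k)) * ?h x)" for n
    proof (induction n)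
      case (Suc n)
      have "(Lc ^^ Suc n) \<psi> = Lc (\<lambda>x. ?k ^ n * \<psi> x + (of_nat n * ?k ^ n * (a / ?k)) * ?h x)"
        by (simp only: funpow.simps comp_apply Suc)
      also have "\<dots> = (\<lambda>x. ?k ^ n * Lc \<psi> x + (of_nat n * ?k ^ n * (a / ?k)) * Lc ?h x)"
        by (rule lin)
      also have "\<dots> = (\<lambda>x. ?k ^ Suc n * \<psi> x + (of_nat (Suc n) * ?k ^ Suc n * (a / ?k)) * ?h x)"
        using k0 by (simp add: L\<psi> eig fun_eq_iff field_simps)
      finally show ?case .
    qed simp
    have eq: "(Lc ^^ n) \<psi> x / ?k ^ n = \<psi> x + of_nat n * ((a / ?k) * ?h x)" for n x
      using k0 by (simp add: iter field_simps)
    obtain c where c: "\<And>x. (\<lambda>n. (Lc ^^ n) \<psi> x / ?k ^ n) \<longlonglongrightarrow> c * ?h x"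
      using Lc_iter_converges[OF Suc.prems(1)] by blast
    define d where "d = (a / ?k) * ?h undefined"
    have lim: "(\<lambda>n. \<psi> undefined + of_nat n * d) \<longlonglongrightarrow> c * ?h undefined"
      using c[of undefined] by (simp add: eq d_def)
    have "(\<lambda>n. (\<psi> undefined + of_nat (Suc n) * d) - (\<psi> undefined + of_nat n * d)) \<longlonglongrightarrow> c * ?h undefined - c * ?h undefined"
      by (intro tendsto_diff LIMSEQ_Suc[OF lim] lim)
    then have "d = 0" by (simp add: algebra_simps LIMSEQ_const_iff)
    then have "a = 0" using h0 k0 by (simp add: d_def)
    then have "(\<lambda>n. \<psi> x) \<longlonglongrightarrow> c * ?h x" for x using c[of x] by (simp add: eq)
    then show ?case by (intro exI[of _ c]) (auto simp: LIMSEQ_const_iff)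
  qed
  have D0: "?D (\<lambda>x. a * ?h x) = (\<lambda>_. 0)" for a
    using lin[of a ?h 0 ?h] by (simp add: eig fun_eq_iff)
  have "{\<psi> \<in> continuous_functions. \<exists>k. (?D ^^ k) \<psi> = (\<lambda>_. 0)} = range (\<lambda>a x. a * ?h x)"
  proof (intro subset_antisym subsetI)
    fix \<psi> assume "\<psi> \<in> {\<psi> \<in> continuous_functions. \<exists>k. (?D ^^ k) \<psi> = (\<lambda>_. 0)}"
    then show "\<psi> \<in> range (\<lambda>a x. a * ?h x)"
      using gen[of \<psi>] unfolding continuous_functions_def by blast
  next
    fix \<psi> assume "\<psi> \<in> range (\<lambda>a x. a * ?h x)"
    then obtain a where a: "\<psi> = (\<lambda>x. a * ?h x)" by blast
    then have "continuous_on UNIV \<psi>" using hc by (auto intro!: continuous_intros normalized_h_continuous)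
    moreover have "(?D ^^ Suc 0) \<psi> = (\<lambda>_. 0)" using D0[of a] by (simp add: a)
    ultimately show "\<psi> \<in> {\<psi> \<in> continuous_functions. \<exists>k. (?D ^^ k) \<psi> = (\<lambda>_. 0)}"
      unfolding continuous_functions_def by blast
  qed
  moreover have "?h \<noteq> (\<lambda>_. 0)" using h0 by metis
  moreover have "?h \<in> continuous_functions" using hc by (simp add: continuous_functions_def)
  ultimately show ?thesis unfolding simple_eigenvalue_on_def eigenvalue_on_def using eig by blast
qed

lemma integrable_indicator_mu: "A \<in> sets borel \<Longrightarrow> integrable \<mu> (indicator A :: 'a \<Rightarrow> real)"
  by (rule mu.integrable_const_bound[of _ 1]) auto

lemma integrable_indicator_nu: "A \<in> sets borel \<Longrightarrow> integrable \<nu> (indicator A :: 'a \<Rightarrow> real)"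
  by (rule nu.integrable_const_bound[of _ 1]) auto

lemma mu_le_nu:
  obtains M where "0 < M" "\<And>A. A \<in> sets borel \<Longrightarrow> measure \<mu> A \<le> M * measure \<nu> A"
    "\<And>A. A \<in> sets borel \<Longrightarrow> measure \<nu> A \<le> M * measure \<mu> A"
proof -
  obtain M where M: "0 < M" "\<And>x. normalized_h x \<le> M" "\<And>x. 1 / M \<le> normalized_h x" by (rule normalized_h_bounds) blast
  have nu: "measure \<nu> A = (\<integral>x. indicator A x / normalized_h x \<partial>\<mu>)" if A: "A \<in> sets borel" for A
    using integral_nu[of "indicator A :: 'a \<Rightarrow> real"] A by simp
  have mu: "measure \<mu> A = (\<integral>x. indicator A x \<partial>\<mu>)" if A: "A \<in> sets borel" for A
    using A by simp
  have int: "integrable \<mu> (\<lambda>x. indicator A x / normalized_h x)" if A: "A \<in> sets borel" for A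
  proof (rule mu.integrable_const_bound[of _ M])
    have "1 / normalized_h x \<le> M" for x using M(3)[of x] normalized_h_pos[of x] M(1) by (simp add: field_simps)
    then show "AE x in \<mu>. norm (indicator A x / normalized_h x) \<le> M"
      using M(1) normalized_h_pos by (auto simp: indicator_def abs_of_pos less_imp_le)
  qed (use A in measurable)
  have "measure \<mu> A \<le> M * measure \<nu> A" if A: "A \<in> sets borel" for A
  proof -
    have "(\<integral>x. indicator A x \<partial>\<mu>) \<le> (\<integral>x. M * (indicator A x / normalized_h x) \<partial>\<mu>)"
    proof (rule integral_mono)
      show "indicator A x \<le> M * (indicator A x / normalized_h x)" for x
        using M(2)[of x] normalized_h_pos[of x] by (auto simp: indicator_def field_simps)
    qed (intro integrable_indicator_mu integrable_mult_right int A)+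
    then show ?thesis unfolding nu[OF A] mu[OF A] by (simp only: integral_mult_right_zero)
  qed
  moreover have "measure \<nu> A \<le> M * measure \<mu> A" if A: "A \<in> sets borel" for A
  proof -
    have "(\<integral>x. indicator A x / normalized_h x \<partial>\<mu>) \<le> (\<integral>x. M * indicator A x \<partial>\<mu>)"
    proof (rule integral_mono)
      show "indicator A x / normalized_h x \<le> M * indicator A x" for x
        using M(3)[of x] normalized_h_pos[of x] M(1) by (auto simp: indicator_def field_simps)
    qed (intro integrable_indicator_mu integrable_mult_right int A)+
    then show ?thesis unfolding nu[OF A] mu[OF A] by (simp only: integral_mult_right_zero)
  qed
  ultimately show thesis using that M(1) by blast
qed

text \<open>Every fibre of \<open>T\<^sup>N\<close> meets the ball of radius \<open>r/2\<close>, so \<open>P\<^sup>N\<close> of a bump supported in the ball of radius \<open>r\<close> is bounded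
below by a constant that does not depend on the centre.\<close>

lemma nu_ball_lower_bound:
  assumes r: "0 < r"
  obtains c where "0 < c" "\<And>x. c \<le> measure \<nu> {y. dist x y < r}"
proof -
  obtain M where M: "0 < M" "\<And>A. A \<in> sets borel \<Longrightarrow> measure \<mu> A \<le> M * measure \<nu> A"
    by (rule mu_le_nu) blast
  obtain N where N: "\<And>x z. \<exists>y. (T ^^ N) y = z \<and> dist x y < r / 2"
    using preimages_dense[of "r / 2"] r by auto
  obtain C where C: "\<And>x. \<bar>G x\<bar> \<le> C"
    using continuous_bounded[of G] G_normalized unfolding normalized_def by (metis real_norm_def)
  define m where "m = exp (- C) ^ N / 2"
  have m: "0 < m" by (simp add: m_def)
  have "m / M \<le> measure \<nu> {y. dist x y < r}" for x
  proof -
    define \<phi> where "\<phi> y = max 0 (1 - dist x y / r)" for y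
    have c: "continuous_on UNIV \<phi>" unfolding \<phi>_def using r by (intro continuous_intros) auto
    have inv: "(\<integral>z. (P ^^ n) \<phi> z \<partial>\<mu>) = (\<integral>z. \<phi> z \<partial>\<mu>)" for n
    proof (induction n)
      case (Suc n)
      have "continuous_on UNIV ((P ^^ n) \<phi>)"
        using c G_normalized by (intro transfer_iter_continuous) (auto simp: normalized_def)
      then show ?case using mu_P_invariant Suc by simp
    qed simp
    have cN: "continuous_on UNIV ((P ^^ N) \<phi>)"
      using c G_normalized by (intro transfer_iter_continuous) (auto simp: normalized_def)
    have "m \<le> (P ^^ N) \<phi> z" for z
    proof -
      obtain y where y: "(T ^^ N) y = z" "dist x y < r / 2" using N by blast
      have "exp (- C) ^ N * \<phi> y \<le> (P ^^ N) \<phi> ((T ^^ N) y)"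
        using C by (intro transfer_iter_ge_preimage) (auto simp: \<phi>_def abs_le_iff minus_le_iff)
      moreover have "1 / 2 \<le> \<phi> y" using y(2) r by (simp add: \<phi>_def field_simps)
      then have "m \<le> exp (- C) ^ N * \<phi> y" unfolding m_def by (simp add: field_simps)
      ultimately show ?thesis using y(1) by simp
    qed
    then have "(\<integral>z. m \<partial>\<mu>) \<le> (\<integral>z. (P ^^ N) \<phi> z \<partial>\<mu>)"
      by (intro integral_mono integrable_continuous cN mu.finite_measure_axioms mu_sets) auto
    then have "m \<le> (\<integral>z. \<phi> z \<partial>\<mu>)" unfolding inv using mu.prob_space by simp
    also have B: "{y. dist x y < r} \<in> sets borel"
      by (intro borel_open open_Collect_less continuous_intros)
    have "(\<integral>z. \<phi> z \<partial>\<mu>) \<le> (\<integral>z. indicator {y. dist x y < r} z \<partial>\<mu>)"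
    proof (rule integral_mono)
      show "integrable \<mu> \<phi>" by (rule integrable_continuous[OF c mu.finite_measure_axioms mu_sets])
      show "\<phi> z \<le> indicator {y. dist x y < r} z" for z
        using r by (auto simp: \<phi>_def indicator_def field_simps)
    qed (rule integrable_indicator_mu[OF B])
    also have "\<dots> \<le> M * measure \<nu> {y. dist x y < r}" using B M(2)[OF B] by simp
    finally show ?thesis using M(1) by (simp add: field_simps)
  qed
  then show thesis using that[of "m / M"] m M(1) by simp
qed

lemma nu_indicator:
  assumes "A \<in> sets borel"
  shows "(\<integral>x. L (indicator A) x \<partial>\<nu>) = \<kappa> * measure \<nu> A" "integrable \<nu> (L (indicator A))"
  using conformal_indicator[OF nu.finite_measure_axioms nu_sets f_continuous nu_conformal assms] by auto

text \<open>The one-step form of conformality: when \<open>T\<close> maps \<open>A\<close> bijectively onto \<open>B\<close>, the transfer operator sends the indicator of \<open>A\<close> to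
\<open>exp f\<close> along the inverse branch, cut off to \<open>B\<close>. It serves for dynamical balls and for cylinders.\<close>

lemma nu_branch_bounds:
  assumes A: "A \<in> sets borel" and B: "B \<in> sets borel"
    and onto: "\<And>z. z \<in> B \<Longrightarrow> \<exists>i. \<forall>j. b j z \<in> A \<longleftrightarrow> j = i" and into: "\<And>y. y \<in> A \<Longrightarrow> T y \<in> B"
    and bd: "\<And>y. y \<in> A \<Longrightarrow> a \<le> f y \<and> f y \<le> c"
  shows "exp a * measure \<nu> B \<le> \<kappa> * measure \<nu> A" and "\<kappa> * measure \<nu> A \<le> exp c * measure \<nu> B"
proof -
  have bounds: "exp a * indicator B z \<le> L (indicator A) z \<and> L (indicator A) z \<le> exp c * indicator B z" for z
  proof (cases "z \<in> B")
    case True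
    then obtain i where i: "\<And>j. b j z \<in> A \<longleftrightarrow> j = i" using onto by blast
    have "L (indicator A) z = (\<Sum>j\<in>UNIV. if j = i then exp (f (b i z)) else 0)"
      unfolding transfer_real by (rule sum.cong) (auto simp: i indicator_def)
    then show ?thesis using True bd[of "b i z"] i by simp
  next
    case False
    then have "b i z \<notin> A" for i using into[of "b i z"] by auto
    then show ?thesis using False by (simp add: transfer_real)
  qed
  have int: "integrable \<nu> (\<lambda>z. d * indicator B z)" for d :: real
    by (intro integrable_mult_right integrable_indicator_nu B)
  have "(\<integral>z. exp a * indicator B z \<partial>\<nu>) \<le> (\<integral>z. L (indicator A) z \<partial>\<nu>)"
    using bounds by (intro integral_mono int nu_indicator(2) A) auto
  then show "exp a * measure \<nu> B \<le> \<kappa> * measure \<nu> A" using B by (simp add: nu_indicator(1)[OF A])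
  have "(\<integral>z. L (indicator A) z \<partial>\<nu>) \<le> (\<integral>z. exp c * indicator B z \<partial>\<nu>)"
    using bounds by (intro integral_mono int nu_indicator(2) A) auto
  then show "\<kappa> * measure \<nu> A \<le> exp c * measure \<nu> B" using B by (simp add: nu_indicator(1)[OF A])
qed

text \<open>The points of a dynamical ball of length \<open>n\<close> are within \<open>e\<^sub>n\<close> of the centre, where \<open>e\<^sub>0 = r\<close> and \<open>stretch e\<^sub>n\<^sub>+\<^sub>1 = e\<^sub>n\<close>. Each step
of conformality therefore costs an error of at most \<open>w(e\<^sub>n)\<close>, and these errors add up to at most \<open>W r\<close>.\<close>

lemma nu_bowen_ball:
  assumes r: "0 < r" "r < 1 / 6"
  shows "0 < measure \<nu> (bowen_ball T n r x) \<and>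
    \<bar>real n * ln \<kappa> + ln (measure \<nu> (bowen_ball T n r x)) - birkhoff_sum T f n x
      - ln (measure \<nu> {y. dist ((T ^^ n) x) y < r})\<bar> \<le> W r"
proof -
  obtain iv where iv: "\<And>D. 0 \<le> D \<Longrightarrow> 0 \<le> iv D \<and> stretch s (iv D) = D"
    using ex_stretch_inverse[OF s_pos] by metis
  \<comment> \<open>the largest distance from the centre that a dynamical ball of length \<open>n\<close> allows\<close>
  define e where "e n = (iv ^^ n) r" for n
  have e0: "0 \<le> e n" for n by (induction n) (use iv r in \<open>auto simp: e_def\<close>)
  have e_Suc: "stretch s (e (Suc n)) = e n" for n using iv[OF e0[of n]] by (simp add: e_def)
  have e_le: "e n \<le> r" for n
  proof (induction n)
    case (Suc n)
    then show ?case using le_stretch[of "e (Suc n)" s] by (simp add: e_Suc)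
  qed (simp add: e_def)
  have near: "dist x y \<le> e n" if "y \<in> bowen_ball T n r x" for n x y
    using that
  proof (induction n arbitrary: x y)
    case 0
    then show ?case by (simp add: bowen_ball_def e_def)
  next
    case (Suc n)
    have d: "dist x y < r" "T y \<in> bowen_ball T n r (T x)" using Suc.prems by (auto simp: bowen_ball_Suc)
    then have "dist (T x) (T y) \<le> e n" using Suc.IH by blast
    moreover have "dist (T x) (T y) < 1 / 6" using d(2) r by (force simp: bowen_ball_def)
    then obtain i where i: "stretch s (dist x (b i (T y))) \<le> dist (T x) (T y)"
      "\<And>j. dist x (b j (T y)) < 1 / 6 \<Longrightarrow> j = i" by (rule local_inverse) blast
    have "code y = i" using i(2)[of "code y"] d(1) r by simp
    then have "stretch s (dist x y) \<le> dist (T x) (T y)" using i(1) branch_code[of y] by simp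
    ultimately have "stretch s (dist x y) \<le> stretch s (e (Suc n))" by (simp add: e_Suc)
    then show ?case by (rule stretch_le_cancel[OF s_pos e0])
  qed
  have one: "0 < measure \<nu> (bowen_ball T (Suc n) r x) \<and>
      \<bar>ln \<kappa> + ln (measure \<nu> (bowen_ball T (Suc n) r x)) - f x - ln (measure \<nu> (bowen_ball T n r (T x)))\<bar>
        \<le> w (e (Suc n))"
    if pos: "0 < measure \<nu> (bowen_ball T n r (T x))" for n x
  proof -
    let ?B = "bowen_ball T n r (T x)" and ?B' = "bowen_ball T (Suc n) r x"
    have onto: "\<exists>i. \<forall>j. b j z \<in> ?B' \<longleftrightarrow> j = i" if z: "z \<in> ?B" for z
    proof -
      have dz: "dist (T x) z < r" using z by (auto simp: bowen_ball_def)
      then have "dist (T x) z < 1 / 6" using r by linarith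
      then obtain i where i: "stretch s (dist x (b i z)) \<le> dist (T x) z"
        "\<And>j. dist x (b j z) < 1 / 6 \<Longrightarrow> j = i" by (rule local_inverse) blast
      have "dist x (b i z) < r" using i(1) dz stretch_dist[of x "b i z"] by linarith
      then have "b j z \<in> ?B' \<longleftrightarrow> j = i" for j
        using z i(2)[of j] r by (auto simp: bowen_ball_Suc)
      then show ?thesis by blast
    qed
    have bd: "f x - w (e (Suc n)) \<le> f y \<and> f y \<le> f x + w (e (Suc n))" if "y \<in> ?B'" for y
      using f_modulus[of x y] w_mono[of "dist x y" "e (Suc n)"] near[OF that] by (auto simp: abs_le_iff)
    have into: "T y \<in> ?B" if "y \<in> ?B'" for y using that by (simp add: bowen_ball_Suc)
    note bounds = nu_branch_bounds[OF bowen_ball_borel bowen_ball_borel onto into bd]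
    have "0 < exp (f x - w (e (Suc n))) * measure \<nu> ?B" using pos by simp
    then have "0 < \<kappa> * measure \<nu> ?B'" using bounds(1) by linarith
    then have pos': "0 < measure \<nu> ?B'" using kappa_pos by (simp add: zero_less_mult_iff)
    have "ln (exp (f x - w (e (Suc n))) * measure \<nu> ?B) \<le> ln (\<kappa> * measure \<nu> ?B')"
      "ln (\<kappa> * measure \<nu> ?B') \<le> ln (exp (f x + w (e (Suc n))) * measure \<nu> ?B)"
      using pos pos' kappa_pos bounds by (auto intro!: ln_mono)
    then show ?thesis using pos pos' kappa_pos by (simp add: ln_mult abs_le_iff)
  qed
  define V where "V n = (\<Sum>i<n. w (e (Suc i)))" for n
  have V: "V n + W (e n) \<le> W r" for n
  proof (induction n)
    case (Suc n)
    have "w (e (Suc n)) + W (e (Suc n)) \<le> W (e n)"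
      by (rule W_step[OF e0]) (simp add: e_Suc)
    then show ?case using Suc by (simp add: V_def)
  qed (simp add: V_def e_def)
  have V': "V n \<le> W r" for n using V[of n] W_nonneg[OF e0[of n]] by linarith
  obtain c where c: "0 < c" "\<And>x. c \<le> measure \<nu> {y. dist x y < r}"
    by (rule nu_ball_lower_bound[OF r(1)]) blast
  have "0 < measure \<nu> (bowen_ball T n r x) \<and>
      \<bar>real n * ln \<kappa> + ln (measure \<nu> (bowen_ball T n r x)) - birkhoff_sum T f n x
        - ln (measure \<nu> {y. dist ((T ^^ n) x) y < r})\<bar> \<le> V n" for n x
  proof (induction n arbitrary: x)
    case 0
    show ?case using c(1) c(2)[of x] by (simp add: bowen_ball_def birkhoff_sum_def V_def)
  next
    case (Suc n)
    show ?case
      using Suc[of "T x"] one[of n x] by (simp add: funpow_swap1 birkhoff_sum_Suc V_def distrib_right abs_le_iff)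
  qed
  then show ?thesis using V'[of n] by (meson order_trans)
qed

lemma gibbs_property:
  assumes r: "0 < r" "r < 1 / 6"
  shows "\<exists>K>0. \<forall>x n. 1 / K \<le> measure \<mu> (bowen_ball T n r x) / exp (birkhoff_sum T f n x - real n * ln \<kappa>)
    \<and> measure \<mu> (bowen_ball T n r x) / exp (birkhoff_sum T f n x - real n * ln \<kappa>) \<le> K"
proof -
  obtain M where M: "0 < M" "\<And>A. A \<in> sets borel \<Longrightarrow> measure \<mu> A \<le> M * measure \<nu> A"
    "\<And>A. A \<in> sets borel \<Longrightarrow> measure \<nu> A \<le> M * measure \<mu> A"
    by (rule mu_le_nu) blast
  obtain c where c: "0 < c" "\<And>x. c \<le> measure \<nu> {y. dist x y < r}"
    by (rule nu_ball_lower_bound[OF r(1)]) blast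
  define R where "R = W r + ln M - ln c"
  have "1 / exp R \<le> q \<and> q \<le> exp R"
    if q: "q = measure \<mu> (bowen_ball T n r x) / exp (birkhoff_sum T f n x - real n * ln \<kappa>)" for n x q
  proof -
    let ?B = "bowen_ball T n r x" and ?b = "measure \<nu> {y. dist ((T ^^ n) x) y < r}"
    note B = nu_bowen_ball[OF r, of n x]
    have "0 < M * measure \<mu> ?B" using B M(3)[OF bowen_ball_borel, of n r x] by linarith
    then have pos: "0 < measure \<mu> ?B" using M(1) by (simp add: zero_less_mult_iff)
    have "ln (measure \<mu> ?B) \<le> ln (M * measure \<nu> ?B)" "ln (measure \<nu> ?B) \<le> ln (M * measure \<mu> ?B)"
      using B pos M(2,3)[OF bowen_ball_borel] by (auto intro!: ln_mono)
    moreover have "ln (M * measure \<nu> ?B) = ln M + ln (measure \<nu> ?B)"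
      "ln (M * measure \<mu> ?B) = ln M + ln (measure \<mu> ?B)"
      using B pos M(1) by (simp_all add: ln_mult)
    moreover have "0 < ?b" using c(1) c(2)[of "(T ^^ n) x"] by linarith
    then have "ln c \<le> ln ?b" "ln ?b \<le> 0" using c(1) c(2)[of "(T ^^ n) x"] by (auto intro!: ln_mono)
    ultimately have "\<bar>ln (measure \<mu> ?B) - (birkhoff_sum T f n x - real n * ln \<kappa>)\<bar> \<le> R"
      using B unfolding R_def by linarith
    moreover have "q = exp (ln (measure \<mu> ?B) - (birkhoff_sum T f n x - real n * ln \<kappa>))"
      unfolding q exp_diff[of "ln _"] using pos by simp
    moreover have "1 / exp R = exp (- R)" by (simp add: exp_minus inverse_eq_divide)
    ultimately show ?thesis by (auto simp: abs_le_iff)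
  qed
  then show ?thesis by (intro exI[of _ "exp R"]) simp
qed

end

section \<open>Entropy of finite partitions\<close>

text \<open>The set \<open>S\<close> has to contain all values of \<open>X\<close>; further elements contribute 0 because \<open>0 * ln 0 = 0\<close>.\<close>

definition shannon :: "'a measure \<Rightarrow> ('a \<Rightarrow> 'w) \<Rightarrow> 'w set \<Rightarrow> real" where
  "shannon m X S = - (\<Sum>w\<in>S. measure m (X -` {w}) * ln (measure m (X -` {w})))"

locale finite_valued = prob_space m for m :: "'a measure" +
  fixes X :: "'a \<Rightarrow> 'w" and S :: "'w set"
  assumes space_UNIV: "space m = UNIV" and finite_values: "finite S" and range_values: "X x \<in> S"
    and cells: "w \<in> S \<Longrightarrow> X -` {w} \<in> sets m"
begin

lemma integral_finite_valued:
  fixes F :: "'w \<Rightarrow> real"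
  shows "integrable m (\<lambda>x. F (X x))" and "(\<integral>x. F (X x) \<partial>m) = (\<Sum>w\<in>S. measure m (X -` {w}) * F w)"
proof -
  have eq: "(\<lambda>x. F (X x)) = (\<lambda>x. \<Sum>w\<in>S. indicator (X -` {w}) x * F w)"
  proof
    fix x
    have "(\<Sum>w\<in>S. indicator (X -` {w}) x * F w) = (\<Sum>w\<in>S. if w = X x then F w else 0)"
      by (rule sum.cong) (auto simp: indicator_def)
    then show "F (X x) = (\<Sum>w\<in>S. indicator (X -` {w}) x * F w)"
      using finite_values range_values[of x] by simp
  qed
  have int: "integrable m (\<lambda>x. indicator (X -` {w}) x * F w)" if "w \<in> S" for w
    using cells[OF that] by (intro integrable_mult_left) (simp add: emeasure_eq_measure)
  show "integrable m (\<lambda>x. F (X x))"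
    unfolding eq using int by (rule Bochner_Integration.integrable_sum)
  have "(\<integral>x. F (X x) \<partial>m) = (\<Sum>w\<in>S. \<integral>x. indicator (X -` {w}) x * F w \<partial>m)"
    unfolding eq using int by (rule Bochner_Integration.integral_sum)
  also have "\<dots> = (\<Sum>w\<in>S. measure m (X -` {w}) * F w)"
    using cells space_UNIV by (intro sum.cong) auto
  finally show "(\<integral>x. F (X x) \<partial>m) = (\<Sum>w\<in>S. measure m (X -` {w}) * F w)" .
qed

lemma sum_cells: "(\<Sum>w\<in>S. measure m (X -` {w})) = 1"
  using integral_finite_valued(2)[of "\<lambda>_. 1"] prob_space by simp

lemma shannon_integral: "shannon m X S = (\<integral>x. - ln (measure m (X -` {X x})) \<partial>m)"
  using integral_finite_valued(2)[of "\<lambda>w. - ln (measure m (X -` {w}))"] by (simp add: shannon_def sum_negf)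

text \<open>From \<open>ln t \<le> t - 1\<close>. Weights may vanish where the measure does.\<close>

lemma gibbs_inequality:
  assumes q: "\<And>w. w \<in> S \<Longrightarrow> 0 \<le> q w" "(\<Sum>w\<in>S. q w) \<le> 1"
    and q_pos: "\<And>w. w \<in> S \<Longrightarrow> 0 < measure m (X -` {w}) \<Longrightarrow> 0 < q w"
  shows "shannon m X S \<le> (\<Sum>w\<in>S. measure m (X -` {w}) * - ln (q w))"
proof -
  let ?m = "\<lambda>w. measure m (X -` {w})"
  have "?m w * ln (q w) - ?m w * ln (?m w) \<le> q w - ?m w" if w: "w \<in> S" for w
  proof (cases "?m w = 0")
    case True
    then show ?thesis using q(1)[OF w] by simp
  next
    case False
    then have pos: "0 < ?m w" using measure_nonneg[of m "X -` {w}"] by linarith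
    have "?m w * ln (q w) - ?m w * ln (?m w) = ?m w * ln (q w / ?m w)"
      using pos q_pos[OF w pos] by (simp add: ln_div right_diff_distrib)
    also have "\<dots> \<le> ?m w * (q w / ?m w - 1)"
      using pos q_pos[OF w pos] by (intro mult_left_mono ln_le_minus_one) auto
    also have "\<dots> = q w - ?m w" using pos by (simp add: field_simps)
    finally show ?thesis .
  qed
  then have "(\<Sum>w\<in>S. ?m w * ln (q w) - ?m w * ln (?m w)) \<le> (\<Sum>w\<in>S. q w - ?m w)"
    by (rule sum_mono)
  then show ?thesis using q(2) sum_cells by (simp add: shannon_def sum_subtractf sum_negf)
qed

lemma shannon_map_le:
  assumes Y: "finite_valued m (\<lambda>x. \<pi> (X x)) S'"
  shows "shannon m (\<lambda>x. \<pi> (X x)) S' \<le> shannon m X S"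
proof -
  interpret Y: finite_valued m "\<lambda>x. \<pi> (X x)" S' by (rule Y)
  let ?Y = "\<lambda>x. \<pi> (X x)"
  have "shannon m ?Y S' = (\<integral>x. - ln (measure m (?Y -` {\<pi> (X x)})) \<partial>m)" by (rule Y.shannon_integral)
  also have "\<dots> = (\<Sum>w\<in>S. measure m (X -` {w}) * - ln (measure m (?Y -` {\<pi> w})))"
    by (rule integral_finite_valued(2)[of "\<lambda>w. - ln (measure m (?Y -` {\<pi> w}))"])
  also have "\<dots> \<le> (\<Sum>w\<in>S. measure m (X -` {w}) * - ln (measure m (X -` {w})))"
  proof (rule sum_mono)
    fix w assume w: "w \<in> S"
    show "measure m (X -` {w}) * - ln (measure m (?Y -` {\<pi> w})) \<le> measure m (X -` {w}) * - ln (measure m (X -` {w}))"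
    proof (cases "measure m (X -` {w}) = 0 \<or> X -` {w} = {}")
      case False
      then have pos: "0 < measure m (X -` {w})" using measure_nonneg[of m "X -` {w}"] by linarith
      obtain x where "X x = w" using False by blast
      then have "\<pi> w \<in> S'" using Y.range_values[of x] by simp
      then have "?Y -` {\<pi> w} \<in> sets m" by (rule Y.cells)
      then have "measure m (X -` {w}) \<le> measure m (?Y -` {\<pi> w})" by (intro finite_measure_mono) auto
      then have "ln (measure m (X -` {w})) \<le> ln (measure m (?Y -` {\<pi> w}))" using pos by (intro ln_mono) auto
      then show ?thesis using pos by (intro mult_left_mono) auto
    qed auto
  qed
  also have "\<dots> = shannon m X S" by (simp add: shannon_def sum_negf)
  finally show ?thesis .
qed

end

definition itinerary :: "('a \<Rightarrow> 'a) \<Rightarrow> ('a \<Rightarrow> 'c) \<Rightarrow> nat \<Rightarrow> 'a \<Rightarrow> 'c list" where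
  "itinerary T p n x = map (\<lambda>j. p ((T ^^ j) x)) [0..<n]"

definition words :: "'c set \<Rightarrow> nat \<Rightarrow> 'c list set" where
  "words C n = {w. set w \<subseteq> C \<and> length w = n}"

lemma itinerary_0 [simp]: "itinerary T p 0 x = []"
  by (simp add: itinerary_def)

lemma itinerary_Suc: "itinerary T p (Suc n) x = p x # itinerary T p n (T x)"
  unfolding itinerary_def by (subst map_upt_Suc) (simp add: funpow_swap1)

lemma length_itinerary [simp]: "length (itinerary T p n x) = n"
  by (simp add: itinerary_def)

lemma itinerary_append: "itinerary T p (n + k) x = itinerary T p n x @ itinerary T p k ((T ^^ n) x)"
  by (induction n arbitrary: x) (simp_all add: itinerary_Suc funpow_swap1)

lemma take_itinerary: "k \<le> n \<Longrightarrow> take k (itinerary T p n x) = itinerary T p k x"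
  by (simp add: itinerary_def take_map)

lemma map_itinerary: "map \<pi> (itinerary T p n x) = itinerary T (\<lambda>x. \<pi> (p x)) n x"
  by (simp add: itinerary_def)

lemma itinerary_eq_iff:
  "itinerary T p n x = itinerary T p n y \<longleftrightarrow> (\<forall>j<n. p ((T ^^ j) x) = p ((T ^^ j) y))"
  by (auto simp: itinerary_def)

lemma finite_words: "finite C \<Longrightarrow> finite (words C n)"
  unfolding words_def by (rule finite_lists_length_eq)

lemma words_0 [simp]: "words C 0 = {[]}"
  by (auto simp: words_def)

lemma sum_words_Suc: "sum F (words C (Suc n)) = (\<Sum>w\<in>words C n. \<Sum>c\<in>C. F (c # w))"
proof -
  have "words C (Suc n) = (\<lambda>(w, c). c # w) ` (words C n \<times> C)"
    unfolding words_def by (rule lists_length_Suc_eq)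
  moreover have "inj_on (\<lambda>(w, c). c # w) (words C n \<times> C)" by (auto simp: inj_on_def)
  ultimately have "sum F (words C (Suc n)) = (\<Sum>(w, c)\<in>words C n \<times> C. F (c # w))"
    by (simp add: sum.reindex split_def)
  then show ?thesis by (simp add: sum.cartesian_product)
qed

lemma sum_words_append:
  "(\<Sum>w\<in>words C (n + k). A (take n w) * D (drop n w)) = (\<Sum>u\<in>words C n. A u) * (\<Sum>v\<in>words C k. D v :: real)"
proof -
  have inj: "inj_on (\<lambda>(u, v). u @ v) (words C n \<times> words C k)" by (auto simp: inj_on_def words_def)
  have "words C (n + k) = (\<lambda>(u, v). u @ v) ` (words C n \<times> words C k)"
  proof (intro subset_antisym subsetI)
    fix w assume "w \<in> words C (n + k)"
    then have "w = take n w @ drop n w" "take n w \<in> words C n" "drop n w \<in> words C k"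
      by (auto simp: words_def dest: in_set_takeD in_set_dropD)
    then show "w \<in> (\<lambda>(u, v). u @ v) ` (words C n \<times> words C k)" by (metis (no_types, lifting) SigmaI case_prod_conv image_eqI)
  qed (auto simp: words_def)
  then have "(\<Sum>w\<in>words C (n + k). A (take n w) * D (drop n w)) = (\<Sum>(u, v)\<in>words C n \<times> words C k. A u * D v)"
    by (simp only: sum.reindex[OF inj] comp_def) (auto intro!: sum.cong simp: words_def)
  then show ?thesis by (simp add: sum_product sum.cartesian_product)
qed

locale invariant_measure = prob_space m for m :: "'a::topological_space measure" +
  fixes T :: "'a \<Rightarrow> 'a"
  assumes sets_borel: "sets m = sets borel" and T_measurable: "T \<in> measurable m m" and distr_T: "distr m m T = m"
begin

lemma space_UNIV: "space m = UNIV"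
  using sets_borel by (metis sets_eq_imp_space_eq space_borel)

lemma integral_T: 
  fixes \<phi> :: "'a \<Rightarrow> real"
  assumes "integrable m \<phi>"
  shows "integrable m (\<lambda>x. \<phi> (T x))" and "(\<integral>x. \<phi> (T x) \<partial>m) = (\<integral>x. \<phi> x \<partial>m)"
proof -
  have "integrable (distr m m T) \<phi>" using assms by (simp add: distr_T)
  then show "integrable m (\<lambda>x. \<phi> (T x))" by (subst (asm) integrable_distr_eq[OF T_measurable]) (use assms in auto)
  show "(\<integral>x. \<phi> (T x) \<partial>m) = (\<integral>x. \<phi> x \<partial>m)"
    using integral_distr[OF T_measurable, of \<phi>] assms by (simp add: distr_T borel_measurable_integrable)
qed

lemma itinerary_finite_valued:
  assumes C: "finite C" "\<And>x. p x \<in> C" "\<And>c. c \<in> C \<Longrightarrow> p -` {c} \<in> sets m"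
  shows "finite_valued m (itinerary T p n) (words C n)"
proof
  show "space m = UNIV" by (rule space_UNIV)
  show "finite (words C n)" by (rule finite_words[OF C(1)])
  show "itinerary T p n x \<in> words C n" for x
    using C(2) by (auto simp: words_def itinerary_def)
  show "itinerary T p n -` {w} \<in> sets m" if "w \<in> words C n" for w
    using that
  proof (induction n arbitrary: w)
    case 0
    then have "itinerary T p 0 -` {w} = space m" by (auto simp: words_def space_UNIV)
    then show ?case by (simp only: sets.top)
  next
    case (Suc n)
    then obtain c v where w: "w = c # v" "c \<in> C" "v \<in> words C n" by (cases w) (auto simp: words_def)
    have "itinerary T p (Suc n) -` {w} = p -` {c} \<inter> (T -` (itinerary T p n -` {v}) \<inter> space m)"
      by (auto simp: w(1) itinerary_Suc space_UNIV)
    then show ?case using C(3)[OF w(2)] measurable_sets[OF T_measurable Suc.IH[OF w(3)]] by simp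
  qed
qed

lemma integral_T_iter:
  fixes \<phi> :: "'a \<Rightarrow> real"
  assumes "integrable m \<phi>"
  shows "integrable m (\<lambda>x. \<phi> ((T ^^ n) x)) \<and> (\<integral>x. \<phi> ((T ^^ n) x) \<partial>m) = (\<integral>x. \<phi> x \<partial>m)"
proof (induction n)
  case (Suc n)
  then show ?case using integral_T[of "\<lambda>x. \<phi> ((T ^^ n) x)"] by (simp add: funpow_swap1)
qed (use assms in simp)

text \<open>The Gibbs inequality with the product of the laws of the first \<open>n\<close> and of the last \<open>k\<close> letters as weights; by
invariance the last \<open>k\<close> letters are distributed like the first \<open>k\<close>.\<close>

lemma shannon_itinerary_subadditive:
  assumes C: "finite C" "\<And>x. p x \<in> C" "\<And>c. c \<in> C \<Longrightarrow> p -` {c} \<in> sets m"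
  shows "shannon m (itinerary T p (n + k)) (words C (n + k))
    \<le> shannon m (itinerary T p n) (words C n) + shannon m (itinerary T p k) (words C k)"
proof -
  interpret A: finite_valued m "itinerary T p n" "words C n" by (rule itinerary_finite_valued[OF C])
  interpret D: finite_valued m "itinerary T p k" "words C k" by (rule itinerary_finite_valued[OF C])
  interpret N: finite_valued m "itinerary T p (n + k)" "words C (n + k)" by (rule itinerary_finite_valued[OF C])
  define a where "a u = measure m (itinerary T p n -` {u})" for u
  define d where "d v = measure m (itinerary T p k -` {v})" for v
  let ?c = "\<lambda>w. measure m (itinerary T p (n + k) -` {w})"
  have split: "take n (itinerary T p (n + k) x) = itinerary T p n x"
    "drop n (itinerary T p (n + k) x) = itinerary T p k ((T ^^ n) x)" for x
    by (simp_all add: itinerary_append)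
  have pos: "0 < a (take n w) \<and> 0 < d (drop n w)" if w: "w \<in> words C (n + k)" "0 < ?c w" for w
  proof -
    have tw: "take n w \<in> words C n" "drop n w \<in> words C k"
      using w(1) by (auto simp: words_def dest: in_set_takeD in_set_dropD)
    have "?c w \<le> a (take n w)"
      unfolding a_def using A.cells[OF tw(1)] by (intro finite_measure_mono) (auto simp: split)
    moreover have "?c w \<le> d (drop n w)"
    proof -
      let ?D = "itinerary T p k -` {drop n w}"
      have D: "?D \<in> sets m" by (rule D.cells[OF tw(2)])
      have i: "integrable m (indicator ?D :: 'a \<Rightarrow> real)" using D by (simp add: emeasure_eq_measure)
      have "?c w = (\<integral>x. indicator (itinerary T p (n + k) -` {w}) x \<partial>m)"
        using N.cells[OF w(1)] by (simp add: space_UNIV)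
      also have "\<dots> \<le> (\<integral>x. indicator ?D ((T ^^ n) x) \<partial>m)"
      proof (rule integral_mono)
        show "integrable m (indicator (itinerary T p (n + k) -` {w}) :: 'a \<Rightarrow> real)"
          using N.cells[OF w(1)] by (simp add: emeasure_eq_measure)
        show "integrable m (\<lambda>x. indicator ?D ((T ^^ n) x) :: real)"
          using integral_T_iter[OF i, of n] by blast
      qed (auto simp: indicator_def itinerary_append)
      also have "\<dots> = d (drop n w)" using integral_T_iter[OF i, of n] D by (simp add: d_def space_UNIV)
      finally show ?thesis .
    qed
    ultimately show ?thesis using w(2) by linarith
  qed
  have "shannon m (itinerary T p (n + k)) (words C (n + k))
      \<le> (\<Sum>w\<in>words C (n + k). ?c w * - ln (a (take n w) * d (drop n w)))"
  proof (rule N.gibbs_inequality)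
    show "(\<Sum>w\<in>words C (n + k). a (take n w) * d (drop n w)) \<le> 1"
      unfolding sum_words_append unfolding a_def d_def A.sum_cells D.sum_cells by simp
  qed (use pos in \<open>auto simp: a_def d_def\<close>)
  also have "\<dots> = (\<Sum>w\<in>words C (n + k). ?c w * - ln (a (take n w)) + ?c w * - ln (d (drop n w)))"
  proof (rule sum.cong[OF refl])
    fix w assume w: "w \<in> words C (n + k)"
    show "?c w * - ln (a (take n w) * d (drop n w)) = ?c w * - ln (a (take n w)) + ?c w * - ln (d (drop n w))"
    proof (cases "?c w = 0")
      case False
      then have "0 < ?c w" using measure_nonneg[of m "itinerary T p (n + k) -` {w}"] by linarith
      then show ?thesis using pos[OF w] by (simp add: ln_mult algebra_simps)
    qed simp
  qed
  also have "\<dots> = (\<integral>x. - ln (a (itinerary T p n x)) \<partial>m) + (\<integral>x. - ln (d (itinerary T p k ((T ^^ n) x))) \<partial>m)"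
    unfolding sum.distrib N.integral_finite_valued(2)[symmetric] split ..
  also have "(\<integral>x. - ln (d (itinerary T p k ((T ^^ n) x))) \<partial>m) = (\<integral>x. - ln (d (itinerary T p k x)) \<partial>m)"
    using integral_T_iter[OF D.integral_finite_valued(1)[of "\<lambda>v. - ln (d v)"]] by blast
  finally show ?thesis
    unfolding A.shannon_integral D.shannon_integral by (simp only: a_def d_def)
qed

lemma shannon_nonneg:
  assumes "finite_valued m X S"
  shows "0 \<le> shannon m X S"
proof -
  have "measure m (X -` {w}) * ln (measure m (X -` {w})) \<le> 0" for w
    by (cases "measure m (X -` {w}) = 0")
       (auto intro!: mult_nonneg_nonpos simp: ln_le_zero_iff measure_le_0_iff order_less_le)
  then show ?thesis by (simp add: shannon_def sum_nonpos)
qed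

text \<open>The nonempty atoms of the iterated join are the nonempty cylinders of the itinerary through the partition. Subadditivity
makes the defining sequence converge.\<close>

lemma entropy_of_partition_limit:
  assumes P: "P \<in> finite_partitions m"
  obtains p where "\<And>x. p x \<in> P" "\<And>x A. A \<in> P \<Longrightarrow> p x = A \<longleftrightarrow> x \<in> A" "\<And>c. c \<in> P \<Longrightarrow> p -` {c} \<in> sets m"
    "(\<lambda>n. shannon m (itinerary T p n) (words P n) / real n) \<longlonglongrightarrow> entropy_of_partition m T P"
proof -
  have fin: "finite P" and sub: "P \<subseteq> sets m" and part: "partition_on UNIV P"
    using P by (auto simp: finite_partitions_def space_UNIV)
  define p where "p x = (THE A. A \<in> P \<and> x \<in> A)" for x
  have ex1: "\<exists>!A. A \<in> P \<and> x \<in> A" for x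
    using part unfolding partition_on_def disjoint_def by blast
  have p: "p x \<in> P" "x \<in> p x" for x using theI'[OF ex1[of x]] by (auto simp: p_def)
  have p_iff: "p x = A \<longleftrightarrow> x \<in> A" if "A \<in> P" for x A using p[of x] ex1[of x] that by blast
  have cell: "p -` {c} \<in> sets m" if "c \<in> P" for c
  proof -
    have "p -` {c} = c" using p_iff[OF that] by auto
    then show ?thesis using that sub by auto
  qed
  let ?H = "\<lambda>n. shannon m (itinerary T p n) (words P n)"
  have H: "partition_entropy m (iterated_join m T P n) = ?H n" for n
  proof -
    let ?I = "itinerary T p n"
    have mem: "(\<forall>j<n. (T ^^ j) x \<in> A j) \<longleftrightarrow> ?I x = map A [0..<n]" if "\<forall>j<n. A j \<in> P" for A x
      using that p_iff by (auto simp: itinerary_def)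
    have join: "iterated_join m T P n = (\<lambda>w. ?I -` {w}) ` {w \<in> words P n. ?I -` {w} \<noteq> {}}"
    proof (intro subset_antisym subsetI)
      fix B assume "B \<in> iterated_join m T P n"
      then obtain A where A: "B \<noteq> {}" "\<forall>j<n. A j \<in> P" "B = {x. \<forall>j<n. (T ^^ j) x \<in> A j}"
        by (auto simp: iterated_join_def space_UNIV)
      have "B = ?I -` {map A [0..<n]}" unfolding A(3) using mem[OF A(2)] by auto
      moreover have "map A [0..<n] \<in> words P n" using A(2) by (auto simp: words_def)
      ultimately show "B \<in> (\<lambda>w. ?I -` {w}) ` {w \<in> words P n. ?I -` {w} \<noteq> {}}" using A(1) by auto
    next
      fix B assume "B \<in> (\<lambda>w. ?I -` {w}) ` {w \<in> words P n. ?I -` {w} \<noteq> {}}"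
      then obtain w where w: "B = ?I -` {w}" "w \<in> words P n" "B \<noteq> {}" by auto
      have "\<forall>j<n. w ! j \<in> P" using w(2) by (auto simp: words_def)
      moreover have "map ((!) w) [0..<n] = w" using w(2) by (auto simp: words_def map_nth)
      ultimately have "B = {x. \<forall>j<n. (T ^^ j) x \<in> w ! j}" using mem[of "(!) w"] w(1) by auto
      then show "B \<in> iterated_join m T P n"
        using w(3) \<open>\<forall>j<n. w ! j \<in> P\<close> unfolding iterated_join_def space_UNIV by auto
    qed
    have inj: "inj_on (\<lambda>w. ?I -` {w}) {w \<in> words P n. ?I -` {w} \<noteq> {}}" by (rule inj_onI) blast
    have "(\<Sum>B\<in>iterated_join m T P n. measure m B * ln (measure m B))
        = (\<Sum>w\<in>{w \<in> words P n. ?I -` {w} \<noteq> {}}. measure m (?I -` {w}) * ln (measure m (?I -` {w})))"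
      unfolding join by (simp add: sum.reindex[OF inj])
    also have "\<dots> = (\<Sum>w\<in>words P n. measure m (?I -` {w}) * ln (measure m (?I -` {w})))"
      using finite_words[OF fin] by (intro sum.mono_neutral_left) auto
    finally show ?thesis by (simp add: partition_entropy_def shannon_def)
  qed
  have "\<exists>l. (\<lambda>n. ?H n / real n) \<longlonglongrightarrow> l \<and> (\<forall>n\<ge>1. l \<le> ?H n / real n)"
  proof (rule fekete)
    show "?H (n + k) \<le> ?H n + ?H k" for n k
      by (rule shannon_itinerary_subadditive[OF fin p(1) cell])
    have "0 \<le> ?H n" for n by (rule shannon_nonneg[OF itinerary_finite_valued[OF fin p(1) cell]])
    then show "bdd_below ((\<lambda>n. ?H n / real n) ` {1..})" by (intro bdd_belowI2[where m = 0]) auto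
  qed
  then obtain l where l: "(\<lambda>n. ?H n / real n) \<longlonglongrightarrow> l" by blast
  then have "entropy_of_partition m T P = l" unfolding entropy_of_partition_def H by (rule limI)
  then show thesis using that[of p] p(1) p_iff cell l by blast
qed

end

section \<open>The entropy bound for normalized potentials\<close>

lemma limit_le_increment:
  fixes a H :: "nat \<Rightarrow> real"
  assumes step: "\<And>n. k \<le> n \<Longrightarrow> a (Suc n) \<le> a n + c" and le: "\<And>n. H n \<le> a n"
    and lim: "(\<lambda>n. H n / real n) \<longlonglongrightarrow> l"
  shows "l \<le> c"
proof -
  have a_le: "a (k + n) \<le> a k + real n * c" for n
  proof (induction n)
    case (Suc n)
    then show ?case using step[of "k + n"] by (simp add: algebra_simps)
  qed simp
  have "H n / real n \<le> (a k - real k * c) / real n + c" if "max k 1 \<le> n" for n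
  proof -
    have "H n \<le> a k + real (n - k) * c"
      using le[of n] a_le[of "n - k"] that by simp
    also have "\<dots> = (a k - real k * c) + real n * c" using that by (simp add: of_nat_diff algebra_simps)
    finally have "H n / real n \<le> ((a k - real k * c) + real n * c) / real n"
      by (rule divide_right_mono) simp
    then show ?thesis unfolding add_divide_distrib using that by simp
  qed
  moreover have "(\<lambda>n. (a k - real k * c) / real n + c) \<longlonglongrightarrow> 0 + c"
    by (intro tendsto_add lim_const_over_n tendsto_const)
  ultimately have "l \<le> 0 + c"
    by (intro LIMSEQ_le[OF lim]) blast+
  then show ?thesis by simp
qed

lemma compact_closed_apart:
  fixes A B :: "'a::metric_space set"
  assumes A: "compact A" and B: "closed B" and disj: "A \<inter> B = {}"
  shows "\<exists>d>0. \<forall>x\<in>A. \<forall>y\<in>B. d \<le> dist x y"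
proof (cases "A = {} \<or> B = {}")
  case True
  then show ?thesis by (auto intro: exI[of _ 1])
next
  case False
  have "continuous_on A (\<lambda>x. infdist x B)" by (intro continuous_intros)
  then obtain x0 where x0: "x0 \<in> A" "\<And>x. x \<in> A \<Longrightarrow> infdist x0 B \<le> infdist x B"
    using continuous_attains_inf[OF A] False by metis
  have "0 < infdist x0 B" using x0(1) disj False B by (intro infdist_pos_not_in_closed) auto
  moreover have "infdist x0 B \<le> dist x y" if "x \<in> A" "y \<in> B" for x y
    using x0(2)[OF that(1)] infdist_le[OF that(2), of x] by linarith
  ultimately show ?thesis by blast
qed

context double_cover
begin

text \<open>The preimage of a fixed base point with a prescribed code.\<close>

primrec point :: "bool list \<Rightarrow> 'a" where
  "point [] = undefined"
| "point (i # w) = b i (point w)"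

lemma itinerary_point: "itinerary T code (length w) (point w) = w"
  by (induction w) (simp_all add: itinerary_Suc)

text \<open>A probability on words of pairs (atom, branch). The branches are chosen with the probabilities \<open>exp g\<close> of the random walk
on the preimages of the base point. Given the branches, \<open>t\<close> guesses each atom from the next \<open>k\<close> branches.\<close>

primrec weight :: "('a \<Rightarrow> real) \<Rightarrow> ('c \<Rightarrow> bool list \<Rightarrow> real) \<Rightarrow> nat \<Rightarrow> ('c \<times> bool) list \<Rightarrow> real" where
  "weight g t k [] = 1"
| "weight g t k (z # w) = exp (g (point (map snd (z # w)))) * t (fst z) (take k (map snd (z # w))) * weight g t k w"

lemma weight_pos: "(\<And>a u. 0 < t a u) \<Longrightarrow> 0 < weight g t k w"
  by (induction w) auto

lemma sum_weight:
  assumes g: "normalized g" and t: "\<And>u. (\<Sum>a\<in>C. t a u) = 1" 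
  shows "(\<Sum>w\<in>words (C \<times> UNIV) n. weight g t k w) = 1"
proof (induction n)
  case (Suc n)
  have "(\<Sum>z\<in>C \<times> UNIV. weight g t k (z # w)) = weight g t k w" for w
  proof -
    have "(\<Sum>z\<in>C \<times> UNIV. weight g t k (z # w))
        = (\<Sum>a\<in>C. \<Sum>i\<in>UNIV. exp (g (point (i # map snd w))) * t a (take k (i # map snd w)) * weight g t k w)"
      by (simp add: sum.cartesian_product split_def)
    also have "\<dots> = (\<Sum>i\<in>UNIV. exp (g (b i (point (map snd w)))) * (\<Sum>a\<in>C. t a (take k (i # map snd w))) * weight g t k w)"
      by (subst sum.swap) (simp add: sum_distrib_left sum_distrib_right)
    also have "\<dots> = weight g t k w"
      using g by (simp add: t sum_distrib_right[symmetric] normalized_def)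
    finally show ?thesis .
  qed
  then show ?case using Suc by (simp add: sum_words_Suc del: weight.simps)
qed simp

lemma codes_agree:
  assumes "\<And>x y. (\<forall>j<k. code ((T ^^ j) x) = code ((T ^^ j) y)) \<Longrightarrow> dist x y < d"
    and "k \<le> n" "itinerary T code n x = itinerary T code n y"
  shows "dist x y < d"
  using assms by (force simp: itinerary_eq_iff)

lemma code_cell: "code -` {i} \<in> sets borel"
proof -
  have "{x. code x} \<in> sets borel" using code_measurable by (simp add: pred_def)
  moreover have "code -` {i} = (if i then {x. code x} else - {x. code x})" by auto
  ultimately show ?thesis by auto
qed

text \<open>The entropy of the \<open>n\<close>-step itinerary is at most the mean of \<open>- ln\<close> of its weight. A letter of the word
contributes \<open>- g\<close> at the base preimage with the same code, which is uniformly close to \<open>- g x\<close> if enough letters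
follow, and \<open>- ln t\<close> for the guess of the atom. The latter is small on average: inside each atom there is a closed
set carrying almost all of its mass, these closed sets are a positive distance apart, so \<open>k\<close> branches determine which
of them contains the point, and outside of them the guess still has a fixed positive probability.\<close>

theorem entropy_of_partition_le:
  assumes m: "invariant_measure m T" and g: "normalized g" and P: "P \<in> finite_partitions m"
  shows "entropy_of_partition m T P \<le> - (\<integral>x. g x \<partial>m)"
proof -
  interpret invariant_measure m T by (rule m)
  obtain p where p: "\<And>x. p x \<in> P" "\<And>x A. A \<in> P \<Longrightarrow> p x = A \<longleftrightarrow> x \<in> A" "\<And>c. c \<in> P \<Longrightarrow> p -` {c} \<in> sets m"
    and lim: "(\<lambda>n. shannon m (itinerary T p n) (words P n) / real n) \<longlonglongrightarrow> entropy_of_partition m T P"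
    by (rule entropy_of_partition_limit[OF P]) blast
  have fin: "finite P" and sub: "P \<subseteq> sets borel"
    using P by (auto simp: finite_partitions_def sets_borel)
  have ne: "P \<noteq> {}" using p(1) by blast
  have gc: "continuous_on UNIV g" using g by (simp add: normalized_def)
  have gi: "integrable m g" by (rule integrable_continuous[OF gc finite_measure_axioms sets_borel])
  have "entropy_of_partition m T P \<le> - (\<integral>x. g x \<partial>m) + \<eta>" if \<eta>: "0 < \<eta>" for \<eta>
  proof -
    \<comment> \<open>a correct guess costs at most \<open>\<eta>/3\<close>, a wrong one at most \<open>K\<close>; \<open>\<eta>1\<close> bounds the probability of a
      wrong guess\<close>
    define \<delta> where "\<delta> = 1 - exp (- \<eta> / 3)"
    have \<delta>: "0 < \<delta>" "\<delta> < 1" using \<eta> by (auto simp: \<delta>_def)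
    define N where "N = real (card P)"
    have N: "1 \<le> N" using fin ne by (simp add: N_def Suc_le_eq card_gt_0_iff)
    define K where "K = ln (N / \<delta>)"
    have K: "0 \<le> K" unfolding K_def using \<delta> N by (intro ln_ge_zero) simp
    define \<eta>1 where "\<eta>1 = \<eta> / (3 * (K + 1))"
    have \<eta>1: "0 < \<eta>1" "\<eta>1 * K \<le> \<eta> / 3" using \<eta> K by (auto simp: \<eta>1_def field_simps)
    have "\<exists>F\<subseteq>A. closed F \<and> measure m (A - F) < \<eta>1 / N" if "A \<in> P" for A
      using inner_closed[OF finite_measure_axioms sets_borel, of A "\<eta>1 / N"] that sub \<eta>1(1) N by auto
    then obtain F where F: "\<And>A. A \<in> P \<Longrightarrow> F A \<subseteq> A" "\<And>A. A \<in> P \<Longrightarrow> closed (F A)"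
      "\<And>A. A \<in> P \<Longrightarrow> measure m (A - F A) < \<eta>1 / N" by metis
    define bad where "bad = (\<Union>A\<in>P. A - F A)"
    have AF: "A - F A \<in> sets m" if "A \<in> P" for A
      using that sub F(2) by (auto simp: sets_borel)
    have bad_sets: "bad \<in> sets m" unfolding bad_def using fin AF by (intro sets.finite_UN) auto
    have "measure m bad \<le> (\<Sum>A\<in>P. measure m (A - F A))"
      unfolding bad_def using fin AF by (intro finite_measure_subadditive_finite) auto
    also have "\<dots> \<le> (\<Sum>A\<in>P. \<eta>1 / N)" using F(3) by (intro sum_mono) (auto intro: less_imp_le)
    also have "\<dots> = \<eta>1" using N by (simp add: N_def)
    finally have bad_le: "measure m bad \<le> \<eta>1" .
    have "\<exists>\<rho>>0. \<forall>x\<in>F A. \<forall>y\<in>F B. A \<noteq> B \<longrightarrow> \<rho> \<le> dist x y" if AB: "A \<in> P" "B \<in> P" for A B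
    proof (cases "A = B")
      case True
      then show ?thesis by (intro exI[of _ 1]) simp
    next
      case False
      have "F A \<inter> F B = {}"
        using F(1) AB False p(2) by (metis disjoint_iff subsetD)
      moreover have "compact (F A)" using compact_Int_closed[OF compact_space F(2)[OF AB(1)]] by simp
      ultimately have "\<exists>d>0. \<forall>x\<in>F A. \<forall>y\<in>F B. d \<le> dist x y"
        using compact_closed_apart[OF _ F(2)[OF AB(2)]] by blast
      then show ?thesis by blast
    qed
    then obtain \<rho> where \<rho>: "\<And>A B. A \<in> P \<Longrightarrow> B \<in> P \<Longrightarrow> 0 < \<rho> A B"
      "\<And>A B x y. A \<in> P \<Longrightarrow> B \<in> P \<Longrightarrow> x \<in> F A \<Longrightarrow> y \<in> F B \<Longrightarrow> A \<noteq> B \<Longrightarrow> \<rho> A B \<le> dist x y"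
      by metis
    define R where "R = Min ((\<lambda>(A, B). \<rho> A B) ` (P \<times> P))"
    have R: "0 < R" "\<And>A B. A \<in> P \<Longrightarrow> B \<in> P \<Longrightarrow> R \<le> \<rho> A B"
      unfolding R_def using fin ne \<rho>(1) by (auto intro!: Min_le)
    obtain d where d: "0 < d" "\<And>x y. dist x y < d \<Longrightarrow> dist (g x) (g y) < \<eta> / 3"
      using uniformly_continuous[OF gc, of "\<eta> / 3"] \<eta> by auto
    obtain k where k: "\<And>x y. (\<forall>j<k. code ((T ^^ j) x) = code ((T ^^ j) y)) \<Longrightarrow> dist x y < min R d"
      using code_separates[of "min R d"] R(1) d(1) by auto
    \<comment> \<open>the atom to be guessed from a code word of length \<open>k\<close>\<close>
    define best where "best u = (if \<exists>A\<in>P. \<exists>x\<in>F A. itinerary T code k x = u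
      then SOME A. A \<in> P \<and> (\<exists>x\<in>F A. itinerary T code k x = u) else SOME A. A \<in> P)" for u
    have best_P: "best u \<in> P" for u
      unfolding best_def using someI_ex[of "\<lambda>A. A \<in> P \<and> (\<exists>x\<in>F A. itinerary T code k x = u)"]
        some_in_eq[of P] ne by auto
    have best: "best (itinerary T code k x) = p x" if "x \<notin> bad" for x
    proof -
      have "x \<in> p x" using p by blast
      then have xF: "x \<in> F (p x)" using that p(1) by (auto simp: bad_def)
      then have ex: "\<exists>A\<in>P. \<exists>y\<in>F A. itinerary T code k y = itinerary T code k x" using p(1) by blast
      let ?B = "best (itinerary T code k x)"
      have "?B \<in> P \<and> (\<exists>y\<in>F ?B. itinerary T code k y = itinerary T code k x)"
        using someI_ex[of "\<lambda>A. A \<in> P \<and> (\<exists>y\<in>F A. itinerary T code k y = itinerary T code k x)"] ex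
        by (auto simp: best_def)
      then obtain y where y: "?B \<in> P" "y \<in> F ?B" "itinerary T code k y = itinerary T code k x" by blast
      have "dist y x < R" using k[of y x] y(3) by (simp add: itinerary_eq_iff)
      then show ?thesis using \<rho>(2)[OF y(1) p(1) y(2) xF] R(2)[OF y(1) p(1)[of x]] by fastforce
    qed
    define t where "t A u = (1 - \<delta>) * of_bool (A = best u) + \<delta> / N" for A u
    have t_pos: "0 < t A u" for A u using \<delta> N by (simp add: t_def add_nonneg_pos)
    have t_sum: "(\<Sum>A\<in>P. t A u) = 1" for u
      using fin ne best_P[of u] N by (simp add: t_def sum.distrib sum_distrib_left[symmetric] N_def of_bool_def)
    have t_ln: "- ln (t (p x) (itinerary T code k x)) \<le> \<eta> / 3 + K * indicator bad x" for x
    proof (cases "x \<in> bad")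
      case True
      have "1 / (N / \<delta>) \<le> t (p x) (itinerary T code k x)" using \<delta> by (simp add: t_def)
      then have "ln (1 / (N / \<delta>)) \<le> ln (t (p x) (itinerary T code k x))"
        using \<delta> N by (intro ln_mono) auto
      then have "- ln (t (p x) (itinerary T code k x)) \<le> K" using \<delta> N by (simp add: K_def ln_div)
      then show ?thesis using True \<eta> by simp
    next
      case False
      have "exp (- \<eta> / 3) \<le> t (p x) (itinerary T code k x)"
        using \<delta> N best[OF False] by (simp add: t_def \<delta>_def)
      then have "ln (exp (- \<eta> / 3)) \<le> ln (t (p x) (itinerary T code k x))" by (intro ln_mono) auto
      then show ?thesis using False by simp
    qed
    let ?J = "itinerary T (\<lambda>x. (p x, code x))"
    let ?C = "P \<times> (UNIV :: bool set)"
    have C: "finite ?C" "\<And>x. (p x, code x) \<in> ?C" "\<And>c. c \<in> ?C \<Longrightarrow> (\<lambda>x. (p x, code x)) -` {c} \<in> sets m"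
    proof -
      show "finite ?C" using fin by simp
      show "(p x, code x) \<in> ?C" for x using p(1) by simp
      fix c assume "c \<in> ?C"
      then obtain A i where c: "c = (A, i)" "A \<in> P" by auto
      have "code -` {i} \<in> sets m" by (simp add: sets_borel code_cell)
      moreover have "(\<lambda>x. (p x, code x)) -` {c} = p -` {A} \<inter> code -` {i}" by (auto simp: c(1))
      ultimately show "(\<lambda>x. (p x, code x)) -` {c} \<in> sets m" using p(3)[OF c(2)] by auto
    qed
    have J: "finite_valued m (?J n) (words ?C n)" for n by (rule itinerary_finite_valued[OF C])
    define q where "q = weight g t k"
    have q_pos: "0 < q w" for w unfolding q_def by (rule weight_pos[OF t_pos])
    define E where "E n = (\<integral>x. - ln (q (?J n x)) \<partial>m)" for n
    have H_le: "shannon m (itinerary T p n) (words P n) \<le> E n" for n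
    proof -
      interpret J: finite_valued m "?J n" "words ?C n" by (rule J)
      have eq: "itinerary T p n = (\<lambda>x. map fst (?J n x))" by (simp add: map_itinerary)
      have "shannon m (itinerary T p n) (words P n) \<le> shannon m (?J n) (words ?C n)"
        unfolding eq by (rule J.shannon_map_le) (use itinerary_finite_valued[OF fin p(1,3), of n] in \<open>simp add: eq\<close>)
      also have "\<dots> \<le> (\<Sum>w\<in>words ?C n. measure m (?J n -` {w}) * - ln (q w))"
        using q_pos sum_weight[OF g t_sum] by (intro J.gibbs_inequality) (auto simp: q_def less_imp_le)
      also have "\<dots> = E n"
        unfolding E_def by (rule J.integral_finite_valued(2)[symmetric])
      finally show ?thesis .
    qed
    have E_step: "E (Suc n) \<le> E n + (- (\<integral>x. g x \<partial>m) + \<eta>)" if n: "k \<le> n" for n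
    proof -
      have Ji: "integrable m (\<lambda>x. - ln (q (?J n x)))" for n
        by (rule finite_valued.integral_finite_valued(1)[OF J])
      note JT = integral_T[OF Ji[of n]]
      have bi: "integrable m (\<lambda>x. K * indicator bad x)"
        using bad_sets by (intro integrable_mult_right) (simp add: emeasure_eq_measure)
      have point: "- ln (q (?J (Suc n) x)) \<le> - ln (q (?J n (T x))) + (- g x + (2 * \<eta> / 3 + K * indicator bad x))" for x
      proof -
        let ?y = "point (itinerary T code (Suc n) x)"
        have snd: "map snd (?J (Suc n) x) = itinerary T code (Suc n) x" by (simp add: map_itinerary)
        have J_Suc: "?J (Suc n) x = (p x, code x) # ?J n (T x)" by (simp add: itinerary_Suc)
        have "q (?J (Suc n) x) = exp (g ?y) * t (p x) (itinerary T code k x) * q (?J n (T x))"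
          using take_itinerary[of k "Suc n" T code x] n snd unfolding J_Suc q_def by simp
        then have "ln (q (?J (Suc n) x)) = g ?y + ln (t (p x) (itinerary T code k x)) + ln (q (?J n (T x)))"
          using t_pos[of "p x" "itinerary T code k x"] q_pos[of "?J n (T x)"] by (simp add: ln_mult)
        moreover have "dist x ?y < min R d"
          using itinerary_point[of "itinerary T code (Suc n) x"]
          by (intro codes_agree[OF k le_SucI[OF n]]) simp_all
        then have "\<bar>g x - g ?y\<bar> < \<eta> / 3" using d(2)[of x ?y] by (simp add: dist_real_def)
        ultimately show ?thesis using t_ln[of x] by linarith
      qed
      have "E (Suc n) \<le> (\<integral>x. - ln (q (?J n (T x))) + (- g x + (2 * \<eta> / 3 + K * indicator bad x)) \<partial>m)"
        unfolding E_def
        by (intro integral_mono Ji point Bochner_Integration.integrable_add JT(1) integrable_minus gi bi) auto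
      also have "\<dots> = E n + (- (\<integral>x. g x \<partial>m) + (2 * \<eta> / 3 + K * measure m bad))"
        using JT gi bi bad_sets prob_space unfolding E_def by (simp add: space_UNIV)
      also have "K * measure m bad \<le> \<eta> / 3"
        using mult_left_mono[OF bad_le K] \<eta>1(2) by (simp add: mult.commute)
      finally show ?thesis by simp
    qed
    show ?thesis by (rule limit_le_increment[OF E_step H_le lim])
  qed
  then show ?thesis by (rule field_le_epsilon)
qed

end

section \<open>The unique equilibrium state\<close>

lemma invariant_measure_iff: "m \<in> invariant_measures T \<longleftrightarrow> invariant_measure m T"
  by (auto simp: invariant_measures_def invariant_measure_def invariant_measure_axioms_def)

context double_cover
begin

lemma metric_entropy_le:
  assumes m: "invariant_measure m T" and g: "normalized g"
  shows "metric_entropy m T \<le> ereal (- (\<integral>x. g x \<partial>m))"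
  unfolding metric_entropy_def
  by (intro SUP_least) (use entropy_of_partition_le[OF m g] in simp)

end

context cover_equilibrium
begin

lemma mu_invariant_measure: "invariant_measure \<mu> T"
  using mu_invariant by (simp add: invariant_measure_iff)

lemma G_continuous: "continuous_on UNIV G"
  using G_normalized by (simp add: normalized_def)

lemma integral_G:
  assumes m: "invariant_measure m T"
  shows "(\<integral>x. G x \<partial>m) = (\<integral>x. f x \<partial>m) - ln \<kappa>"
proof -
  interpret invariant_measure m T by (rule m)
  have int: "continuous_on UNIV \<phi> \<Longrightarrow> integrable m \<phi>" for \<phi> :: "'a \<Rightarrow> real"
    by (rule integrable_continuous[OF _ finite_measure_axioms sets_borel])
  have "continuous_on UNIV (\<lambda>x. ln (h x))"
    using h_pos by (intro continuous_intros h_continuous) (auto simp: less_imp_neq[symmetric])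
  note lnh = int[OF this] integral_T[OF int[OF this]]
  have "(\<integral>x. G x \<partial>m) = (\<integral>x. f x + ln (h x) - ln (h (T x)) - ln \<kappa> \<partial>m)" by (simp add: G_def)
  also have "\<dots> = (\<integral>x. f x \<partial>m) + (\<integral>x. ln (h x) \<partial>m) - (\<integral>x. ln (h (T x)) \<partial>m) - ln \<kappa>"
    using int[OF f_continuous] lnh prob_space by simp
  also have "\<dots> = (\<integral>x. f x \<partial>m) - ln \<kappa>" using lnh by simp
  finally show ?thesis .
qed

lemma free_energy_le:
  assumes m: "invariant_measure m T"
  shows "metric_entropy m T + ereal (\<integral>x. f x \<partial>m) \<le> ereal (ln \<kappa>)"
proof -
  have "metric_entropy m T + ereal (\<integral>x. f x \<partial>m) \<le> ereal (- (\<integral>x. G x \<partial>m)) + ereal (\<integral>x. f x \<partial>m)"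
    by (intro add_mono metric_entropy_le m G_normalized) simp
  then show ?thesis by (simp add: integral_G[OF m])
qed

text \<open>For \<open>u = exp (t \<psi>)\<close> the potential \<open>G + ln u - ln (P u \<circ> T)\<close> is normalized as well. Comparing its entropy bound with the
equality for \<open>G\<close> gives \<open>t \<integral> \<psi> dm \<le> \<integral> ln (P u) dm \<le> t \<integral> P \<psi> dm + t\<^sup>2\<close>.\<close>

lemma equilibrium_subharmonic:
  assumes m: "invariant_measure m T" and eq: "ereal (ln \<kappa>) \<le> metric_entropy m T + ereal (\<integral>x. f x \<partial>m)"
    and \<psi>: "continuous_on UNIV \<psi>" "\<And>x. 0 \<le> \<psi> x \<and> \<psi> x \<le> 1"
  shows "(\<integral>x. \<psi> x \<partial>m) \<le> (\<integral>x. P \<psi> x \<partial>m)"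
proof (rule field_le_epsilon)
  interpret invariant_measure m T by (rule m)
  fix e :: real assume e: "0 < e"
  have int: "continuous_on UNIV \<phi> \<Longrightarrow> integrable m \<phi>" for \<phi> :: "'a \<Rightarrow> real"
    by (rule integrable_continuous[OF _ finite_measure_axioms sets_borel])
  \<comment> \<open>\<open>t \<le> 1\<close> keeps \<open>t \<psi>\<close> in the range where \<open>exp y \<le> 1 + y + y\<^sup>2\<close>\<close>
  define t where "t = min e 1"
  have t: "0 < t" "t \<le> 1" "t \<le> e" using e by (auto simp: t_def)
  define u where "u x = exp (t * \<psi> x)" for x
  have u_pos: "0 < u x" for x by (simp add: u_def)
  have uc: "continuous_on UNIV u" unfolding u_def by (intro continuous_intros \<psi>)
  have Pu_pos: "0 < P u x" for x by (rule transfer_pos[OF u_pos])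
  have lnPu: "continuous_on UNIV (\<lambda>x. ln (P u x))"
    using Pu_pos by (intro continuous_intros P_continuous uc) (auto simp: less_imp_neq[symmetric])
  then have lnPuT: "continuous_on UNIV (\<lambda>x. ln (P u (T x)))"
    using continuous_on_compose[OF T_continuous continuous_on_subset] by (fastforce simp: comp_def)
  define g where "g x = G x + t * \<psi> x - ln (P u (T x))" for x
  have "normalized g"
    unfolding normalized_def
  proof (intro conjI allI)
    show "continuous_on UNIV g"
      unfolding g_def by (intro continuous_on_diff continuous_on_add G_continuous lnPuT continuous_on_mult_left \<psi>)
    fix x
    have "exp (g (b i x)) = exp (G (b i x)) * u (b i x) / P u x" for i
      using Pu_pos[of x] by (simp add: g_def u_def exp_diff exp_add)
    then have "(\<Sum>i\<in>UNIV. exp (g (b i x))) = P u x / P u x"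
      by (simp add: sum_divide_distrib[symmetric] transfer_real)
    then show "(\<Sum>i\<in>UNIV. exp (g (b i x))) = 1" using Pu_pos[of x] by simp
  qed
  from metric_entropy_le[OF m this]
  have "metric_entropy m T + ereal (\<integral>x. f x \<partial>m) \<le> ereal (- (\<integral>x. g x \<partial>m)) + ereal (\<integral>x. f x \<partial>m)"
    by (intro add_mono) simp_all
  then have "ln \<kappa> \<le> - (\<integral>x. g x \<partial>m) + (\<integral>x. f x \<partial>m)"
    using eq by (metis ereal_less_eq(3) order_trans plus_ereal.simps(1))
  moreover have "(\<integral>x. g x \<partial>m) = (\<integral>x. G x \<partial>m) + t * (\<integral>x. \<psi> x \<partial>m) - (\<integral>x. ln (P u x) \<partial>m)"
    unfolding g_def using int[OF G_continuous] int[OF \<psi>(1)] int[OF lnPuT] integral_T[OF int[OF lnPu]] by simp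
  ultimately have "t * (\<integral>x. \<psi> x \<partial>m) \<le> (\<integral>x. ln (P u x) \<partial>m)"
    by (simp add: integral_G[OF m])
  also have "\<dots> \<le> (\<integral>x. t * P \<psi> x + t * t \<partial>m)"
  proof (rule integral_mono)
    show "integrable m (\<lambda>x. t * P \<psi> x + t * t)"
      by (intro int continuous_intros P_continuous \<psi>)
    fix x
    have ule: "u y \<le> t * \<psi> y + (1 + t * t) * 1" for y
    proof -
      have r: "0 \<le> t * \<psi> y" "t * \<psi> y \<le> t" using t \<psi>(2)[of y] by (auto simp: mult_left_le)
      then have "u y \<le> 1 + t * \<psi> y + (t * \<psi> y)\<^sup>2" unfolding u_def using t(2) by (intro exp_bound) linarith+
      moreover have "(t * \<psi> y)\<^sup>2 \<le> t * t" using r unfolding power2_eq_square by (intro mult_mono) auto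
      ultimately show ?thesis by simp
    qed
    have "P u x \<le> P (\<lambda>y. t * \<psi> y + (1 + t * t) * 1) x" by (rule transfer_mono[OF ule])
    also have "\<dots> = t * P \<psi> x + (1 + t * t)"
      unfolding transfer_linear by (simp add: transfer_normalized_const[OF G_normalized])
    finally have "P u x - 1 \<le> t * P \<psi> x + t * t" by simp
    moreover have "ln (P u x) \<le> P u x - 1" by (rule ln_le_minus_one[OF Pu_pos])
    ultimately show "ln (P u x) \<le> t * P \<psi> x + t * t" by linarith
  qed (rule int[OF lnPu])
  also have "\<dots> = t * ((\<integral>x. P \<psi> x \<partial>m) + t)"
    using int[OF P_continuous[OF \<psi>(1)]] prob_space by (simp add: distrib_left)
  finally have "(\<integral>x. \<psi> x \<partial>m) \<le> (\<integral>x. P \<psi> x \<partial>m) + t" using t(1) by (simp add: mult_le_cancel_left)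
  then show "(\<integral>x. \<psi> x \<partial>m) \<le> (\<integral>x. P \<psi> x \<partial>m) + e" using t(3) by linarith
qed

text \<open>Iterating the inequality \<open>\<integral> \<psi> dm \<le> \<integral> P \<psi> dm\<close> and letting the averages converge yields
\<open>\<integral> \<psi> dm \<le> \<integral> \<psi> d\<mu>\<close>; the same for \<open>1 - \<psi>\<close> gives equality.\<close>

theorem equilibrium_unique:
  assumes m: "invariant_measure m T" and eq: "ereal (ln \<kappa>) \<le> metric_entropy m T + ereal (\<integral>x. f x \<partial>m)"
  shows "m = \<mu>"
proof -
  interpret invariant_measure m T by (rule m)
  have le: "(\<integral>x. \<psi> x \<partial>m) \<le> (\<integral>x. \<psi> x \<partial>\<mu>)"
    if \<psi>: "continuous_on UNIV \<psi>" "\<And>x. 0 \<le> \<psi> x \<and> \<psi> x \<le> 1" for \<psi> :: "'a \<Rightarrow> real"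
  proof -
    have cont: "continuous_on UNIV ((P ^^ n) \<psi>)" for n
      by (rule transfer_iter_continuous[OF G_continuous \<psi>(1)])
    have bound: "0 \<le> (P ^^ n) \<psi> x \<and> (P ^^ n) \<psi> x \<le> 1" for n x
    proof (induction n arbitrary: x)
      case (Suc n)
      then show ?case
        by (auto intro!: transfer_normalized_ge transfer_normalized_le G_normalized)
    qed (use \<psi>(2) in simp)
    have iter: "(\<integral>x. \<psi> x \<partial>m) \<le> (\<integral>x. (P ^^ n) \<psi> x \<partial>m)" for n
    proof (induction n)
      case (Suc n)
      then show ?case using equilibrium_subharmonic[OF m eq cont bound, of n] by simp
    qed simp
    have "(\<lambda>n. \<integral>x. (P ^^ n) \<psi> x \<partial>m) \<longlonglongrightarrow> (\<integral>x. (\<integral>y. \<psi> y \<partial>\<mu>) \<partial>m)"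
    proof (rule integral_dominated_convergence[where w = "\<lambda>_. 1"])
      show "(P ^^ n) \<psi> \<in> borel_measurable m" for n by (rule measurable_continuous[OF cont sets_borel])
      show "AE x in m. norm ((P ^^ n) \<psi> x) \<le> 1" for n using bound by simp
      show "AE x in m. (\<lambda>n. (P ^^ n) \<psi> x) \<longlonglongrightarrow> (\<integral>y. \<psi> y \<partial>\<mu>)" using averages_tendsto[OF \<psi>(1)] by simp
    qed simp_all
    then have "(\<lambda>n. \<integral>x. (P ^^ n) \<psi> x \<partial>m) \<longlonglongrightarrow> (\<integral>y. \<psi> y \<partial>\<mu>)" using prob_space by simp
    then show ?thesis by (rule LIMSEQ_le_const) (use iter in blast)
  qed
  show ?thesis
  proof (rule finite_measure_eqI_continuous[OF finite_measure_axioms sets_borel mu.finite_measure_axioms mu_sets])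
    fix \<psi> :: "'a \<Rightarrow> real" assume \<psi>: "continuous_on UNIV \<psi>" "\<And>x. 0 \<le> \<psi> x \<and> \<psi> x \<le> 1"
    have "(\<integral>x. 1 - \<psi> x \<partial>m) \<le> (\<integral>x. 1 - \<psi> x \<partial>\<mu>)"
      by (rule le) (use \<psi> in \<open>auto intro!: continuous_intros\<close>)
    moreover have "integrable m \<psi>" "integrable \<mu> \<psi>"
      by (rule integrable_continuous[OF \<psi>(1) finite_measure_axioms sets_borel],
          rule integrable_continuous[OF \<psi>(1) mu.finite_measure_axioms mu_sets])
    ultimately have "(\<integral>x. \<psi> x \<partial>\<mu>) \<le> (\<integral>x. \<psi> x \<partial>m)"
      using prob_space mu.prob_space by simp
    then show "(\<integral>x. \<psi> x \<partial>m) = (\<integral>x. \<psi> x \<partial>\<mu>)" using le[OF \<psi>] by simp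
  qed
qed

definition cylinder :: "nat \<Rightarrow> 'a \<Rightarrow> 'a set" where
  "cylinder n x = {y. itinerary T code n y = itinerary T code n x}"

lemma cylinder_Suc: "cylinder (Suc n) x = {y. code y = code x \<and> T y \<in> cylinder n (T x)}"
  by (auto simp: cylinder_def itinerary_Suc)

lemma code_itinerary_finite_valued: "finite_valued \<mu> (itinerary T code n) (words UNIV n)"
  by (rule invariant_measure.itinerary_finite_valued[OF mu_invariant_measure]) (auto simp: code_cell)

lemma cylinder_borel: "cylinder n x \<in> sets borel"
proof -
  interpret I: finite_valued \<mu> "itinerary T code n" "words UNIV n" by (rule code_itinerary_finite_valued)
  have "cylinder n x = itinerary T code n -` {itinerary T code n x}" by (auto simp: cylinder_def)
  then show ?thesis using I.cells[OF I.range_values[of x]] by simp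
qed

lemma nu_cylinder:
  assumes bd: "\<And>y. y \<in> cylinder (Suc n) x \<Longrightarrow> a \<le> f y \<and> f y \<le> c"
  shows "exp a * measure \<nu> (cylinder n (T x)) \<le> \<kappa> * measure \<nu> (cylinder (Suc n) x)"
    and "\<kappa> * measure \<nu> (cylinder (Suc n) x) \<le> exp c * measure \<nu> (cylinder n (T x))"
proof -
  have "\<exists>i. \<forall>j. b j z \<in> cylinder (Suc n) x \<longleftrightarrow> j = i" if "z \<in> cylinder n (T x)" for z
    using that by (intro exI[of _ "code x"]) (auto simp: cylinder_Suc)
  moreover have "T y \<in> cylinder n (T x)" if "y \<in> cylinder (Suc n) x" for y
    using that by (simp add: cylinder_Suc)
  ultimately show "exp a * measure \<nu> (cylinder n (T x)) \<le> \<kappa> * measure \<nu> (cylinder (Suc n) x)"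
    and "\<kappa> * measure \<nu> (cylinder (Suc n) x) \<le> exp c * measure \<nu> (cylinder n (T x))"
    using nu_branch_bounds[OF cylinder_borel cylinder_borel _ _ bd] by blast+
qed

lemma nu_cylinder_pos: "0 < measure \<nu> (cylinder n x)"
proof (induction n arbitrary: x)
  case 0
  have "cylinder 0 x = space \<nu>" by (simp add: cylinder_def)
  then show ?case using nu.prob_space by simp
next
  case (Suc n)
  obtain B where "\<And>x. \<bar>f x\<bar> \<le> B" using continuous_bounded[OF f_continuous] by (metis real_norm_def)
  then have "exp (- B) * measure \<nu> (cylinder n (T x)) \<le> \<kappa> * measure \<nu> (cylinder (Suc n) x)"
    by (intro nu_cylinder(1)[where c = B]) (auto simp: abs_le_iff minus_le_iff)
  moreover have "0 < exp (- B) * measure \<nu> (cylinder n (T x))" using Suc by simp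
  ultimately have "0 < \<kappa> * measure \<nu> (cylinder (Suc n) x)" by linarith
  then show ?case using kappa_pos by (simp add: zero_less_mult_iff)
qed

text \<open>The partition into the two branches suffices. Its cylinders shrink uniformly, so along a cylinder the variation of \<open>f\<close>
is at most \<open>\<eta>\<close> in all but the last \<open>k\<close> steps, and by conformality \<open>- ln\<close> of its \<open>\<nu>\<close>-measure grows on average by at
least \<open>ln \<kappa> - \<integral> f d\<mu> - \<eta>\<close> per step.\<close>

theorem mu_entropy_ge: "ereal (ln \<kappa> - (\<integral>x. f x \<partial>\<mu>)) \<le> metric_entropy \<mu> T"
proof -
  interpret I: invariant_measure \<mu> T by (rule mu_invariant_measure)
  interpret F: finite_valued \<mu> "itinerary T code n" "words UNIV n" for n by (rule code_itinerary_finite_valued)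
  define Q where "Q = range (\<lambda>i. code -` {i})"
  have Q: "Q \<in> finite_partitions \<mu>"
  proof -
    have "{} \<notin> Q"
    proof
      assume "{} \<in> Q"
      then obtain i where i: "{} = code -` {i}" unfolding Q_def by (rule rangeE)
      have "b i undefined \<in> code -` {i}" by simp
      then show False unfolding i[symmetric] by simp
    qed
    moreover have "\<Union>Q = UNIV" by (auto simp: Q_def)
    moreover have "disjoint Q" unfolding disjoint_def Q_def by fastforce
    ultimately have "partition_on UNIV Q" by (simp add: partition_on_def)
    moreover have "Q \<subseteq> sets \<mu>" using code_cell by (auto simp: Q_def)
    ultimately show ?thesis by (auto simp: finite_partitions_def Q_def)
  qed
  obtain p where p: "\<And>x. p x \<in> Q" "\<And>x A. A \<in> Q \<Longrightarrow> p x = A \<longleftrightarrow> x \<in> A" "\<And>c. c \<in> Q \<Longrightarrow> p -` {c} \<in> sets \<mu>"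
    and lim: "(\<lambda>n. shannon \<mu> (itinerary T p n) (words Q n) / real n) \<longlonglongrightarrow> entropy_of_partition \<mu> T Q"
    by (rule I.entropy_of_partition_limit[OF Q]) blast
  have finQ: "finite Q" by (simp add: Q_def)
  have p_code: "p x = code -` {code x}" for x using p(2)[of "code -` {code x}" x] by (auto simp: Q_def)
  have p_eq: "p x = p y \<longleftrightarrow> code x = code y" for x y
    using p(2)[of "p y" x] p(1)[of y] p_code[of y] by auto
  have cyl: "itinerary T p n -` {itinerary T p n x} = cylinder n x" for n x
    by (auto simp: cylinder_def itinerary_eq_iff p_eq)
  define H where "H n = shannon \<mu> (itinerary T p n) (words Q n)" for n
  have H: "H n = (\<integral>x. - ln (measure \<mu> (cylinder n x)) \<partial>\<mu>)" and
    iH: "integrable \<mu> (\<lambda>x. - ln (measure \<mu> (cylinder n x)))" for n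
  proof -
    interpret J: finite_valued \<mu> "itinerary T p n" "words Q n"
      by (rule I.itinerary_finite_valued[OF finQ p(1,3)])
    show "H n = (\<integral>x. - ln (measure \<mu> (cylinder n x)) \<partial>\<mu>)"
      unfolding H_def J.shannon_integral cyl ..
    show "integrable \<mu> (\<lambda>x. - ln (measure \<mu> (cylinder n x)))"
      using J.integral_finite_valued(1)[of "\<lambda>w. - ln (measure \<mu> (itinerary T p n -` {w}))"] by (simp only: cyl)
  qed
  define E where "E n = (\<integral>x. - ln (measure \<nu> (cylinder n x)) \<partial>\<mu>)" for n
  have iE: "integrable \<mu> (\<lambda>x. - ln (measure \<nu> (cylinder n x)))" for n
  proof -
    have "cylinder n x = itinerary T code n -` {itinerary T code n x}" for x by (auto simp: cylinder_def)
    then show ?thesis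
      using F.integral_finite_valued(1)[of "\<lambda>w. - ln (measure \<nu> (itinerary T code n -` {w}))" n] by (simp only:)
  qed
  obtain M where M: "0 < M" "\<And>A. A \<in> sets borel \<Longrightarrow> measure \<mu> A \<le> M * measure \<nu> A"
    "\<And>A. A \<in> sets borel \<Longrightarrow> measure \<nu> A \<le> M * measure \<mu> A"
    by (rule mu_le_nu) blast
  have H_ge: "E n - ln M \<le> H n" for n
  proof -
    have pt: "- ln (measure \<nu> (cylinder n x)) - ln M \<le> - ln (measure \<mu> (cylinder n x))" for x
    proof -
      have pos: "0 < measure \<mu> (cylinder n x)"
        using M(3)[OF cylinder_borel, of n x] nu_cylinder_pos[of n x] M(1)
        by (smt (verit) zero_less_mult_iff)
      have "ln (measure \<mu> (cylinder n x)) \<le> ln (M * measure \<nu> (cylinder n x))"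
        using pos M(2)[OF cylinder_borel] by (intro ln_mono) auto
      then show ?thesis using M(1) nu_cylinder_pos[of n x] by (simp add: ln_mult)
    qed
    have "E n - ln M = (\<integral>x. - ln (measure \<nu> (cylinder n x)) - ln M \<partial>\<mu>)"
      unfolding E_def using iE[of n] mu.prob_space by simp
    also have "\<dots> \<le> H n"
      unfolding H by (rule integral_mono[OF _ iH pt]) (use iE[of n] in simp)
    finally show ?thesis .
  qed
  let ?F = "\<integral>x. f x \<partial>\<mu>"
  have fi: "integrable \<mu> f" by (rule integrable_continuous[OF f_continuous mu.finite_measure_axioms mu_sets])
  have "ln \<kappa> - ?F \<le> entropy_of_partition \<mu> T Q + \<eta>" if \<eta>: "0 < \<eta>" for \<eta>
  proof -
    obtain d where d: "0 < d" "\<And>x y. dist x y < d \<Longrightarrow> dist (f x) (f y) < \<eta>"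
      using uniformly_continuous[OF f_continuous \<eta>] by blast
    obtain k where k: "\<And>x y. (\<forall>j<k. code ((T ^^ j) x) = code ((T ^^ j) y)) \<Longrightarrow> dist x y < d"
      using code_separates[OF d(1)] by blast
    let ?c = "ln \<kappa> - ?F - \<eta>"
    have step: "E n + ?c \<le> E (Suc n)" if n: "k \<le> n" for n
    proof -
      note JT = I.integral_T[OF iE[of n]]
      have pt: "- ln (measure \<nu> (cylinder n (T x))) + (ln \<kappa> - f x - \<eta>) \<le> - ln (measure \<nu> (cylinder (Suc n) x))" for x
      proof -
        have "f x - \<eta> \<le> f y \<and> f y \<le> f x + \<eta>" if "y \<in> cylinder (Suc n) x" for y
        proof -
          have "dist y x < d"
            using that by (intro codes_agree[OF k le_SucI[OF n]]) (auto simp: cylinder_def)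
          then have "dist (f y) (f x) < \<eta>" by (rule d(2))
          then show ?thesis by (auto simp: dist_real_def abs_less_iff)
        qed
        then have "\<kappa> * measure \<nu> (cylinder (Suc n) x) \<le> exp (f x + \<eta>) * measure \<nu> (cylinder n (T x))"
          by (rule nu_cylinder(2))
        then have "ln (\<kappa> * measure \<nu> (cylinder (Suc n) x)) \<le> ln (exp (f x + \<eta>) * measure \<nu> (cylinder n (T x)))"
          using kappa_pos nu_cylinder_pos by (intro ln_mono) auto
        then show ?thesis
          using kappa_pos nu_cylinder_pos[of "Suc n" x] nu_cylinder_pos[of n "T x"] by (simp add: ln_mult)
      qed
      have "E n + ?c = (\<integral>x. - ln (measure \<nu> (cylinder n (T x))) + (ln \<kappa> - f x - \<eta>) \<partial>\<mu>)"
        using JT fi mu.prob_space unfolding E_def by simp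
      also have "\<dots> \<le> E (Suc n)"
        unfolding E_def by (rule integral_mono[OF _ iE pt]) (use JT(1) fi in auto)
      finally show ?thesis .
    qed
    have "- entropy_of_partition \<mu> T Q \<le> - ?c"
    proof (rule limit_le_increment[where k = k and a = "\<lambda>n. ln M - E n" and H = "\<lambda>n. - H n"])
      show "(\<lambda>n. - H n / real n) \<longlonglongrightarrow> - entropy_of_partition \<mu> T Q"
        using tendsto_minus[OF lim] by (simp add: H_def)
      show "- H n \<le> ln M - E n" for n using H_ge[of n] by linarith
      show "ln M - E (Suc n) \<le> ln M - E n + - ?c" if "k \<le> n" for n using step[OF that] by linarith
    qed
    then show ?thesis by simp
  qed
  then have "ln \<kappa> - ?F \<le> entropy_of_partition \<mu> T Q" by (rule field_le_epsilon)
  then have "ereal (ln \<kappa> - ?F) \<le> ereal (entropy_of_partition \<mu> T Q)" by simp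
  also have "\<dots> \<le> metric_entropy \<mu> T" unfolding metric_entropy_def by (rule SUP_upper[OF Q])
  finally show ?thesis .
qed

theorem mu_equilibrium: "metric_entropy \<mu> T + ereal (\<integral>x. f x \<partial>\<mu>) = ereal (ln \<kappa>)"
proof (rule antisym[OF free_energy_le[OF mu_invariant_measure]])
  have "ereal (ln \<kappa>) = ereal (ln \<kappa> - (\<integral>x. f x \<partial>\<mu>)) + ereal (\<integral>x. f x \<partial>\<mu>)" by simp
  also have "\<dots> \<le> metric_entropy \<mu> T + ereal (\<integral>x. f x \<partial>\<mu>)" by (intro add_mono mu_entropy_ge order_refl)
  finally show "ereal (ln \<kappa>) \<le> metric_entropy \<mu> T + ereal (\<integral>x. f x \<partial>\<mu>)" .
qed

theorem pressure_eq: "pressure T f = ereal (ln \<kappa>)"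
proof (rule antisym)
  show "pressure T f \<le> ereal (ln \<kappa>)"
    unfolding pressure_def by (intro SUP_least free_energy_le) (simp add: invariant_measure_iff)
  show "ereal (ln \<kappa>) \<le> pressure T f"
    unfolding pressure_def mu_equilibrium[symmetric] by (rule SUP_upper[OF mu_invariant])
qed

end

section \<open>The moduli with logarithmic factor\<close>

lemma log_modulus_0 [simp]: "log_modulus \<alpha> \<beta> x0 0 = 0"
  by (simp add: log_modulus_def)

lemma log_modulus_mono:
  "admissible_cutoff \<alpha> \<beta> x0 \<Longrightarrow> 0 \<le> d \<Longrightarrow> d \<le> e \<Longrightarrow> log_modulus \<alpha> \<beta> x0 d \<le> log_modulus \<alpha> \<beta> x0 e"
  by (auto simp: admissible_cutoff_def mono_on_def)

lemma log_modulus_nonneg: "0 \<le> log_modulus \<alpha> \<beta> x0 d"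
  by (simp add: log_modulus_def)

lemma log_modulus_pos: "admissible_cutoff \<alpha> \<beta> x0 \<Longrightarrow> 0 < d \<Longrightarrow> 0 < log_modulus \<alpha> \<beta> x0 d"
  by (auto simp: log_modulus_def admissible_cutoff_def)

lemma log_factor_mono:
  fixes d e \<beta> :: real
  assumes "0 \<le> \<beta>" "0 < d" "d \<le> e" "e < 1"
  shows "(- ln d) powr (- \<beta>) \<le> (- ln e) powr (- \<beta>)"
proof -
  have "ln d \<le> ln e" "ln e < 0" using assms by (auto simp: ln_less_zero)
  then show ?thesis using assms by (intro powr_mono2') auto
qed

lemma log_modulus_small:
  assumes "0 < \<alpha>" "0 \<le> \<beta>" and adm: "admissible_cutoff \<alpha> \<beta> x0" and e: "0 < e"
  shows "\<exists>\<delta>>0. \<forall>d. 0 \<le> d \<and> d < \<delta> \<longrightarrow> log_modulus \<alpha> \<beta> x0 d < e"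
proof -
  have x0: "0 < x0" "x0 < 1" using adm by (auto simp: admissible_cutoff_def)
  define C where "C = (- ln x0) powr (- \<beta>)"
  have C: "0 < C" using x0 by (simp add: C_def ln_less_zero less_imp_neq)
  define \<delta> where "\<delta> = min x0 ((e / C) powr (1 / \<alpha>))"
  have "0 < \<delta>" using x0 e C by (simp add: \<delta>_def)
  moreover have "log_modulus \<alpha> \<beta> x0 d < e" if d: "0 \<le> d" "d < \<delta>" for d
  proof (cases "d = 0")
    case True
    then show ?thesis using e by simp
  next
    case False
    then have d0: "0 < d" using d by simp
    have "log_modulus \<alpha> \<beta> x0 d = d powr \<alpha> * (- ln d) powr (- \<beta>)"
      using d d0 by (simp add: log_modulus_def \<delta>_def)
    also have "\<dots> \<le> d powr \<alpha> * C"
      unfolding C_def using d d0 x0 assms by (intro mult_left_mono log_factor_mono) (auto simp: \<delta>_def)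
    also have "\<dots> < e"
    proof -
      have "d powr \<alpha> < ((e / C) powr (1 / \<alpha>)) powr \<alpha>"
        using d d0 assms by (intro powr_less_mono2) (auto simp: \<delta>_def)
      also have "\<dots> = e / C" using assms e C by (simp add: powr_powr)
      finally show ?thesis using C by (simp add: field_simps)
    qed
    finally show ?thesis .
  qed
  ultimately show ?thesis by blast
qed

text \<open>By concavity, the modulus lies above its chord from 0 to the cutoff.\<close>

lemma le_log_modulus:
  assumes adm: "admissible_cutoff \<gamma> \<beta> x1" and d: "0 \<le> d" "d \<le> 1"
  shows "d \<le> log_modulus \<gamma> \<beta> x1 d / log_modulus \<gamma> \<beta> x1 x1"
proof -
  let ?\<Omega> = "log_modulus \<gamma> \<beta> x1"
  have x1: "0 < x1" "x1 < 1" and conc: "concave_on {0..} ?\<Omega>"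
    using adm by (auto simp: admissible_cutoff_def)
  have pos: "0 < ?\<Omega> x1" by (rule log_modulus_pos[OF adm x1(1)])
  show ?thesis
  proof (cases "d \<le> x1")
    case True
    have "(1 - d / x1) * ?\<Omega> 0 + d / x1 * ?\<Omega> x1 \<le> ?\<Omega> ((1 - d / x1) *\<^sub>R 0 + (d / x1) *\<^sub>R x1)"
      using True d x1 by (intro concave_onD[OF conc]) auto
    then have "d / x1 \<le> ?\<Omega> d / ?\<Omega> x1" using x1 pos by (simp add: field_simps)
    moreover have "d \<le> d / x1" using x1 d by (simp add: field_simps mult_left_le)
    ultimately show ?thesis by linarith
  next
    case False
    then have "?\<Omega> d = ?\<Omega> x1" using x1 by (simp add: log_modulus_def)
    then show ?thesis using d pos by simp
  qed
qed

lemma powr_one_plus_ge: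
  fixes u \<gamma> :: real
  assumes "0 \<le> u" "u \<le> 1" "0 < \<gamma>"
  shows "1 + \<gamma> * u / 2 \<le> (1 + u) powr \<gamma>"
proof -
  have "u / 2 \<le> u / (1 + u)" using assms by (intro divide_left_mono) auto
  also have "u / (1 + u) = - (1 / (1 + u) - 1)" using assms by (simp add: field_simps)
  also have "\<dots> \<le> - ln (1 / (1 + u))" using ln_le_minus_one[of "1 / (1 + u)"] assms by simp
  also have "\<dots> = ln (1 + u)" using assms by (simp add: ln_div)
  finally have "\<gamma> * (u / 2) \<le> \<gamma> * ln (1 + u)" using assms by (intro mult_left_mono) auto
  moreover have "1 + \<gamma> * ln (1 + u) \<le> exp (\<gamma> * ln (1 + u))" by (rule exp_ge_add_one_self)
  ultimately have "1 + \<gamma> * (u / 2) \<le> exp (\<gamma> * ln (1 + u))" by linarith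
  then show ?thesis using assms by (simp add: powr_def)
qed

text \<open>Below the cutoffs, \<open>e = d (1 + u)\<close> with \<open>u = d\<^sup>s/4\<close>, and the power \<open>\<alpha> - s\<close> gains the factor
\<open>1 + (\<alpha> - s) u / 2\<close>; the gain \<open>d\<^bsup>\<alpha>-s\<^esup> \<cdot> u\<close> is a multiple of \<open>d\<^sup>\<alpha>\<close>, and the logarithmic factor only increases with
\<open>d\<close>. Above the cutoffs the moduli are constant; there the linear term provides the increase.\<close>

lemma log_modulus_telescopes:
  assumes s: "0 < s" "s < \<alpha>" "\<alpha> < 1" and \<beta>: "0 \<le> \<beta>"
    and adm0: "admissible_cutoff \<alpha> \<beta> x0" and adm1: "admissible_cutoff (\<alpha> - s) \<beta> x1"
  obtains C where "0 < C" "\<And>d e. 0 \<le> d \<Longrightarrow> stretch s d \<le> e \<Longrightarrow>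
    log_modulus \<alpha> \<beta> x0 d + C * (log_modulus (\<alpha> - s) \<beta> x1 d + d) \<le> C * (log_modulus (\<alpha> - s) \<beta> x1 e + e)"
proof -
  let ?\<omega> = "log_modulus \<alpha> \<beta> x0" and ?\<Omega> = "log_modulus (\<alpha> - s) \<beta> x1"
  define \<gamma> where "\<gamma> = \<alpha> - s"
  have \<gamma>: "0 < \<gamma>" using s by (simp add: \<gamma>_def)
  have x0: "0 < x0" "x0 < 1" and x1: "0 < x1" "x1 < 1" using adm0 adm1 by (auto simp: admissible_cutoff_def)
  \<comment> \<open>below \<open>d0\<close> also \<open>stretch s d \<le> 2 d\<close> stays below the cutoff \<open>x1\<close>\<close>
  define d0 where "d0 = min x0 (x1 / 2)"
  have d0: "0 < d0" "d0 \<le> x0" "d0 \<le> x1 / 2" using x0 x1 by (auto simp: d0_def)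
  define c1 where "c1 = d0 powr (s + 1) / 4"
  have c1: "0 < c1" using d0 by (simp add: c1_def)
  define C where "C = max (8 / \<gamma>) (?\<omega> x0 / c1)"
  have C: "0 < C" "8 / \<gamma> \<le> C" "?\<omega> x0 / c1 \<le> C" using \<gamma> by (auto simp: C_def less_max_iff_disj)
  have main: "?\<omega> d \<le> C * ((?\<Omega> e + e) - (?\<Omega> d + d))" if d: "0 \<le> d" and e: "e = stretch s d" for d e
  proof (cases "d = 0")
    case True
    then show ?thesis using e by (simp add: stretch_def)
  next
    case False
    then have dpos: "0 < d" using d by simp
    have de: "d \<le> e" using le_stretch e by simp
    show ?thesis
    proof (cases "d < d0")
      case True
      have ds: "d powr s \<le> 1" using True d0 x0 dpos s by (intro powr_le1) auto
      define u where "u = d powr s / 4"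
      have u: "0 \<le> u" "u \<le> 1" using ds by (auto simp: u_def)
      have e_eq: "e = d * (1 + u)" using dpos by (simp add: e stretch_def u_def powr_add algebra_simps)
      also have "\<dots> \<le> d * 2" using u dpos by (intro mult_left_mono) auto
      finally have ex1: "e < x1" using True d0 by simp
      let ?l = "(- ln d) powr (- \<beta>)"
      have "?\<omega> d = d powr \<alpha> * ?l" using True d0 dpos by (simp add: log_modulus_def)
      also have "d powr \<alpha> = d powr \<gamma> * d powr s" by (simp add: \<gamma>_def powr_add[symmetric])
      finally have w: "?\<omega> d = d powr \<gamma> * d powr s * ?l" .
      have "?\<Omega> d = d powr \<gamma> * ?l" using dpos ex1 de by (simp add: log_modulus_def \<gamma>_def)
      moreover have "d powr \<gamma> * (1 + \<gamma> * u / 2) * ?l \<le> ?\<Omega> e"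
      proof -
        have "d powr \<gamma> * (1 + \<gamma> * u / 2) \<le> d powr \<gamma> * (1 + u) powr \<gamma>"
          using powr_one_plus_ge[OF u \<gamma>] by (intro mult_left_mono) auto
        also have "\<dots> = e powr \<gamma>" using dpos u by (simp add: e_eq powr_mult)
        finally have "d powr \<gamma> * (1 + \<gamma> * u / 2) * ?l \<le> e powr \<gamma> * (- ln e) powr (- \<beta>)"
          using dpos de ex1 x1 \<beta> u \<gamma> by (intro mult_mono log_factor_mono) auto
        also have "\<dots> = ?\<Omega> e" using dpos de ex1 by (simp add: log_modulus_def \<gamma>_def)
        finally show ?thesis .
      qed
      ultimately have "(\<gamma> / 8) * ?\<omega> d \<le> ?\<Omega> e - ?\<Omega> d"
        unfolding w by (simp add: u_def algebra_simps)
      then have g: "(\<gamma> / 8) * ?\<omega> d \<le> (?\<Omega> e + e) - (?\<Omega> d + d)" using de by simp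
      have "?\<omega> d = (8 / \<gamma>) * ((\<gamma> / 8) * ?\<omega> d)" using \<gamma> by simp
      also have "\<dots> \<le> C * ((?\<Omega> e + e) - (?\<Omega> d + d))"
        using C g \<gamma> log_modulus_nonneg[of \<alpha> \<beta> x0 d] by (intro mult_mono) auto
      finally show ?thesis .
    next
      case False
      have "?\<omega> d \<le> ?\<omega> x0"
      proof (cases "d \<le> x0")
        case True
        then show ?thesis by (rule log_modulus_mono[OF adm0 d])
      next
        case False
        then show ?thesis using x0 by (simp add: log_modulus_def)
      qed
      also have "\<dots> = (?\<omega> x0 / c1) * c1" using c1 by simp
      also have "\<dots> \<le> C * ((?\<Omega> e + e) - (?\<Omega> d + d))"
      proof (rule mult_mono)
        have "c1 \<le> e - d"
          using False d0 s unfolding e stretch_def c1_def by (simp add: powr_mono2)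
        moreover have "?\<Omega> d \<le> ?\<Omega> e" by (rule log_modulus_mono[OF adm1 d de])
        ultimately show "c1 \<le> (?\<Omega> e + e) - (?\<Omega> d + d)" by simp
      qed (use C c1 in auto)
      finally show ?thesis .
    qed
  qed
  have "?\<omega> d + C * (?\<Omega> d + d) \<le> C * (?\<Omega> e + e)" if d: "0 \<le> d" and e: "stretch s d \<le> e" for d e
  proof -
    have "0 \<le> stretch s d" using d le_stretch[of d s] by linarith
    then have "?\<Omega> (stretch s d) + stretch s d \<le> ?\<Omega> e + e"
      by (intro add_mono log_modulus_mono[OF adm1] e)
    then have "C * (?\<Omega> (stretch s d) + stretch s d) \<le> C * (?\<Omega> e + e)"
      using C(1) by (intro mult_left_mono) auto
    then show ?thesis using main[OF d refl] by (simp add: right_diff_distrib)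
  qed
  then show thesis using that C(1) by blast
qed

lemma manneville_pomeau_double_cover:
  assumes s: "0 < s" "s < 1"
  shows "double_cover (manneville_pomeau s) (mp_branch s) (mp_code s) s"
proof
  show "dist x y \<le> 1" for x y :: circle
    using dist_circle_le_half[of x y] by linarith
qed (fact s(1) compact_circle continuous_manneville_pomeau[OF s] mp_branch_section[OF s] mp_code_branch[OF s]
  mp_branch_code[OF s] mp_branch_pairing[OF s] mp_branches_apart[OF s] mp_branch_measurable[OF s]
  mp_code_measurable[OF s] mp_code_separates[OF s] circle_weakly_compact circle_inner_closed)+

theorem corollary4:
  fixes s \<alpha> \<beta> x0 x1 :: real and f :: "circle \<Rightarrow> real"
  defines "T \<equiv> manneville_pomeau s"
  assumes "0 < s" and "s < 1" and "s < \<alpha>" and "\<alpha> < 1" and "0 \<le> \<beta>"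
    and "admissible_cutoff \<alpha> \<beta> x0" and "admissible_cutoff (\<alpha> - s) \<beta> x1"
    and "f \<in> modulus_space (log_modulus \<alpha> \<beta> x0)"
  shows "\<exists>(\<nu> :: circle measure) (\<kappa> :: real) (h :: circle \<Rightarrow> real).
      prob_space \<nu> \<and> sets \<nu> = sets borel \<and> 0 < \<kappa> \<and>
      is_dual_transfer T f \<nu> (scale_measure (ennreal \<kappa>) \<nu>) \<and>
      simple_eigenvalue_on (continuous_functions :: (circle \<Rightarrow> complex) set)
        (transfer_operator T f) (complex_of_real \<kappa>) \<and>
      h \<in> modulus_space (log_modulus (\<alpha> - s) \<beta> x1) \<and> (\<forall>x. 0 < h x) \<and>
      transfer_operator T f h = (\<lambda>x. \<kappa> * h x) \<and>
      (\<forall>c::complex. c \<noteq> complex_of_real \<kappa> \<and> \<kappa> \<le> cmod c \<longrightarrow>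
        \<not> eigenvalue_on (continuous_functions :: (circle \<Rightarrow> complex) set)
            (transfer_operator T f) c) \<and>
      (\<integral>x. h x \<partial>\<nu>) = 1 \<and>
      (\<forall>\<phi> \<in> (continuous_functions :: (circle \<Rightarrow> real) set).
        uniform_limit UNIV (\<lambda>n x. (transfer_operator T f ^^ n) \<phi> x / \<kappa> ^ n)
          (\<lambda>x. h x * (\<integral>y. \<phi> y \<partial>\<nu>)) sequentially) \<and>
      (let \<mu> = density \<nu> (\<lambda>x. ennreal (h x)) in
        \<mu> \<in> invariant_measures T \<and>
        metric_entropy \<mu> T + ereal (\<integral>x. f x \<partial>\<mu>) = ereal (ln \<kappa>) \<and>
        ereal (ln \<kappa>) = pressure T f \<and>
        (\<forall>m \<in> invariant_measures T. m \<noteq> \<mu> \<longrightarrow>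
          metric_entropy m T + ereal (\<integral>x. f x \<partial>m) < pressure T f) \<and>
        (\<exists>r0>0. \<forall>r. 0 < r \<and> r < r0 \<longrightarrow>
          (\<exists>K>0. \<forall>x. \<forall>n\<ge>1.
            let q = measure \<mu> (bowen_ball T n r x) /
                    exp (birkhoff_sum T f n x - real n * real_of_ereal (pressure T f))
            in 1 / K \<le> q \<and> q \<le> K)))"
proof -
  let ?\<omega> = "log_modulus \<alpha> \<beta> x0" and ?\<Omega> = "log_modulus (\<alpha> - s) \<beta> x1"
  interpret double_cover T "mp_branch s" "mp_code s" s
    unfolding T_def by (rule manneville_pomeau_double_cover) fact+
  have \<gamma>: "0 < \<alpha> - s" and \<alpha>: "0 < \<alpha>" using assms by auto
  note adm0 = \<open>admissible_cutoff \<alpha> \<beta> x0\<close> and adm1 = \<open>admissible_cutoff (\<alpha> - s) \<beta> x1\<close>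
  obtain Cf where Cf: "0 < Cf" "\<And>x y. \<bar>f x - f y\<bar> \<le> Cf * ?\<omega> (dist x y)"
    using \<open>f \<in> _\<close> by (auto simp: modulus_space_def)
  obtain C where C: "0 < C" "\<And>d e. 0 \<le> d \<Longrightarrow> stretch s d \<le> e \<Longrightarrow>
      ?\<omega> d + C * (?\<Omega> d + d) \<le> C * (?\<Omega> e + e)"
    by (rule log_modulus_telescopes[of s \<alpha> \<beta> x0 x1]) (use assms in auto)
  define A where "A = Cf * C"
  have A: "0 < A" using Cf C by (simp add: A_def)
  define W where "W d = A * (?\<Omega> d + d)" for d
  interpret cover_potential T "mp_branch s" "mp_code s" s f "\<lambda>d. Cf * ?\<omega> d" W
  proof
    show "\<bar>f x - f y\<bar> \<le> Cf * ?\<omega> (dist x y)" for x y by (rule Cf(2))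
    show "continuous_on UNIV f"
    proof (rule continuous_onI)
      fix x :: circle and e :: real assume "0 < e"
      then obtain \<delta> where \<delta>: "0 < \<delta>" "\<And>d. 0 \<le> d \<Longrightarrow> d < \<delta> \<Longrightarrow> ?\<omega> d < e / Cf"
        using log_modulus_small[OF \<alpha> \<open>0 \<le> \<beta>\<close> adm0, of "e / Cf"] Cf(1) by auto
      have "dist (f y) (f x) \<le> e" if "dist y x < \<delta>" for y
        using Cf(2)[of y x] \<delta>(2)[of "dist y x"] that Cf(1) by (simp add: dist_real_def field_simps)
      then show "\<exists>d>0. \<forall>y\<in>UNIV. dist y x < d \<longrightarrow> dist (f y) (f x) \<le> e" using \<delta>(1) by blast
    qed
    show "Cf * ?\<omega> d \<le> Cf * ?\<omega> e" if "0 \<le> d" "d \<le> e" for d e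
      using Cf(1) that by (intro mult_left_mono log_modulus_mono[OF adm0]) auto
    show "0 \<le> W d" if "0 \<le> d" for d
      using A that log_modulus_nonneg[of "\<alpha> - s" \<beta> x1 d] by (simp add: W_def)
    show "W d \<le> W e" if "0 \<le> d" "d \<le> e" for d e
      unfolding W_def using A that by (intro mult_left_mono add_mono log_modulus_mono[OF adm1]) auto
    show "\<exists>\<delta>>0. \<forall>d. 0 \<le> d \<and> d < \<delta> \<longrightarrow> W d < e" if e: "0 < e" for e
    proof -
      obtain \<delta> where \<delta>: "0 < \<delta>" "\<And>d. 0 \<le> d \<Longrightarrow> d < \<delta> \<Longrightarrow> ?\<Omega> d < e / (2 * A)"
        using log_modulus_small[OF \<gamma> \<open>0 \<le> \<beta>\<close> adm1, of "e / (2 * A)"] A e by auto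
      have "W d < e" if "0 \<le> d" "d < min \<delta> (e / (2 * A))" for d
      proof -
        have "?\<Omega> d + d < e / (2 * A) + e / (2 * A)" using \<delta>(2)[of d] that by simp
        then have "A * (?\<Omega> d + d) < A * (e / (2 * A) + e / (2 * A))" using A by (intro mult_strict_left_mono)
        then show ?thesis using A by (simp add: W_def)
      qed
      then show ?thesis using \<delta>(1) A e by (intro exI[of _ "min \<delta> (e / (2 * A))"]) auto
    qed
    show "Cf * ?\<omega> d + W d \<le> W e" if "0 \<le> d" "stretch s d \<le> e" for d e
      using mult_left_mono[OF C(2)[OF that], of Cf] Cf(1) by (simp add: W_def A_def distrib_left mult.assoc)
  qed
  obtain \<kappa> g where g: "0 < \<kappa>" "\<And>x. 0 < g x" "log_regular 0 2 g" "L g = (\<lambda>x. \<kappa> * g x)"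
    by (rule ex_eigenfunction) blast
  interpret cover_eigenfunction T "mp_branch s" "mp_code s" s f "\<lambda>d. Cf * ?\<omega> d" W \<kappa> g
    by unfold_locales (use g in auto)
  obtain \<mu> where \<mu>: "prob_space \<mu>" "sets \<mu> = sets borel"
    "\<And>\<phi>. continuous_on UNIV \<phi> \<Longrightarrow> uniform_limit UNIV (\<lambda>n. (P ^^ n) \<phi>) (\<lambda>_. \<integral>x. \<phi> x \<partial>\<mu>) sequentially"
    by (rule ex_stationary_measure) blast
  interpret E: cover_equilibrium T "mp_branch s" "mp_code s" s f "\<lambda>d. Cf * ?\<omega> d" W \<kappa> g \<mu>
    by (intro cover_equilibrium.intro cover_equilibrium_axioms.intro cover_eigenfunction_axioms \<mu>)
  have normalized_h: "E.normalized_h x = E.inverse_h_mean * g x" for x by (rule E.normalized_h_def)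
  have normalized_h_regular: "log_regular 0 2 E.normalized_h"
    using log_regular_scale[OF less_imp_le[OF E.inverse_h_mean_pos] g(3)] by (simp add: normalized_h[abs_def])
  have normalized_h_modulus: "E.normalized_h \<in> modulus_space ?\<Omega>"
  proof -
    obtain M where M: "0 < M" "\<And>x. E.normalized_h x \<le> M" by (rule E.normalized_h_bounds) blast
    define B where "B = M * exp (W 1) * (A * (1 + 1 / ?\<Omega> x1))"
    have x1: "0 < x1" using adm1 by (simp add: admissible_cutoff_def)
    have pos: "0 < ?\<Omega> x1" by (rule log_modulus_pos[OF adm1 x1])
    have B: "0 < B" using M(1) A pos by (simp add: B_def add_pos_pos)
    have one: "E.normalized_h x - E.normalized_h y \<le> B * ?\<Omega> (dist x y)" for x y
    proof -
      let ?d = "dist x y"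
      have W0: "0 \<le> W ?d" and W1: "W ?d \<le> W 1" using dist_le_1[of x y] by (auto intro: W_nonneg W_mono)
      have "exp (W ?d) - 1 \<le> W ?d * exp (W ?d)"
        using exp_ge_add_one_self[of "- W ?d"] by (simp add: exp_minus field_simps)
      also have "\<dots> \<le> W ?d * exp (W 1)" using W0 W1 by (intro mult_left_mono) auto
      finally have ex: "exp (W ?d) - 1 \<le> W ?d * exp (W 1)" .
      have "W ?d \<le> A * (1 + 1 / ?\<Omega> x1) * ?\<Omega> ?d"
      proof -
        have "?\<Omega> ?d + ?d \<le> ?\<Omega> ?d + ?\<Omega> ?d / ?\<Omega> x1"
          using le_log_modulus[OF adm1, of ?d] dist_le_1[of x y] by simp
        then have "A * (?\<Omega> ?d + ?d) \<le> A * (?\<Omega> ?d + ?\<Omega> ?d / ?\<Omega> x1)" using A by (intro mult_left_mono) auto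
        then show ?thesis by (simp add: W_def algebra_simps)
      qed
      then have "exp (W 1) * W ?d \<le> exp (W 1) * (A * (1 + 1 / ?\<Omega> x1) * ?\<Omega> ?d)"
        by (intro mult_left_mono) auto
      then have ex': "exp (W ?d) - 1 \<le> exp (W 1) * (A * (1 + 1 / ?\<Omega> x1) * ?\<Omega> ?d)"
        using ex by (simp only: mult.commute[of "exp (W 1)"])
      have "E.normalized_h x - E.normalized_h y \<le> E.normalized_h y * (exp (W ?d) - 1)"
        using log_regular_global(1)[OF normalized_h_regular, of x y] by (simp add: algebra_simps)
      also have "\<dots> \<le> M * (exp (W ?d) - 1)"
        using M(2)[of y] W0 by (intro mult_right_mono) auto
      also have "\<dots> \<le> M * (exp (W 1) * (A * (1 + 1 / ?\<Omega> x1) * ?\<Omega> ?d))"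
        using M(1) ex' by (intro mult_left_mono) auto
      finally show ?thesis by (simp add: B_def mult.assoc)
    qed
    have "\<bar>E.normalized_h x - E.normalized_h y\<bar> \<le> B * ?\<Omega> (dist x y)" for x y
      using one[of x y] one[of y x] by (simp add: dist_commute abs_le_iff)
    then show ?thesis using B by (auto simp: modulus_space_def)
  qed
  have normalized_h_eigen: "transfer_operator T f E.normalized_h = (\<lambda>x. \<kappa> * E.normalized_h x)"
    using transfer_iter_scale[of 1 f E.inverse_h_mean g] by (simp add: normalized_h[abs_def] g(4) mult.left_commute)
  have strict: "metric_entropy m T + ereal (\<integral>x. f x \<partial>m) < ereal (ln \<kappa>)"
    if "m \<in> invariant_measures T" "m \<noteq> \<mu>" for m
    using E.equilibrium_unique[of m] that by (force simp: invariant_measure_iff not_less)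
  show ?thesis
  proof (intro exI[of _ E.\<nu>] exI[of _ \<kappa>] exI[of _ E.normalized_h] conjI)
    show "prob_space E.\<nu>" by (rule E.nu_prob)
    show "sets E.\<nu> = sets borel" by (rule E.nu_sets)
    show "0 < \<kappa>" by (rule g(1))
    show "is_dual_transfer T f E.\<nu> (scale_measure (ennreal \<kappa>) E.\<nu>)" by (rule E.nu_dual)
    show "simple_eigenvalue_on (continuous_functions :: (circle \<Rightarrow> complex) set)
        (transfer_operator T f) (complex_of_real \<kappa>)" by (rule E.kappa_simple)
    show "E.normalized_h \<in> modulus_space ?\<Omega>" by (rule normalized_h_modulus)
    show "\<forall>x. 0 < E.normalized_h x" using E.normalized_h_pos by blast
    show "transfer_operator T f E.normalized_h = (\<lambda>x. \<kappa> * E.normalized_h x)" by (rule normalized_h_eigen)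
    show "\<forall>c. c \<noteq> complex_of_real \<kappa> \<and> \<kappa> \<le> cmod c \<longrightarrow>
        \<not> eigenvalue_on (continuous_functions :: (circle \<Rightarrow> complex) set) (transfer_operator T f) c"
      using E.no_other_peripheral_eigenvalue by blast
    show "(\<integral>x. E.normalized_h x \<partial>E.\<nu>) = 1" by (rule E.integral_normalized_h)
    show "\<forall>\<phi> \<in> (continuous_functions :: (circle \<Rightarrow> real) set).
        uniform_limit UNIV (\<lambda>n x. (transfer_operator T f ^^ n) \<phi> x / \<kappa> ^ n)
          (\<lambda>x. E.normalized_h x * (\<integral>y. \<phi> y \<partial>E.\<nu>)) sequentially"
      using E.L_iter_converges by (simp add: continuous_functions_def)
    show "let \<mu> = density E.\<nu> (\<lambda>x. ennreal (E.normalized_h x)) in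
        \<mu> \<in> invariant_measures T \<and>
        metric_entropy \<mu> T + ereal (\<integral>x. f x \<partial>\<mu>) = ereal (ln \<kappa>) \<and>
        ereal (ln \<kappa>) = pressure T f \<and>
        (\<forall>m \<in> invariant_measures T. m \<noteq> \<mu> \<longrightarrow>
          metric_entropy m T + ereal (\<integral>x. f x \<partial>m) < pressure T f) \<and>
        (\<exists>r0>0. \<forall>r. 0 < r \<and> r < r0 \<longrightarrow>
          (\<exists>K>0. \<forall>x. \<forall>n\<ge>1.
            let q = measure \<mu> (bowen_ball T n r x) /
                    exp (birkhoff_sum T f n x - real n * real_of_ereal (pressure T f))
            in 1 / K \<le> q \<and> q \<le> K))"
      unfolding E.mu_eq_density[symmetric] Let_def E.pressure_eq
    proof (intro conjI)
      show "\<exists>r0>0. \<forall>r. 0 < r \<and> r < r0 \<longrightarrow>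
          (\<exists>K>0. \<forall>x. \<forall>n\<ge>1. 1 / K \<le> measure \<mu> (bowen_ball T n r x) /
              exp (birkhoff_sum T f n x - real n * real_of_ereal (ereal (ln \<kappa>))) \<and>
            measure \<mu> (bowen_ball T n r x) /
              exp (birkhoff_sum T f n x - real n * real_of_ereal (ereal (ln \<kappa>))) \<le> K)"
      proof (rule exI[of _ "1 / 6"], intro conjI allI impI)
        fix r :: real assume "0 < r \<and> r < 1 / 6"
        then show "\<exists>K>0. \<forall>x. \<forall>n\<ge>1. 1 / K \<le> measure \<mu> (bowen_ball T n r x) /
              exp (birkhoff_sum T f n x - real n * real_of_ereal (ereal (ln \<kappa>))) \<and>
            measure \<mu> (bowen_ball T n r x) /
              exp (birkhoff_sum T f n x - real n * real_of_ereal (ereal (ln \<kappa>))) \<le> K"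
          using E.gibbs_property[of r] by simp blast
      qed simp
    qed (use E.mu_invariant E.mu_equilibrium strict in auto)
  qed
qed

end
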